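(* Let $d\ge1$, $m\ge1$. Let $u_0\in L^\infty(\mathbb{T}^d)$ be nonnegative and let $u$ be a solution, constructed by vanishing viscosity (see context), of $$\partial_t u-\operatorname{div}(u^m\nabla \mathsf g\ast u)=0 \ \text{ in } (0,\infty)\times\mathbb{T}^d,\qquad u|_{t=0}=u_0 .$$ Define $S(t):=|\operatorname{supp}u(t)|=|\operatorname{supp}u_*(t)|$ and let $S_0:=S(0)<1$. (a) Under the condition $$\limsup_{s\to S_0^-}\frac1{(S_0-s)^{\frac m{m-1}}}\int_{s<\sigma<S_0}(u_0)_*(\sigma)\,d\sigma=+\infty,$$ there is no waiting time, i.e. for a.e. $t>0$, $S(t)>S_0$. (b) By contrast, if $u^{m-1}\in C^{0,1}([0,T_* )\times\mathbb{T}^d)$ for some $T_*>0$, then $S(t)=S_0$ for all $t<T_*$.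
   Context: $\mathbb{T}^d=\mathbb{R}^d/\mathbb{Z}^d$ is the $d$-dimensional torus of unit volume; $\mathsf g$ is the mean-zero Green kernel on $\mathbb{T}^d$, i.e. $-\Delta\mathsf g=\delta_0-1$; convolution is in the space variable. $|E|$ is Lebesgue measure. Decreasing rearrangement: for measurable $f:\mathbb{T}^d\to\mathbb{R}$, $f_*:[0,1]\to\mathbb{R}$ is $f_*(s)=\inf\{\tau\in\mathbb{R}:|\{f>\tau\}|\le s\}$ for $0\le s<1$ and $f_*(1)=\operatorname{ess\,inf}f$. For $u=u(t,x)$, $u_*(t,s)=(u(t))_*(s)$. The measure of the support is understood as the measure of the positivity set: $|\operatorname{supp}u(t)|=|\{x:u(t,x)>0\}|=|\{s:u_*(t,s)>0\}|$. Vanishing viscosity construction: for $\varepsilon>0$ let $u_{0,\varepsilon}=u_0\ast\omega_\varepsilon$ with $\omega_\varepsilon$ smooth mollifiers, and let $u_\varepsilon$ be the unique classical solution of $\partial_tu_\varepsilon-\operatorname{div}(u_\varepsilon^m\nabla\mathsf g\ast u_\varepsilon)=\varepsilon\Delta u_\varepsilon$ on $(0,\infty)\times\mathbb{T}^d$, $u_\varepsilon|_{t=0}=u_{0,\varepsilon}$ (its existence and uniqueness are taken for granted). A constructed solution $u$ is a limit of $u_\varepsilon$ along a sequence $\varepsilon\to0$, with $u_\varepsilon(t)\to u(t)$ strongly in $L^1(\mathbb{T}^d)$ for a.e. $t>0$. Such a $u$ is an entropy solution: $u\ge0$, $u\in L^\infty(\mathbb{R}_+\times\mathbb{T}^d)$,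 $u$ solves the equation in the weak sense with datum $u_0$, and $\partial_t\eta(u)\le\operatorname{div}(q(u)\nabla\mathsf g\ast u)+(q(u)-\eta'(u)u^m)(u-\bar u)$ in distributions for all convex $\eta\in C^2$, $q'(\xi)=m\eta'(\xi)\xi^{m-1}$, where $\bar u=\int_{\mathbb{T}^d}u\,dx$.
   Formalization: At m=1, where m/(m-1) is undefined and (b) with u^0=1 would fail (S grows for indicator data), (S_0-s)^{m/(m-1)} is read as 0, so the condition in (a) holds whenever S_0>0, and u^{m-1} in (b) is read as the indicator of {u>0}. *)

theory Defs
  imports "HOL-Analysis.Analysis"
begin

text \<open>
  The torus of dimension \<open>d = CARD('n)\<close> is represented by \<open>\<int>\<^sup>d\<close>-periodic functions on
  \<open>real ^ 'n\<close>, integrated over the closed unit cube (a fundamental domain up to a null set).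
\<close>

definition periodic :: "(real ^ 'n \<Rightarrow> 'b) \<Rightarrow> bool" where
  "periodic f \<longleftrightarrow> (\<forall>x i. f (x + axis i 1) = f x)"

abbreviation torus :: "(real ^ 'n) measure" where
  "torus \<equiv> lebesgue_on (cbox 0 1)"

definition mean :: "(real ^ 'n \<Rightarrow> real) \<Rightarrow> real" where
  "mean f = (LINT x|torus. f x)"

definition conv :: "(real ^ 'n \<Rightarrow> real) \<Rightarrow> (real ^ 'n \<Rightarrow> real) \<Rightarrow> real ^ 'n \<Rightarrow> real" where
  "conv f h x = (LINT y|torus. f (x - y) * h y)"


section \<open>Differential operators\<close>

definition dderiv :: "'a::euclidean_space \<Rightarrow> ('a \<Rightarrow> real) \<Rightarrow> 'a \<Rightarrow> real" where
  "dderiv v f x = frechet_derivative f (at x) v"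

definition grad :: "(real ^ 'n \<Rightarrow> real) \<Rightarrow> real ^ 'n \<Rightarrow> real ^ 'n" where
  "grad f x = (\<chi> i. dderiv (axis i 1) f x)"

definition divergence :: "(real ^ 'n \<Rightarrow> real ^ 'n) \<Rightarrow> real ^ 'n \<Rightarrow> real" where
  "divergence F x = (\<Sum>i\<in>UNIV. dderiv (axis i 1) (\<lambda>y. F y $ i) x)"

definition laplacian :: "(real ^ 'n \<Rightarrow> real) \<Rightarrow> real ^ 'n \<Rightarrow> real" where
  "laplacian f = divergence (grad f)"

primrec C_k :: "nat \<Rightarrow> ('a::euclidean_space \<Rightarrow> real) \<Rightarrow> bool" where
  "C_k 0 f \<longleftrightarrow> continuous_on UNIV f"
| "C_k (Suc k) f \<longleftrightarrow> (\<forall>x. f differentiable (at x)) \<and> (\<forall>i\<in>Basis. C_k k (dderiv i f))"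

definition smooth :: "('a::euclidean_space \<Rightarrow> real) \<Rightarrow> bool" where
  "smooth f \<longleftrightarrow> (\<forall>k. C_k k f)"


section \<open>Green kernel and mollifiers\<close>

text \<open>\<open>- \<Delta> g = \<delta>\<^sub>0 - 1\<close> in the sense of distributions, which together with the zero mean determines
  \<open>g\<close> up to a null set.\<close>

definition green_kernel :: "(real ^ 'n \<Rightarrow> real) \<Rightarrow> bool" where
  "green_kernel g \<longleftrightarrow>
     periodic g \<and> integrable torus g \<and> mean g = 0 \<and>
     (\<forall>\<phi>. periodic \<phi> \<and> smooth \<phi> \<longrightarrow>
        - (LINT x|torus. g x * laplacian \<phi> x) = \<phi> 0 - (LINT x|torus. \<phi> x))"

text \<open>The distance to \<open>0\<close> on the torus is the distance to the integer lattice on \<open>real ^ 'n\<close>.\<close>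

definition mollifiers :: "(real \<Rightarrow> real ^ 'n \<Rightarrow> real) \<Rightarrow> bool" where
  "mollifiers \<omega> \<longleftrightarrow>
     (\<forall>\<epsilon>>0. periodic (\<omega> \<epsilon>) \<and> smooth (\<omega> \<epsilon>) \<and> (\<forall>x. 0 \<le> \<omega> \<epsilon> x) \<and> mean (\<omega> \<epsilon>) = 1) \<and>
     (\<forall>\<delta>>0. \<forall>\<^sub>F \<epsilon> in at_right 0.
        \<forall>x. infdist x {z. \<forall>i. z $ i \<in> \<int>} \<ge> \<delta> \<longrightarrow> \<omega> \<epsilon> x = 0)"


section \<open>The equation\<close>

text \<open>Since \<open>g\<close> is only given up to null sets, \<open>\<nabla>g * u\<close> is expressed as \<open>\<nabla>(g * u)\<close>.\<close>

definition velocity :: "(real ^ 'n \<Rightarrow> real) \<Rightarrow> (real ^ 'n \<Rightarrow> real) \<Rightarrow> real ^ 'n \<Rightarrow> real ^ 'n" where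
  "velocity g v = grad (conv g v)"

definition classical_viscous_solution ::
  "real \<Rightarrow> (real ^ 'n \<Rightarrow> real) \<Rightarrow> real \<Rightarrow> (real ^ 'n \<Rightarrow> real) \<Rightarrow> (real \<Rightarrow> real ^ 'n \<Rightarrow> real) \<Rightarrow> bool"
  where
  "classical_viscous_solution m g \<epsilon> v0 v \<longleftrightarrow>
     (\<forall>t\<ge>0. periodic (v t) \<and> (\<forall>x. 0 \<le> v t x)) \<and>
     v 0 = v0 \<and>
     continuous_on ({0..} \<times> UNIV) (\<lambda>(t, x). v t x) \<and>
     (\<forall>t>0. C_k 2 (v t)) \<and>
     (\<forall>t>0. \<forall>x. (\<lambda>\<tau>. v \<tau> x) differentiable (at t)) \<and>
     continuous_on ({0<..} \<times> UNIV) (\<lambda>(t, x). deriv (\<lambda>\<tau>. v \<tau> x) t) \<and>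
     (\<forall>i\<in>Basis. continuous_on ({0<..} \<times> UNIV) (\<lambda>(t, x). dderiv i (v t) x)) \<and>
     (\<forall>i\<in>Basis. \<forall>j\<in>Basis.
        continuous_on ({0<..} \<times> UNIV) (\<lambda>(t, x). dderiv j (dderiv i (v t)) x)) \<and>
     (\<forall>t>0. \<forall>x.
        deriv (\<lambda>\<tau>. v \<tau> x) t - divergence (\<lambda>y. (v t y powr m) *\<^sub>R velocity g (v t) y) x
          = \<epsilon> * laplacian (v t) x)"

text \<open>Test functions on \<open>[0, \<infinity>) \<times> \<T>\<^sup>d\<close>, as restrictions of smooth functions on the whole space,
  and on \<open>(0, \<infinity>) \<times> \<T>\<^sup>d\<close>.\<close>

definition test_closed :: "(real \<times> (real ^ 'n) \<Rightarrow> real) \<Rightarrow> bool" where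
  "test_closed \<phi> \<longleftrightarrow> smooth \<phi> \<and> (\<forall>t. periodic (\<lambda>x. \<phi> (t, x))) \<and>
     (\<exists>b. \<forall>t x. t \<ge> b \<longrightarrow> \<phi> (t, x) = 0)"

definition test_open :: "(real \<times> (real ^ 'n) \<Rightarrow> real) \<Rightarrow> bool" where
  "test_open \<phi> \<longleftrightarrow> smooth \<phi> \<and> (\<forall>t. periodic (\<lambda>x. \<phi> (t, x))) \<and>
     (\<exists>a>0. \<exists>b. \<forall>t x. t \<notin> {a..b} \<longrightarrow> \<phi> (t, x) = 0)"

abbreviation spacetime :: "(real \<times> (real ^ 'n)) measure" where
  "spacetime \<equiv> lebesgue_on ({0..} \<times> cbox 0 1)"

definition weak_solution ::
  "real \<Rightarrow> (real ^ 'n \<Rightarrow> real) \<Rightarrow> (real ^ 'n \<Rightarrow> real) \<Rightarrow> (real \<Rightarrow> real ^ 'n \<Rightarrow> real) \<Rightarrow> bool"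
  where
  "weak_solution m g u0 u \<longleftrightarrow>
     (\<forall>\<phi>. test_closed \<phi> \<longrightarrow>
        (LINT (t, x)|spacetime. u t x * dderiv (1, 0) \<phi> (t, x)
           - (u t x powr m) * (velocity g (u t) x \<bullet> grad (\<lambda>y. \<phi> (t, y)) x))
        + (LINT x|torus. u0 x * \<phi> (0, x)) = 0)"

text \<open>The entropy flux \<open>q\<close> is any primitive of \<open>m \<eta>'(\<xi>) \<xi>\<^sup>m\<^sup>-\<^sup>1\<close> on \<open>[0, \<infinity>)\<close>.  The derivative is required
  for \<open>\<xi> > 0\<close> only because \<open>0 powr 0 = 0\<close> would give a wrong value at \<open>\<xi> = 0\<close> when \<open>m = 1\<close>.\<close>

definition entropy_inequalities ::
  "real \<Rightarrow> (real ^ 'n \<Rightarrow> real) \<Rightarrow> (real \<Rightarrow> real ^ 'n \<Rightarrow> real) \<Rightarrow> bool"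
  where
  "entropy_inequalities m g u \<longleftrightarrow>
     (\<forall>\<eta> q \<phi>. C_k 2 \<eta> \<and> convex_on UNIV \<eta> \<and>
        continuous_on {0..} q \<and>
        (\<forall>\<xi>>0. (q has_real_derivative m * deriv \<eta> \<xi> * \<xi> powr (m - 1)) (at \<xi>)) \<and>
        test_open \<phi> \<and> (\<forall>z. 0 \<le> \<phi> z) \<longrightarrow>
        0 \<le> (LINT (t, x)|spacetime. \<eta> (u t x) * dderiv (1, 0) \<phi> (t, x)
               - q (u t x) * (velocity g (u t) x \<bullet> grad (\<lambda>y. \<phi> (t, y)) x)
               + (q (u t x) - deriv \<eta> (u t x) * u t x powr m) * (u t x - mean (u t)) * \<phi> (t, x)))"

definition essentially_bounded :: "'a measure \<Rightarrow> ('a \<Rightarrow> real) \<Rightarrow> bool" where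
  "essentially_bounded M f \<longleftrightarrow> f \<in> borel_measurable M \<and> (\<exists>B. AE x in M. \<bar>f x\<bar> \<le> B)"

text \<open>\<open>u\<close> is a pointwise defined representative on \<open>[0, \<infinity>) \<times> \<T>\<^sup>d\<close>, nonnegative and with
  \<open>u(0) = u0\<close> almost everywhere.\<close>

definition entropy_solution ::
  "real \<Rightarrow> (real ^ 'n \<Rightarrow> real) \<Rightarrow> (real ^ 'n \<Rightarrow> real) \<Rightarrow> (real \<Rightarrow> real ^ 'n \<Rightarrow> real) \<Rightarrow> bool"
  where
  "entropy_solution m g u0 u \<longleftrightarrow>
     (\<forall>t\<ge>0. periodic (u t) \<and> (\<forall>x. 0 \<le> u t x)) \<and>
     (AE x in torus. u 0 x = u0 x) \<and>
     essentially_bounded spacetime (\<lambda>(t, x). u t x) \<and>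
     weak_solution m g u0 u \<and> entropy_inequalities m g u"

definition vanishing_viscosity_limit ::
  "real \<Rightarrow> (real ^ 'n \<Rightarrow> real) \<Rightarrow> (real ^ 'n \<Rightarrow> real) \<Rightarrow> (real \<Rightarrow> real ^ 'n \<Rightarrow> real) \<Rightarrow> bool"
  where
  "vanishing_viscosity_limit m g u0 u \<longleftrightarrow>
     (\<exists>\<omega> (\<epsilon> :: nat \<Rightarrow> real) v.
        mollifiers \<omega> \<and> (\<forall>k. \<epsilon> k > 0) \<and> \<epsilon> \<longlonglongrightarrow> 0 \<and>
        (\<forall>k. classical_viscous_solution m g (\<epsilon> k) (conv u0 (\<omega> (\<epsilon> k))) (v k)) \<and>
        (AE t in lebesgue_on {0<..}. integrable torus (u t) \<and>
           (\<lambda>k. LINT x|torus. \<bar>v k t x - u t x\<bar>) \<longlonglongrightarrow> 0))"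

definition constructed_solution ::
  "real \<Rightarrow> (real ^ 'n \<Rightarrow> real) \<Rightarrow> (real ^ 'n \<Rightarrow> real) \<Rightarrow> (real \<Rightarrow> real ^ 'n \<Rightarrow> real) \<Rightarrow> bool"
  where
  "constructed_solution m g u0 u \<longleftrightarrow>
     entropy_solution m g u0 u \<and> vanishing_viscosity_limit m g u0 u"


section \<open>Rearrangement and support\<close>

text \<open>Meaningful for \<open>s \<in> [0, 1]\<close>; the value at \<open>1\<close> is the essential infimum.\<close>

definition decreasing_rearrangement :: "(real ^ 'n \<Rightarrow> real) \<Rightarrow> real \<Rightarrow> real" where
  "decreasing_rearrangement f s =
     (if s = 1 then Sup {\<tau>. AE x in torus. \<tau> \<le> f x}
      else Inf {\<tau>. measure torus {x \<in> cbox 0 1. f x > \<tau>} \<le> s})"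

definition support_size :: "(real ^ 'n \<Rightarrow> real) \<Rightarrow> real" where
  "support_size f = measure torus {x \<in> cbox 0 1. f x > 0}"

text \<open>\<open>r\<close> to the power \<open>m / (m - 1)\<close> for \<open>0 < r < 1\<close>.  For \<open>m = 1\<close> the exponent is \<open>\<infinity>\<close> and the power
  is \<open>0\<close>, the limit as \<open>m\<close> tends to \<open>1\<close> from above (\<open>m / (m - 1)\<close> itself would be \<open>0\<close> in HOL).\<close>

definition critical_power :: "real \<Rightarrow> real \<Rightarrow> real" where
  "critical_power m r = (if m = 1 then 0 else r powr (m / (m - 1)))"

text \<open>The quotient is taken in \<open>ereal\<close>, where \<open>a / 0 = \<infinity>\<close> for \<open>a > 0\<close>.  The limit from the left is
  restricted to \<open>s \<ge> 0\<close>, the domain of the rearrangement, so for \<open>S0 = 0\<close> the condition fails.\<close>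

definition no_waiting_condition :: "real \<Rightarrow> real \<Rightarrow> (real ^ 'n \<Rightarrow> real) \<Rightarrow> bool" where
  "no_waiting_condition m S0 u0 \<longleftrightarrow>
     Limsup (at S0 within {0..<S0})
       (\<lambda>s. ereal (LINT \<sigma>:{s<..<S0}|lebesgue. decreasing_rearrangement u0 \<sigma>)
             / ereal (critical_power m (S0 - s))) = \<infinity>"

text \<open>Pitfall for \<open>m = 1\<close>: with \<open>0 powr 0 = 0\<close>, the power \<open>u powr (m - 1)\<close> is the indicator of
  \<open>{u > 0}\<close>, again the limit as \<open>m\<close> tends to \<open>1\<close> from above, and not the constant \<open>1\<close>, for which a
  Lipschitz hypothesis would be void.\<close>

end

theory Submission
  imports Defs
begin

text \<open>
  Write \<open>p = g * u\<close> and let \<open>U\<close> be the conserved mean of \<open>u\<close>. As \<open>- \<Delta> p = u - U\<close>, the equation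
  reads \<open>\<partial>\<^sub>t u = \<nabla>u\<^sup>m \<bullet> \<nabla>p - u\<^sup>m (u - U)\<close>. Both parts rest on this form of it, but on different
  consequences.

  No waiting time. For a solution \<open>v\<close> of the viscous equation and a concave \<open>\<beta>\<close>, the integral of \<open>\<beta>(v)\<close>
  grows at least at the rate \<open>\<integral> Q(v) (v - U)\<close>, where \<open>Q' = - \<beta>'' \<xi>\<^sup>m\<close>; the viscosity has a favourable sign
  (\<open>viscous_evolution\<close>). Let \<open>\<beta>\<close> be a truncation at a small height \<open>\<tau>\<close>. Then \<open>Q\<close> is constant above \<open>\<tau>\<close>, and
  since \<open>v - U\<close> has mean zero the rate equals \<open>\<integral> (Q(\<tau>) - Q(v)) (U - v)\<close>. This only sees points with
  \<open>v < \<tau> \<le> U / 2\<close>, so it is nonnegative and at least a constant times \<open>\<tau>\<^sup>m |{v < \<tau> / 2}|\<close>. Because the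
  integrals increase, a bound on \<open>|{v \<ge> \<tau> / 2}|\<close> at one time holds at all earlier times. Hence the final
  time alone controls the growth (\<open>viscous_spreading\<close>), and the inequality passes to the limit of vanishing
  viscosity at every time at which the approximations converge (\<open>limit_spreading\<close>). For the initial datum one inequality is enough, and Jensen gives it: averaging increases the integral of a
  concave function.

  If \<open>S(t) \<le> S(0)\<close>, the truncated integral at time \<open>t\<close> is at most \<open>\<tau> S(0) / 3\<close>, while it has grown by at
  least \<open>c \<tau>\<^sup>m\<close>. Comparison with the datum gives \<open>|{0 < u0 < \<tau>}| \<ge> c' \<tau>\<^sup>m\<^sup>-\<^sup>1\<close> for all small \<open>\<tau>\<close>: the datum
  has a thin tail. For \<open>m > 1\<close> this bounds the rearrangement by a multiple of \<open>(S(0) - s)\<close> to the power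
  \<open>1 / (m - 1)\<close>, and the limit superior in the hypothesis is finite. For \<open>m = 1\<close> it contradicts the
  continuity of the measure.

  Waiting time. If \<open>w = u\<^sup>m\<^sup>-\<^sup>1\<close> is Lipschitz and \<open>m > 1\<close>, then \<open>(m - 1) u\<^sup>m\<^sup>-\<^sup>1 \<nabla>u = u \<nabla>w\<close>, so that formally
  \<open>|\<partial>\<^sub>t u| \<le> K u\<close>. Every value \<open>u(t, x)\<close> thus changes by at most the factor \<open>exp(K t)\<close>, and the positivity
  set is constant in time, pointwise (\<open>stationary_positivity_set\<close>). To make this rigorous the weak
  formulation is tested with products of a function of time and a mollifier in space. The flux is estimated
  by the density after mollification of \<open>u\<^sup>m\<close>, whose local Lipschitz constant is proportional to \<open>u\<close>
  (\<open>flux_bound\<close>), and a Gronwall argument in the sense of distributions concludes. For \<open>m = 1\<close> the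
  hypothesis says that the indicator of the positivity set is continuous, hence constant in time.

  The kernel \<open>g\<close> is only known to be integrable and to satisfy its equation in the sense of distributions.
  Derivatives therefore always fall on the other factor of \<open>g * u\<close>. When \<open>u\<close> is merely continuous, the
  existence, continuity and boundedness of \<open>\<nabla>(g * u)\<close> come from an interior gradient estimate for the
  Poisson equation, proved by comparison (\<open>gradient_estimate\<close>), which controls \<open>\<nabla>(g * v)\<close> by the supremum of
  \<open>|v|\<close> for smooth \<open>v\<close> and so allows approximation.
\<close>

section \<open>Integrals of periodic functions\<close>

abbreviation pd :: "'n \<Rightarrow> (real ^ 'n \<Rightarrow> real) \<Rightarrow> real ^ 'n \<Rightarrow> real" where
  "pd i \<equiv> dderiv (axis i 1)"

lemma periodic_add_axis: "periodic f \<Longrightarrow> f (x + axis i 1) = f x"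
  by (simp add: periodic_def)

lemma periodic_diff_axis:
  assumes "periodic f"
  shows "f (x - axis i 1) = f x"
  using periodic_add_axis[OF assms, of "x - axis i 1" i] by simp

lemma periodic_add_int_axis:
  assumes "periodic f"
  shows "f (x + of_int k *\<^sub>R axis i 1) = f x"
proof (induction k rule: int_induct[where k = 0])
  case (step1 k)
  have "x + of_int (k + 1) *\<^sub>R axis i 1 = (x + of_int k *\<^sub>R axis i 1) + axis i (1::real)"
    by (simp add: algebra_simps)
  then show ?case using periodic_add_axis[OF assms] step1 by metis
next
  case (step2 k)
  have "x + of_int (k - 1) *\<^sub>R axis i 1 = (x + of_int k *\<^sub>R axis i 1) - axis i (1::real)"
    by (simp add: algebra_simps)
  then show ?case using periodic_diff_axis[OF assms] step2 by metis
qed simp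

lemma sum_axis: "(\<Sum>i\<in>UNIV. (z $ i) *\<^sub>R axis i 1) = (z :: real ^ 'n)"
  using basis_expansion[of z] by (simp add: scalar_mult_eq_scaleR)

lemma periodic_add_lattice:
  fixes z :: "real ^ 'n"
  assumes f: "periodic f" and z: "\<And>i. z $ i \<in> \<int>"
  shows "f (x + z) = f x"
proof -
  have "f (x + (\<Sum>i\<in>A. (z $ i) *\<^sub>R axis i 1)) = f x" if "finite A" for A :: "'n set"
    using that
  proof (induction A arbitrary: x)
    case (insert j A)
    obtain k where k: "z $ j = of_int k" using z[of j] by (auto elim: Ints_cases)
    have "f (x + (\<Sum>i\<in>insert j A. (z $ i) *\<^sub>R axis i 1))
        = f ((x + (\<Sum>i\<in>A. (z $ i) *\<^sub>R axis i 1)) + of_int k *\<^sub>R axis j 1)"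
      using insert by (simp add: k add_ac)
    then show ?case using periodic_add_int_axis[OF f] insert.IH by simp
  qed simp
  from this[of UNIV] show ?thesis by (simp add: sum_axis)
qed

lemma periodic_shift: "periodic f \<Longrightarrow> periodic (\<lambda>x. f (x + a))"
  by (simp add: periodic_def add_ac) (metis add.commute add.assoc)

lemma periodic_reflect: "periodic f \<Longrightarrow> periodic (\<lambda>x. f (a - x))"
  using periodic_diff_axis[of f] by (simp add: periodic_def diff_diff_eq[symmetric])

lemma axis_in_Basis: "axis i (1::real) \<in> (Basis :: (real ^ 'n) set)"
  by (simp add: axis_in_Basis_iff)

lemma Basis_axisE:
  assumes "b \<in> (Basis :: (real ^ 'n) set)"
  obtains i where "b = axis i 1"
  using assms by (auto simp: Basis_vec_def)

text \<open>
  The shifted cube is cut at the face of the unit cube; the part that sticks out is moved back by a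
  period. The Henstock-Kurzweil integral is used because it can be cut along hyperplanes; absolute
  integrability is recovered in \<open>torus_transport\<close> by applying the result to \<open>\<bar>f\<bar>\<close> as well.
\<close>

lemma has_integral_shift_unit_cube_axis:
  fixes f :: "real ^ 'n \<Rightarrow> real"
  assumes f: "periodic f" and I: "(f has_integral I) (cbox 0 1)" and s: "0 \<le> s" "s \<le> 1"
  shows "((\<lambda>x. f (x + s *\<^sub>R axis i 1)) has_integral I) (cbox 0 1)"
proof -
  define e where "e = (axis i 1 :: real ^ 'n)"
  have e: "e \<in> Basis" "e \<noteq> 0" "e \<bullet> e = 1" 
    by (auto simp: e_def axis_in_Basis inner_axis_axis)
  define C where "C = cbox (0 :: real ^ 'n) 1"
  have box: "cbox a b \<inter> {x. x \<bullet> e \<le> c} = cbox a (\<Sum>k\<in>Basis. (if k = e then min (b \<bullet> e) c else b \<bullet> k) *\<^sub>R k)"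
    "cbox a b \<inter> {x. x \<bullet> e \<ge> c} = cbox (\<Sum>k\<in>Basis. (if k = e then max (a \<bullet> e) c else a \<bullet> k) *\<^sub>R k) b"
    for a b :: "real ^ 'n" and c
    using interval_split[OF e(1)] by auto
  have "f integrable_on C" using I by (auto simp: C_def)
  then have i12: "f integrable_on C \<inter> {x. x \<bullet> e \<le> s}" "f integrable_on C \<inter> {x. x \<bullet> e \<ge> s}"
    unfolding C_def using integrable_split[OF _ e(1)] by blast+
  then obtain I1 I2 where I1: "(f has_integral I1) (C \<inter> {x. x \<bullet> e \<le> s})"
    and I2: "(f has_integral I2) (C \<inter> {x. x \<bullet> e \<ge> s})"
    by (auto simp: integrable_on_def)
  have "I = I1 + I2"
    using has_integral_split[OF I1[unfolded C_def] I2[unfolded C_def] e(1)] I by (metis has_integral_unique)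
  have inner1: "x \<bullet> k = x $ j" if "k = axis j 1" for x k :: "real ^ 'n" and j
    using that by (simp add: inner_axis)
  have mem: "x \<in> C \<longleftrightarrow> (\<forall>j. 0 \<le> x $ j \<and> x $ j \<le> 1)" for x
    by (auto simp: C_def mem_box_cart)
  have ej: "e $ j = (if j = i then 1 else 0)" for j by (simp add: e_def axis_def)
  have xe: "x \<bullet> e = x $ i" for x by (simp add: e_def inner_axis)
  have sh: "((\<lambda>x. f (x + c)) has_integral J) ((\<lambda>x. x - c) ` (cbox a b))"
    if "(f has_integral J) (cbox a b)" for c J a b
    using has_integral_affinity[OF that, of 1 c] by simp
  have "((\<lambda>x. f (x + s *\<^sub>R e)) has_integral I2) ((\<lambda>x. x - s *\<^sub>R e) ` (C \<inter> {x. x \<bullet> e \<ge> s}))"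
    using I2 unfolding C_def box by (rule sh)
  also have "(\<lambda>x. x - s *\<^sub>R e) ` (C \<inter> {x. x \<bullet> e \<ge> s}) = C \<inter> {x. x \<bullet> e \<le> 1 - s}"
  proof (intro set_eqI iffI)
    fix x assume "x \<in> C \<inter> {x. x \<bullet> e \<le> 1 - s}"
    then have "x + s *\<^sub>R e \<in> C \<inter> {x. x \<bullet> e \<ge> s}" using s by (auto simp: mem ej xe add_increasing2) 
    then have "(x + s *\<^sub>R e) - s *\<^sub>R e \<in> (\<lambda>x. x - s *\<^sub>R e) ` (C \<inter> {x. x \<bullet> e \<ge> s})" by blast
    then show "x \<in> (\<lambda>x. x - s *\<^sub>R e) ` (C \<inter> {x. x \<bullet> e \<ge> s})" by simp
  qed (use s in \<open>auto simp: mem ej xe\<close>, (smt (verit))+)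
  finally have A: "((\<lambda>x. f (x + s *\<^sub>R e)) has_integral I2) (C \<inter> {x. x \<bullet> e \<le> 1 - s})" .
  have "((\<lambda>x. f (x + (s - 1) *\<^sub>R e)) has_integral I1) ((\<lambda>x. x - (s - 1) *\<^sub>R e) ` (C \<inter> {x. x \<bullet> e \<le> s}))"
    using I1 unfolding C_def box by (rule sh)
  also have "(\<lambda>x. x - (s - 1) *\<^sub>R e) ` (C \<inter> {x. x \<bullet> e \<le> s}) = C \<inter> {x. x \<bullet> e \<ge> 1 - s}"
  proof (intro set_eqI iffI)
    fix x assume "x \<in> C \<inter> {x. x \<bullet> e \<ge> 1 - s}"
    then have "x + (s - 1) *\<^sub>R e \<in> C \<inter> {x. x \<bullet> e \<le> s}" using s by (auto simp: mem ej xe) (smt (verit))+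
    then have "(x + (s - 1) *\<^sub>R e) - (s - 1) *\<^sub>R e \<in> (\<lambda>x. x - (s - 1) *\<^sub>R e) ` (C \<inter> {x. x \<bullet> e \<le> s})" by blast
    then show "x \<in> (\<lambda>x. x - (s - 1) *\<^sub>R e) ` (C \<inter> {x. x \<bullet> e \<le> s})" by simp
  qed (use s in \<open>auto simp: mem ej xe\<close>, (smt (verit))+)
  also have "(\<lambda>x. f (x + (s - 1) *\<^sub>R e)) = (\<lambda>x. f (x + s *\<^sub>R e))"
  proof
    fix x show "f (x + (s - 1) *\<^sub>R e) = f (x + s *\<^sub>R e)"
    using periodic_diff_axis[OF f, of "x + s *\<^sub>R e" i] by (simp add: e_def algebra_simps)
  qed
  finally have B: "((\<lambda>x. f (x + s *\<^sub>R e)) has_integral I1) (C \<inter> {x. x \<bullet> e \<ge> 1 - s})" .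
  show ?thesis
    using has_integral_split[OF A[unfolded C_def] B[unfolded C_def] e(1)] \<open>I = I1 + I2\<close>
    by (simp add: e_def add.commute)
qed

text \<open>
  A general shift is a composition of shifts along the axes, each by a fractional part and an integer.
\<close>

lemma has_integral_shift_unit_cube:
  fixes f :: "real ^ 'n \<Rightarrow> real"
  assumes f: "periodic f" and I: "(f has_integral I) (cbox 0 1)"
  shows "((\<lambda>x. f (x + a)) has_integral I) (cbox 0 1)"
proof -
  have "((\<lambda>x. f (x + (\<Sum>i\<in>A. (a $ i) *\<^sub>R axis i 1))) has_integral I) (cbox 0 1)" if "finite A" for A :: "'n set"
    using that
  proof (induction A)
    case empty
    then show ?case using I by simp
  next
    case (insert j A)
    let ?b = "\<Sum>i\<in>A. (a $ i) *\<^sub>R axis i 1 :: real ^ 'n"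
    have "((\<lambda>x. f ((x + frac (a $ j) *\<^sub>R axis j 1) + ?b)) has_integral I) (cbox 0 1)"
      by (rule has_integral_shift_unit_cube_axis[OF periodic_shift[OF f] insert.IH])
         (auto simp: frac_ge_0 less_imp_le frac_lt_1)
    moreover have "f ((x + frac (a $ j) *\<^sub>R axis j 1) + ?b) = f (x + (\<Sum>i\<in>insert j A. (a $ i) *\<^sub>R axis i 1))" for x
    proof -
      have "f (x + (\<Sum>i\<in>insert j A. (a $ i) *\<^sub>R axis i 1))
          = f (((x + frac (a $ j) *\<^sub>R axis j 1) + ?b) + of_int \<lfloor>a $ j\<rfloor> *\<^sub>R axis j 1)"
        using insert by (simp add: frac_def algebra_simps)
      then show ?thesis using periodic_add_int_axis[OF f] by simp
    qed
    ultimately show ?case by simp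
  qed
  from this[of UNIV] show ?thesis by (simp add: sum_axis)
qed

lemma has_integral_reflect_unit_cube:
  fixes f :: "real ^ 'n \<Rightarrow> real"
  assumes f: "periodic f" and I: "(f has_integral I) (cbox 0 1)"
  shows "((\<lambda>x. f (a - x)) has_integral I) (cbox 0 1)"
proof -
  have "((\<lambda>x. f (- x)) has_integral I) (cbox (- 1) (- 0))"
    using I by (subst has_integral_reflect)
  from has_integral_shift_cbox[OF this, of "- 1"]
  have "((\<lambda>x. f (- (x - 1))) has_integral I) (cbox 0 1)" by simp
  moreover have "periodic (\<lambda>x. f (- (x - 1)))"
    using periodic_reflect[OF f, of 1] by simp
  ultimately have "((\<lambda>x. f (- ((x + (1 - a)) - 1))) has_integral I) (cbox 0 1)"
    by (rule has_integral_shift_unit_cube[rotated])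
  then show ?thesis by (simp add: algebra_simps)
qed

lemma torus_integrable_iff:
  fixes f :: "real ^ 'n \<Rightarrow> real"
  shows "integrable torus f \<longleftrightarrow> f integrable_on cbox 0 1 \<and> (\<lambda>x. \<bar>f x\<bar>) integrable_on cbox 0 1"
  using absolutely_integrable_on_def[where f = f and S = "cbox 0 1"]
  by (simp add: integrable_restrict_space set_integrable_def)

lemma torus_has_integral:
  fixes f :: "real ^ 'n \<Rightarrow> real"
  shows "integrable torus f \<Longrightarrow> (f has_integral (LINT x|torus. f x)) (cbox 0 1)"
  by (rule has_integral_integral_lebesgue_on) auto

lemma torus_integral_eq:
  fixes f :: "real ^ 'n \<Rightarrow> real"
  shows "integrable torus f \<Longrightarrow> (LINT x|torus. f x) = integral (cbox 0 1) f"
  by (rule lebesgue_integral_eq_integral) auto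

lemma torus_transport:
  fixes f :: "real ^ 'n \<Rightarrow> real"
  assumes "periodic f" "integrable torus f"
    and T: "\<And>(h :: real ^ 'n \<Rightarrow> real) I. periodic h \<Longrightarrow> (h has_integral I) (cbox 0 1) \<Longrightarrow> ((\<lambda>x. h (T x)) has_integral I) (cbox 0 1)"
  shows "integrable torus (\<lambda>x. f (T x))" "(LINT x|torus. f (T x)) = (LINT x|torus. f x)"
proof -
  have "periodic (\<lambda>x. \<bar>f x\<bar>)" using assms(1) by (simp add: periodic_def)
  then show i: "integrable torus (\<lambda>x. f (T x))"
    using assms unfolding torus_integrable_iff by (meson T integrable_on_def)
  show "(LINT x|torus. f (T x)) = (LINT x|torus. f x)"
    using T[OF assms(1) torus_has_integral[OF assms(2)]] torus_has_integral[OF i] has_integral_unique by blast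
qed

lemmas torus_shift = torus_transport[where T = "\<lambda>x. x + a" for a, OF _ _ has_integral_shift_unit_cube]
lemmas torus_reflect = torus_transport[where T = "\<lambda>x. a - x" for a, OF _ _ has_integral_reflect_unit_cube]

section \<open>Periodic functions on the torus\<close>

lemma periodic_reduce:
  fixes x :: "real ^ 'n"
  obtains z where "\<And>i. z $ i \<in> \<int>" "x + z \<in> cbox 0 1"
proof
  show "(\<chi> i. - of_int \<lfloor>x $ i\<rfloor>) $ i \<in> (\<int> :: real set)" for i by simp
  have "0 \<le> x $ i - of_int \<lfloor>x $ i\<rfloor> \<and> x $ i - of_int \<lfloor>x $ i\<rfloor> \<le> 1" for i
    by linarith
  then show "x + (\<chi> i. - of_int \<lfloor>x $ i\<rfloor>) \<in> cbox 0 1"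
    by (simp add: mem_box_cart)
qed

lemma periodic_bounded:
  fixes f :: "real ^ 'n \<Rightarrow> real"
  assumes "periodic f" "continuous_on UNIV f"
  obtains B where "B > 0" "\<And>x. \<bar>f x\<bar> \<le> B"
proof -
  have "bounded (f ` cbox 0 1)"
    by (intro compact_imp_bounded compact_continuous_image continuous_on_subset[OF assms(2)]) auto
  then obtain B where B: "B > 0" "\<And>x. x \<in> cbox 0 1 \<Longrightarrow> \<bar>f x\<bar> \<le> B"
    unfolding bounded_pos by auto
  have "\<bar>f x\<bar> \<le> B" for x
  proof -
    obtain z where "\<And>i. z $ i \<in> \<int>" "x + z \<in> cbox 0 1" using periodic_reduce[of x] by blast
    then show ?thesis using B(2)[of "x + z"] periodic_add_lattice[OF assms(1), of z x] by simp
  qed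
  with B(1) show ?thesis using that by blast
qed

lemma periodic_uniformly_continuous:
  fixes f :: "real ^ 'n \<Rightarrow> real"
  assumes "periodic f" "continuous_on UNIV f" "e > 0"
  obtains d where "d > 0" "\<And>x y. dist x y < d \<Longrightarrow> \<bar>f x - f y\<bar> < e"
proof -
  have "uniformly_continuous_on (cbox (-1) 2) f"
    by (intro compact_uniformly_continuous continuous_on_subset[OF assms(2)]) auto
  then obtain d where d: "d > 0" "\<And>x y. x \<in> cbox (-1) 2 \<Longrightarrow> y \<in> cbox (-1) 2 \<Longrightarrow> dist x y < d \<Longrightarrow> \<bar>f x - f y\<bar> < e"
    unfolding uniformly_continuous_on_def dist_real_def using assms(3) by (metis dist_commute)
  have "\<bar>f x - f y\<bar> < e" if xy: "dist x y < min d 1" for x y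
  proof -
    obtain z where z: "\<And>i. z $ i \<in> \<int>" "x + z \<in> cbox 0 1" using periodic_reduce[of x] by blast
    have xz: "0 \<le> (x + z) $ i \<and> (x + z) $ i \<le> 1" for i using z(2) by (simp add: mem_box_cart)
    have near: "\<bar>(x - y) $ i\<bar> < 1" for i
      using component_le_norm_cart[of "x - y" i] xy by (simp add: dist_norm)
    then have "-1 \<le> (y + z) $ i \<and> (y + z) $ i \<le> 2" for i
      using xz[of i] near[of i] unfolding vector_add_component vector_minus_component by linarith
    then have "y + z \<in> cbox (-1) 2" by (simp add: mem_box_cart)
    moreover have "x + z \<in> cbox (-1) 2"
      unfolding mem_box_cart using xz by (auto intro: order.trans[of "-1" 0] order.trans[of _ 1 2])
    ultimately show ?thesis
      using d(2)[of "x + z" "y + z"] xy periodic_add_lattice[OF assms(1) z(1)] by simp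
  qed
  then show ?thesis using that[of "min d 1"] d(1) by auto
qed

lemma continuous_integrable_torus:
  fixes f :: "real ^ 'n \<Rightarrow> real"
  assumes "continuous_on UNIV f"
  shows "integrable torus f"
  using continuous_imp_integrable[OF continuous_on_subset[OF assms]] by auto

lemma content_unit_cube: "measure lborel (cbox 0 1 :: (real ^ 'n) set) = 1"
proof -
  have "(1 :: real ^ 'n) \<bullet> b = 1" if "b \<in> Basis" for b
    using that by (auto elim!: Basis_axisE simp: inner_axis)
  then show ?thesis by (subst content_cbox) auto
qed

lemma emeasure_torus_space: "emeasure (torus :: (real ^ 'n) measure) (space torus) = 1"
proof -
  have "emeasure lborel (cbox 0 1 :: (real ^ 'n) set) = 1"
    by (subst emeasure_eq_ennreal_measure) (auto simp: content_unit_cube emeasure_lborel_cbox_eq)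
  then show ?thesis
    by (subst space_restrict_space, subst emeasure_restrict_space) auto
qed

interpretation torus: finite_measure "torus :: (real ^ 'n) measure"
  by (rule finite_measureI) (simp only: emeasure_torus_space, simp)

lemma torus_integral_const [simp]: "(LINT x|(torus :: (real ^ 'n) measure). c) = (c :: real)"
  using emeasure_torus_space[where 'n = 'n] by (subst lebesgue_integral_const) (simp add: measure_def)

lemma measure_unit_torus [simp]: "measure (torus :: (real ^ 'n) measure) (cbox 0 1) = 1"
  using torus_integral_const[where 'n = 'n, of 1] by simp

lemma torus_mult_integrable:
  fixes G h :: "real ^ 'n \<Rightarrow> real"
  assumes "integrable torus G" "continuous_on UNIV h" 
  shows "integrable torus (\<lambda>y. G y * h y)"
proof -
  have "bounded (h ` cbox 0 1)"
    by (intro compact_imp_bounded compact_continuous_image continuous_on_subset[OF assms(2)]) auto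
  then obtain B where B: "B > 0" "\<And>x. x \<in> cbox 0 1 \<Longrightarrow> \<bar>h x\<bar> \<le> B"
    unfolding bounded_pos by auto
  have h: "h \<in> borel_measurable torus"
    using continuous_integrable_torus[OF assms(2)] by (rule borel_measurable_integrable)
  show ?thesis
  proof (rule Bochner_Integration.integrable_bound)
    show "integrable torus (\<lambda>y. B * G y)" using assms(1) by simp
    show "(\<lambda>y. G y * h y) \<in> borel_measurable torus" using assms(1) h by measurable
    show "AE x in torus. norm (G x * h x) \<le> norm (B * G x)"
      using B by (intro AE_I2) (auto simp: abs_mult mult.commute[of B] intro!: mult_left_mono)
  qed
qed

section \<open>Directional derivatives\<close>

lemma dderiv_eqI: "(f has_derivative D) (at x) \<Longrightarrow> dderiv v f x = D v"
  unfolding dderiv_def by (metis frechet_derivative_at)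

lemma has_derivative_dderiv: "f differentiable (at x) \<Longrightarrow> (f has_derivative (\<lambda>v. dderiv v f x)) (at x)"
  unfolding dderiv_def by (metis frechet_derivative_works)

lemma dderiv_sum_axis:
  fixes f :: "real ^ 'n \<Rightarrow> real"
  assumes "f differentiable (at x)"
  shows "dderiv v f x = (\<Sum>i\<in>UNIV. v $ i * pd i f x)"
proof -
  have lin: "linear (\<lambda>v. dderiv v f x)"
    using has_derivative_dderiv[OF assms] has_derivative_linear by blast
  then have "dderiv (\<Sum>i\<in>UNIV. (v $ i) *\<^sub>R axis i 1) f x = (\<Sum>i\<in>UNIV. v $ i * pd i f x)"
    by (subst linear_sum[OF lin]) (simp add: linear_cmul[OF lin])
  then show ?thesis by (simp add: sum_axis)
qed

text \<open>
  The sets of Frechet derivatives at \<open>x\<close> and at \<open>x + axis i 1\<close> agree, so the statement also covers points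
  where \<open>f\<close> has no derivative and \<open>dderiv\<close> is an arbitrary choice.
\<close>

lemma periodic_dderiv:
  fixes f :: "real ^ 'n \<Rightarrow> real"
  assumes "periodic f"
  shows "periodic (dderiv v f)"
proof -
  have "(f has_derivative D) (at (x + axis i 1)) = (f has_derivative D) (at x)" for D x i
  proof -
    have eq: "(\<lambda>y. f (y + axis i 1)) = f" "(\<lambda>y. f (y - axis i 1)) = f"
      using assms periodic_diff_axis[OF assms] by (auto simp: periodic_def)
    have "(f has_derivative D) (at (x + axis i 1)) \<Longrightarrow> ((\<lambda>y. f (y + axis i 1)) has_derivative D) (at x)"
      by (rule has_derivative_compose[of "\<lambda>y. y + axis i 1" "\<lambda>h. h" x UNIV f D, simplified])
         (auto intro!: derivative_eq_intros)
    moreover have "(f has_derivative D) (at x) \<Longrightarrow> ((\<lambda>y. f (y - axis i 1)) has_derivative D) (at (x + axis i 1))"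
      by (rule has_derivative_compose[of "\<lambda>y. y - axis i 1" "\<lambda>h. h" "x + axis i 1" UNIV f D, simplified])
         (auto intro!: derivative_eq_intros)
    ultimately show ?thesis unfolding eq by blast
  qed
  then show ?thesis by (simp add: periodic_def dderiv_def frechet_derivative_def)
qed

lemma C_k_continuous: "C_k k f \<Longrightarrow> continuous_on UNIV f"
  by (cases k) (auto simp: continuous_at_imp_continuous_on differentiable_imp_continuous_within)

lemma C_k_dderiv: "C_k (Suc k) f \<Longrightarrow> i \<in> Basis \<Longrightarrow> C_k k (dderiv i f)" by simp

lemma C_k_Suc_axis_iff:
  fixes f :: "real ^ 'n \<Rightarrow> real"
  shows "C_k (Suc k) f \<longleftrightarrow> (\<forall>x. f differentiable (at x)) \<and> (\<forall>i. C_k k (pd i f))"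
  by (auto simp: axis_in_Basis elim!: Basis_axisE)

lemma C_k_Suc_imp: "C_k (Suc k) f \<Longrightarrow> C_k k f"
  by (induction k arbitrary: f) (auto intro: C_k_continuous[of "Suc 0"])

lemma C_k_mono: "C_k k f \<Longrightarrow> j \<le> k \<Longrightarrow> C_k j f"
  by (induction k) (auto simp: le_Suc_eq simp del: C_k.simps dest: C_k_Suc_imp)

lemma laplacian_sum:
  "laplacian f x = (\<Sum>i\<in>UNIV. pd i (pd i f) x)"
  by (simp add: laplacian_def divergence_def grad_def)

text \<open>
  Integration by parts on the torus: the integral of \<open>f (x + s *\<^sub>R axis i 1)\<close> does not depend on \<open>s\<close>, and
  its derivative at \<open>s = 0\<close> is the integral of the partial derivative.
\<close>

lemma torus_integral_derivative_zero:
  fixes f :: "real ^ 'n \<Rightarrow> real"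
  assumes per: "periodic f" and d: "\<And>x. (f has_derivative D x) (at x)"
    and c: "continuous_on UNIV (\<lambda>x. D x (axis i 1))"
  shows "(LINT x|torus. D x (axis i 1)) = 0"
proof -
  have cf: "continuous_on UNIV f"
    using d by (meson has_derivative_continuous continuous_at_imp_continuous_on)
  have const: "integral (cbox 0 1) (\<lambda>x. f (x + s *\<^sub>R axis i 1)) = integral (cbox 0 1) f" for s
    using has_integral_shift_unit_cube[OF per torus_has_integral[OF continuous_integrable_torus[OF cf]], of "s *\<^sub>R axis i 1"]
      torus_has_integral[OF continuous_integrable_torus[OF cf]] by (metis integral_unique)
  have "((\<lambda>s. integral (cbox 0 1) (\<lambda>x. f (x + s *\<^sub>R axis i 1))) has_field_derivative
      integral (cbox 0 1) (\<lambda>x. D (x + 0 *\<^sub>R axis i 1) (axis i 1))) (at 0 within UNIV)"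
  proof (rule leibniz_rule_field_derivative[where fx = "\<lambda>s x. D (x + s *\<^sub>R axis i 1) (axis i 1)"])
    fix s :: real and x :: "real ^ 'n"
    have "((\<lambda>s. f (x + s *\<^sub>R axis i 1)) has_derivative (\<lambda>h. D (x + s *\<^sub>R axis i 1) (h *\<^sub>R axis i 1))) (at s)"
      by (rule has_derivative_compose[OF _ d]) (auto intro!: derivative_eq_intros)
    moreover have "D (x + s *\<^sub>R axis i 1) (h *\<^sub>R axis i 1) = h * D (x + s *\<^sub>R axis i 1) (axis i 1)" for h
      using linear_cmul[OF has_derivative_linear[OF d]] by simp
    ultimately show "((\<lambda>s. f (x + s *\<^sub>R axis i 1)) has_field_derivative D (x + s *\<^sub>R axis i 1) (axis i 1)) (at s within UNIV)"
      by (simp add: has_field_derivative_def mult_commute_abs)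
  next
    fix s :: real
    show "(\<lambda>x. f (x + s *\<^sub>R axis i 1)) integrable_on cbox 0 1"
      by (intro integrable_continuous continuous_on_compose2[OF cf]) (auto intro!: continuous_intros)
  next
    show "continuous_on (UNIV \<times> cbox 0 1) (\<lambda>(s, x). D (x + s *\<^sub>R axis i 1) (axis i 1))"
      unfolding split_beta by (rule continuous_on_compose2[OF c]) (auto intro!: continuous_intros)
  qed auto
  then have "((\<lambda>s::real. integral (cbox 0 1) f) has_field_derivative integral (cbox 0 1) (\<lambda>x. D x (axis i 1))) (at 0)"
    by (simp add: const)
  then have "integral (cbox 0 1) (\<lambda>x. D x (axis i 1)) = 0"
    using DERIV_unique DERIV_const by blast
  then show ?thesis using torus_integral_eq[OF continuous_integrable_torus[OF c]] by simp
qed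

section \<open>Convolution\<close>

text \<open>
  Substituting \<open>x - y\<close> for \<open>y\<close> moves the shift, and later the derivatives, to the regular factor \<open>h\<close>.
\<close>

lemma conv_alt:
  fixes G h :: "real ^ 'n \<Rightarrow> real"
  assumes G: "periodic G" "integrable torus G" and h: "periodic h" "continuous_on UNIV h"
  shows "conv G h x = (LINT y|torus. G y * h (x - y))"
    and conv_integrable: "integrable torus (\<lambda>y. G y * h (x - y))"
proof -
  have "continuous_on UNIV (\<lambda>y. h (x - y))"
    by (rule continuous_on_compose2[OF h(2)]) (auto intro!: continuous_intros)
  then show i: "integrable torus (\<lambda>y. G y * h (x - y))" by (rule torus_mult_integrable[OF G(2)])
  have "periodic (\<lambda>y. G y * h (x - y))"
    using G(1) periodic_reflect[OF h(1), of x] by (simp add: periodic_def)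
  from torus_reflect(2)[OF this i, of x] show "conv G h x = (LINT y|torus. G y * h (x - y))"
    by (simp add: conv_def)
qed

lemma conv_commute:
  fixes G h :: "real ^ 'n \<Rightarrow> real"
  assumes G: "periodic G" "integrable torus G" and h: "periodic h" "continuous_on UNIV h"
  shows "conv G h = conv h G"
  by (rule ext) (simp add: conv_alt[OF assms] conv_def[of h G] mult.commute)

lemma periodic_conv: "periodic G \<Longrightarrow> periodic (conv G h)"
  by (simp add: conv_def periodic_def diff_add_eq[symmetric])

lemma conv_bound:
  fixes G h :: "real ^ 'n \<Rightarrow> real"
  assumes G: "periodic G" "integrable torus G" and h: "periodic h" "continuous_on UNIV h"
    and B: "\<And>x. \<bar>h x\<bar> \<le> B"
  shows "\<bar>conv G h x\<bar> \<le> B * (LINT y|torus. \<bar>G y\<bar>)"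
proof -
  have "\<bar>conv G h x\<bar> \<le> (LINT y|torus. \<bar>G y * h (x - y)\<bar>)"
    unfolding conv_alt[OF G h] by (rule integral_abs_bound)
  also have "\<dots> \<le> (LINT y|torus. B * \<bar>G y\<bar>)"
  proof (rule integral_mono)
    show "\<bar>G y * h (x - y)\<bar> \<le> B * \<bar>G y\<bar>" for y
      using B[of "x - y"] by (simp add: abs_mult mult.commute[of B] mult_left_mono)
  qed (use conv_integrable[OF G h] G(2) in \<open>auto intro: integrable_abs\<close>)
  finally show ?thesis by simp
qed

lemma conv_diff:
  fixes G h :: "real ^ 'n \<Rightarrow> real"
  assumes G: "periodic G" "integrable torus G" and h: "periodic h" "continuous_on UNIV h"
    and k: "periodic k" "continuous_on UNIV k"
  shows "conv G (\<lambda>y. h y - k y) x = conv G h x - conv G k x"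
proof -
  have hk: "periodic (\<lambda>y. h y - k y)" "continuous_on UNIV (\<lambda>y. h y - k y)"
    using h k by (auto simp: periodic_def intro!: continuous_intros)
  show ?thesis
    unfolding conv_alt[OF G h] conv_alt[OF G k] conv_alt[OF G hk]
    using conv_integrable[OF G h] conv_integrable[OF G k] by (simp add: right_diff_distrib)
qed

lemma continuous_on_conv:
  fixes G h :: "real ^ 'n \<Rightarrow> real"
  assumes G: "periodic G" "integrable torus G" and h: "periodic h" "continuous_on UNIV h"
  shows "continuous_on UNIV (conv G h)"
  unfolding continuous_on_iff
proof (intro ballI allI impI)
  fix x :: "real ^ 'n" and e :: real assume e: "e > 0"
  define K where "K = (LINT y|torus. \<bar>G y\<bar>) + 1"
  have K: "K > 0" unfolding K_def by (smt (verit) integral_nonneg_AE AE_I2 abs_ge_zero)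
  obtain d where d: "d > 0" "\<And>x y. dist x y < d \<Longrightarrow> \<bar>h x - h y\<bar> < e / K"
    using periodic_uniformly_continuous[OF h, of "e / K"] e K by auto
  show "\<exists>d>0. \<forall>x'\<in>UNIV. dist x' x < d \<longrightarrow> dist (conv G h x') (conv G h x) < e"
  proof (intro exI conjI ballI impI)
    fix x' assume x': "dist x' x < d"
    have "\<bar>conv G h x' - conv G h x\<bar> = \<bar>LINT y|torus. G y * (h (x' - y) - h (x - y))\<bar>"
      unfolding conv_alt[OF G h] using conv_integrable[OF G h] by (simp add: right_diff_distrib)
    also have "\<dots> \<le> (LINT y|torus. \<bar>G y * (h (x' - y) - h (x - y))\<bar>)"
      by (rule integral_abs_bound)
    also have "\<dots> \<le> (LINT y|torus. e / K * \<bar>G y\<bar>)"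
    proof (rule integral_mono)
      show "integrable torus (\<lambda>y. \<bar>G y * (h (x' - y) - h (x - y))\<bar>)"
        using conv_integrable[OF G h] by (simp add: right_diff_distrib)
      show "integrable torus (\<lambda>y. e / K * \<bar>G y\<bar>)" using G by simp
      show "\<bar>G y * (h (x' - y) - h (x - y))\<bar> \<le> e / K * \<bar>G y\<bar>" for y
        using d(2)[of "x' - y" "x - y"] x' unfolding abs_mult mult.commute[of "e / K"]
        by (intro mult_left_mono) (auto simp: dist_norm)
    qed
    also have "\<dots> = e * ((K - 1) / K)" by (simp add: K_def)
    also have "\<dots> < e" using K e by (simp add: field_simps)
    finally show "dist (conv G h x') (conv G h x) < e" by (simp add: dist_real_def)
  qed (rule d(1))
qed

text \<open>
  The remainder is uniform in \<open>x\<close>, which is what allows it to be integrated against a kernel that is only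
  integrable.
\<close>

lemma periodic_uniform_taylor:
  fixes h :: "real ^ 'n \<Rightarrow> real"
  assumes h: "periodic h" "C_k 1 h" and e: "e > 0"
  obtains d where "d > 0" "\<And>x k. norm k < d \<Longrightarrow> \<bar>h (x + k) - h x - dderiv k h x\<bar> \<le> e * norm k"
proof -
  have diff: "h differentiable (at x)" for x using h(2) by simp
  have cont: "continuous_on UNIV (pd i h)" for i using h(2) by (simp add: axis_in_Basis)
  define n where "n = real CARD('n)"
  have n: "n > 0" by (simp add: n_def)
  have "\<exists>d>0. \<forall>x y. dist x y < d \<longrightarrow> \<bar>pd i h x - pd i h y\<bar> < e / n" for i
    using periodic_uniformly_continuous[OF periodic_dderiv[OF h(1)] cont, of "e / n" i] e n
    by (metis zero_less_divide_iff)
  then obtain d where d: "\<And>i. d i > 0"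
    "\<And>i x y. dist x y < d i \<Longrightarrow> \<bar>pd i h x - pd i h y\<bar> < e / n" by metis
  define d0 where "d0 = Min (range d)"
  have d0: "d0 > 0" "\<And>i. d0 \<le> d i" using d(1) by (auto simp: d0_def)
  have "\<bar>h (x + k) - h x - dderiv k h x\<bar> \<le> e * norm k" if k: "norm k < d0" for x k
  proof -
    have der: "((\<lambda>s. h (x + s *\<^sub>R k)) has_real_derivative dderiv k h (x + s *\<^sub>R k)) (at s)" for s
    proof -
      have "((\<lambda>s. h (x + s *\<^sub>R k)) has_derivative (\<lambda>t. dderiv (t *\<^sub>R k) h (x + s *\<^sub>R k))) (at s)"
        by (rule has_derivative_compose[OF _ has_derivative_dderiv[OF diff]]) (auto intro!: derivative_eq_intros)
      then show ?thesis
        using linear_cmul[OF has_derivative_linear[OF has_derivative_dderiv[OF diff[of "x + s *\<^sub>R k"]]]]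
        by (simp add: has_field_derivative_def mult_commute_abs)
    qed
    obtain s where s: "0 < s" "s < 1" "h (x + 1 *\<^sub>R k) - h (x + 0 *\<^sub>R k) = (1 - 0) * dderiv k h (x + s *\<^sub>R k)"
      using MVT2[of 0 1 "\<lambda>s. h (x + s *\<^sub>R k)", OF _ der] by auto
    have "\<bar>h (x + k) - h x - dderiv k h x\<bar> = \<bar>\<Sum>i\<in>UNIV. k $ i * (pd i h (x + s *\<^sub>R k) - pd i h x)\<bar>"
      using s(3) unfolding dderiv_sum_axis[OF diff, of k] by (simp add: right_diff_distrib sum_subtractf)
    also have "\<dots> \<le> (\<Sum>i\<in>(UNIV :: 'n set). norm k * (e / n))"
    proof (rule order.trans[OF sum_abs], rule sum_mono)
      fix i
      have "norm (s *\<^sub>R k) < d i" using s(1,2) k d0(2)[of i]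
        by (smt (verit) norm_scaleR mult_left_le_one_le norm_ge_zero)
      then have "\<bar>pd i h (x + s *\<^sub>R k) - pd i h x\<bar> < e / n"
        by (intro d(2)) (simp add: dist_norm)
      then show "\<bar>k $ i * (pd i h (x + s *\<^sub>R k) - pd i h x)\<bar> \<le> norm k * (e / n)"
        unfolding abs_mult using component_le_norm_cart[of k i] by (intro mult_mono) auto
    qed
    also have "\<dots> = e * norm k" using n by (simp add: n_def)
    finally show ?thesis .
  qed
  then show ?thesis using that d0(1) by blast
qed

lemma has_derivative_conv:
  fixes G h :: "real ^ 'n \<Rightarrow> real"
  assumes G: "periodic G" "integrable torus G" and h: "periodic h" "C_k 1 h"
  shows "(conv G h has_derivative (\<lambda>k. \<Sum>i\<in>UNIV. k $ i * conv G (pd i h) x)) (at x)"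
  unfolding has_derivative_at_alt
proof (intro conjI allI impI)
  show "bounded_linear (\<lambda>k. \<Sum>i\<in>UNIV. k $ i * conv G (pd i h) x)"
    by (intro bounded_linear_intros bounded_linear_vec_nth)
next
  fix e :: real assume e: "e > 0"
  have diff: "h differentiable (at x)" for x using h(2) by simp
  have hc: "continuous_on UNIV h" using h(2) by (rule C_k_continuous)
  have cont: "continuous_on UNIV (pd i h)" for i using h(2) by (simp add: axis_in_Basis)
  have per: "periodic (pd i h)" for i using h(1) by (rule periodic_dderiv)
  define K where "K = (LINT y|torus. \<bar>G y\<bar>) + 1"
  have K: "K > 0" unfolding K_def by (smt (verit) integral_nonneg_AE AE_I2 abs_ge_zero)
  obtain d where d: "d > 0" "\<And>x k. norm k < d \<Longrightarrow> \<bar>h (x + k) - h x - dderiv k h x\<bar> \<le> e / K * norm k"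
    using periodic_uniform_taylor[OF h, of "e / K"] e K by (metis zero_less_divide_iff)
  show "\<exists>d>0. \<forall>y. norm (y - x) < d \<longrightarrow>
      norm (conv G h y - conv G h x - (\<Sum>i\<in>UNIV. (y - x) $ i * conv G (pd i h) x)) \<le> e * norm (y - x)"
  proof (intro exI conjI allI impI)
    fix y assume y: "norm (y - x) < d"
    let ?R = "\<lambda>z. h (y - z) - h (x - z) - dderiv (y - x) h (x - z)"
    have int: "integrable torus (\<lambda>z. G z * pd i h (x - z))" for i
      by (rule conv_integrable[OF G per cont])
    have R: "G z * ?R z = G z * h (y - z) - G z * h (x - z) - (\<Sum>i\<in>UNIV. (y - x) $ i * (G z * pd i h (x - z)))" for z
      by (simp add: right_diff_distrib dderiv_sum_axis[OF diff, of "y - x"] sum_distrib_left mult.left_commute)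
    have iR: "integrable torus (\<lambda>z. G z * ?R z)"
      unfolding R using int conv_integrable[OF G h(1) hc]
      by (intro Bochner_Integration.integrable_diff Bochner_Integration.integrable_sum) auto
    have eq: "conv G h y - conv G h x - (\<Sum>i\<in>UNIV. (y - x) $ i * conv G (pd i h) x)
        = (LINT z|torus. G z * ?R z)"
      unfolding R conv_alt[OF G h(1) hc] conv_alt[OF G per cont]
      using int conv_integrable[OF G h(1) hc]
      by (simp add: Bochner_Integration.integral_sum)
    have "norm (conv G h y - conv G h x - (\<Sum>i\<in>UNIV. (y - x) $ i * conv G (pd i h) x))
        \<le> (LINT z|torus. \<bar>G z * ?R z\<bar>)"
      unfolding eq real_norm_def by (rule integral_abs_bound)
    also have "\<dots> \<le> (LINT z|torus. e / K * norm (y - x) * \<bar>G z\<bar>)"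
    proof (rule integral_mono)
      fix z
      have xz: "(x - z) + (y - x) = y - z" by (simp add: algebra_simps)
      have "\<bar>?R z\<bar> \<le> e / K * norm (y - x)"
        using d(2)[OF y, of "x - z"] unfolding xz .
      then show "\<bar>G z * ?R z\<bar> \<le> e / K * norm (y - x) * \<bar>G z\<bar>"
        unfolding abs_mult by (subst mult.commute) (intro mult_right_mono abs_ge_zero)
    next
      show "integrable torus (\<lambda>z. \<bar>G z * ?R z\<bar>)" using iR by (rule integrable_abs)
      show "integrable torus (\<lambda>z. e / K * norm (y - x) * \<bar>G z\<bar>)"
        using integrable_abs[OF G(2)] by (rule integrable_mult_right)
    qed
    also have "\<dots> = e * norm (y - x) * ((K - 1) / K)" by (simp add: K_def)
    also have "\<dots> \<le> e * norm (y - x)" using K e by (intro mult_left_le) auto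
    finally show "norm (conv G h y - conv G h x - (\<Sum>i\<in>UNIV. (y - x) $ i * conv G (pd i h) x)) \<le> e * norm (y - x)" .
  qed (rule d(1))
qed

lemma dderiv_conv:
  fixes G h :: "real ^ 'n \<Rightarrow> real"
  assumes G: "periodic G" "integrable torus G" and h: "periodic h" "C_k 1 h"
  shows "pd i (conv G h) = conv G (pd i h)"
  by (rule ext) (simp add: dderiv_eqI[OF has_derivative_conv[OF assms]] axis_def if_distrib[of "\<lambda>a. a * _"] cong: if_cong)

lemma C_k_conv:
  fixes G h :: "real ^ 'n \<Rightarrow> real"
  assumes G: "periodic G" "integrable torus G" and h: "periodic h" "C_k k h"
  shows "C_k k (conv G h)"
  using h
proof (induction k arbitrary: h)
  case 0
  then show ?case using continuous_on_conv[OF G] by simp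
next
  case (Suc k)
  have h1: "C_k 1 h" using Suc.prems(2) by (rule C_k_mono) simp
  show ?case unfolding C_k_Suc_axis_iff
  proof (intro conjI allI)
    show "conv G h differentiable at x" for x
      using has_derivative_conv[OF G Suc.prems(1) h1] differentiable_def by blast
    show "C_k k (pd i (conv G h))" for i
      unfolding dderiv_conv[OF G Suc.prems(1) h1]
      using Suc.prems by (intro Suc.IH periodic_dderiv C_k_dderiv axis_in_Basis) auto
  qed
qed

section \<open>Operations on functions of class Ck\<close>

lemma C_k_const: "C_k k (\<lambda>x. c)"
proof (induction k arbitrary: c)
  case (Suc k)
  have "dderiv i (\<lambda>x. c) = (\<lambda>x. 0)" for i :: 'a
    by (rule ext, rule dderiv_eqI) (rule has_derivative_const)
  then show ?case using Suc by simp
qed simp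

lemma C_k_cmult: "C_k k f \<Longrightarrow> C_k k (\<lambda>x. c * f x)"
proof (induction k arbitrary: f)
  case (Suc k)
  then have d: "((\<lambda>x. c * f x) has_derivative (\<lambda>v. c * dderiv v f x)) (at x)" for x
    by (auto intro!: has_derivative_mult_right has_derivative_dderiv)
  have "dderiv i (\<lambda>x. c * f x) = (\<lambda>x. c * dderiv i f x)" for i
    by (rule ext, rule dderiv_eqI[OF d])
  then show ?case using Suc differentiableI[OF d] by auto
qed (auto intro!: continuous_intros)

lemma C_k_add: "C_k k f \<Longrightarrow> C_k k g \<Longrightarrow> C_k k (\<lambda>x. f x + g x)"
proof (induction k arbitrary: f g)
  case (Suc k)
  then have d: "((\<lambda>x. f x + g x) has_derivative (\<lambda>v. dderiv v f x + dderiv v g x)) (at x)" for x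
    by (auto intro!: has_derivative_add has_derivative_dderiv)
  have "dderiv i (\<lambda>x. f x + g x) = (\<lambda>x. dderiv i f x + dderiv i g x)" for i
    by (rule ext, rule dderiv_eqI[OF d])
  then show ?case using Suc differentiableI[OF d] by auto
qed (auto intro!: continuous_intros)

lemma C_k_sum: "finite A \<Longrightarrow> (\<And>a. a \<in> A \<Longrightarrow> C_k k (f a)) \<Longrightarrow> C_k k (\<lambda>x. \<Sum>a\<in>A. f a x)"
  by (induction A rule: finite_induct) (auto intro!: C_k_add C_k_const)

lemma C_k_mult: "C_k k f \<Longrightarrow> C_k k g \<Longrightarrow> C_k k (\<lambda>x. f x * g x)"
proof (induction k arbitrary: f g)
  case (Suc k)
  then have d: "((\<lambda>x. f x * g x) has_derivative (\<lambda>v. f x * dderiv v g x + dderiv v f x * g x)) (at x)" for x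
    by (auto intro!: has_derivative_mult has_derivative_dderiv)
  have "dderiv i (\<lambda>x. f x * g x) = (\<lambda>x. f x * dderiv i g x + dderiv i f x * g x)" for i
    by (rule ext, rule dderiv_eqI[OF d])
  then show ?case using Suc.IH Suc.prems[THEN C_k_Suc_imp] Suc.prems differentiableI[OF d]
    by (auto intro!: C_k_add)
qed (auto intro!: continuous_intros)

lemma dderiv_linear_sum:
  assumes "f differentiable (at x)"
  shows "dderiv v f x = (\<Sum>j\<in>Basis. (v \<bullet> j) * dderiv j f x)"
proof -
  have lin: "linear (\<lambda>v. dderiv v f x)"
    using has_derivative_dderiv[OF assms] has_derivative_linear by blast
  have "dderiv (\<Sum>j\<in>Basis. (v \<bullet> j) *\<^sub>R j) f x = (\<Sum>j\<in>Basis. (v \<bullet> j) * dderiv j f x)"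
    by (subst linear_sum[OF lin]) (simp add: linear_cmul[OF lin])
  then show ?thesis by (simp add: euclidean_representation)
qed

text \<open>
  This covers the reflections \<open>x - z\<close> in convolutions and the two projections of \<open>\<real> \<times> \<real>\<^sup>d\<close>, from which
  test functions in product form are built.
\<close>

lemma C_k_affine:
  fixes B :: "'a::euclidean_space \<Rightarrow> 'b::euclidean_space"
  assumes B: "bounded_linear B"
  shows "C_k k f \<Longrightarrow> C_k k (\<lambda>z. f (a + B z))"
proof (induction k arbitrary: f)
  case 0
  then show ?case
    using linear_continuous_on[OF B] by (auto intro!: continuous_on_compose2[of UNIV f] continuous_intros)
next
  case (Suc k)
  then have df: "f differentiable (at x)" for x by simp
  have d: "((\<lambda>z. f (a + B z)) has_derivative (\<lambda>v. dderiv (B v) f (a + B x))) (at x)" for x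
    by (rule has_derivative_compose[OF _ has_derivative_dderiv[OF df]])
       (auto intro!: derivative_eq_intros bounded_linear_imp_has_derivative[OF B])
  have "dderiv i (\<lambda>z. f (a + B z)) = (\<lambda>x. \<Sum>j\<in>Basis. (B i \<bullet> j) * dderiv j f (a + B x))" for i
    by (rule ext) (simp add: dderiv_eqI[OF d] dderiv_linear_sum[OF df, of "B i"])
  then show ?case using Suc differentiableI[OF d]
    by (auto intro!: C_k_sum C_k_cmult)
qed

lemma dderiv_reflect:
  assumes "\<And>x. h differentiable (at x)"
  shows "dderiv v (\<lambda>z. h (a - z)) = (\<lambda>z. - dderiv v h (a - z))"
proof
  fix z
  have "((\<lambda>z. h (a - z)) has_derivative (\<lambda>v. dderiv (- v) h (a - z))) (at z)"
    by (rule has_derivative_compose[OF _ has_derivative_dderiv[OF assms]])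
       (auto intro!: derivative_eq_intros)
  moreover have "dderiv (- v) h (a - z) = - dderiv v h (a - z)"
    using linear_neg[OF has_derivative_linear[OF has_derivative_dderiv[OF assms]]] .
  ultimately show "dderiv v (\<lambda>z. h (a - z)) z = - dderiv v h (a - z)"
    by (simp add: dderiv_eqI)
qed

lemma C_k_reflect: "C_k k h \<Longrightarrow> C_k k (\<lambda>z. h (a - z))"
  using C_k_affine[of "\<lambda>z. - z" k h a] by (simp add: bounded_linear_minus[OF bounded_linear_ident])

section \<open>Mollification\<close>

lemma mollifiersD:
  assumes "mollifiers \<omega>" "\<epsilon> > 0"
  shows "periodic (\<omega> \<epsilon>)" "smooth (\<omega> \<epsilon>)" "\<And>x. 0 \<le> \<omega> \<epsilon> x" "mean (\<omega> \<epsilon>) = 1"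
    "continuous_on UNIV (\<omega> \<epsilon>)" "integrable torus (\<omega> \<epsilon>)"
proof -
  show *: "periodic (\<omega> \<epsilon>)" "smooth (\<omega> \<epsilon>)" "\<And>x. 0 \<le> \<omega> \<epsilon> x" "mean (\<omega> \<epsilon>) = 1"
    using assms by (auto simp: mollifiers_def)
  then show c: "continuous_on UNIV (\<omega> \<epsilon>)"
    using C_k.simps(1) unfolding smooth_def by blast
  then show "integrable torus (\<omega> \<epsilon>)" by (rule continuous_integrable_torus)
qed

text \<open>
  Where the kernel does not vanish, \<open>y\<close> is close to a lattice point, and by periodicity \<open>x - y\<close> may be
  replaced by a point close to \<open>x\<close>. The value \<open>c\<close> is left free: with \<open>c = f x\<close> this is uniform
  convergence, with \<open>c = 0\<close> it bounds difference quotients of a mollified function.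
\<close>

lemma mollifier_average_bound:
  fixes f :: "real ^ 'n \<Rightarrow> real"
  assumes \<omega>: "mollifiers \<omega>" and f: "periodic f" "continuous_on UNIV f" 
    and \<epsilon>: "\<epsilon> > 0" and supp: "\<And>x. infdist x {z. \<forall>i. z $ i \<in> \<int>} \<ge> \<delta> \<Longrightarrow> \<omega> \<epsilon> x = 0"
    and b: "\<And>y. norm y < \<delta> \<Longrightarrow> \<bar>f (x + y) - c\<bar> \<le> e"
  shows "\<bar>conv (\<omega> \<epsilon>) f x - c\<bar> \<le> e"
proof -
  note w = mollifiersD[OF \<omega> \<epsilon>]
  have int: "integrable torus (\<lambda>y. \<omega> \<epsilon> y * f (x - y))"
    by (rule conv_integrable[OF w(1,6) f])
  have pt: "\<bar>\<omega> \<epsilon> y * (f (x - y) - c)\<bar> \<le> e * \<omega> \<epsilon> y" for y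
  proof (cases "\<omega> \<epsilon> y = 0")
    case False
    then have "infdist y {z. \<forall>i. z $ i \<in> \<int>} < \<delta>" using supp[of y] by linarith
    moreover have ne: "{z :: real ^ 'n. \<forall>i. z $ i \<in> \<int>} \<noteq> {}" by (auto intro: exI[of _ 0])
    ultimately obtain z :: "real ^ 'n" where z: "\<And>i. z $ i \<in> \<int>" "dist y z < \<delta>"
      by (auto simp: infdist_notempty[OF ne] dest!: cInf_lessD[rotated])
    have "f (x - y) = f (x + (z - y))"
      using periodic_add_lattice[OF f(1) z(1), of "x - y"] by (simp add: algebra_simps)
    then have "\<bar>f (x - y) - c\<bar> \<le> e" using b[of "z - y"] z(2) by (simp add: dist_norm norm_minus_commute)
    then show ?thesis using w(3)[of y] 
      unfolding abs_mult by (subst mult.commute) (simp add: mult_right_mono)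
  qed simp
  have "\<bar>conv (\<omega> \<epsilon>) f x - c\<bar> = \<bar>LINT y|torus. \<omega> \<epsilon> y * (f (x - y) - c)\<bar>"
    unfolding conv_alt[OF w(1,6) f] using int w(4,6) by (simp add: right_diff_distrib mean_def)
  also have "\<dots> \<le> (LINT y|torus. \<bar>\<omega> \<epsilon> y * (f (x - y) - c)\<bar>)" by (rule integral_abs_bound)
  also have "\<dots> \<le> (LINT y|torus. e * \<omega> \<epsilon> y)"
  proof (rule integral_mono)
    have "integrable torus (\<lambda>y. \<omega> \<epsilon> y * (f (x - y) - c))"
      using int w(6) by (simp add: right_diff_distrib)
    then show "integrable torus (\<lambda>y. \<bar>\<omega> \<epsilon> y * (f (x - y) - c)\<bar>)" by (rule integrable_abs)
    show "integrable torus (\<lambda>y. e * \<omega> \<epsilon> y)" using w(6) by simp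
  qed (rule pt)
  also have "\<dots> = e" using w(4) by (simp add: mean_def)
  finally show ?thesis .
qed

lemma mollifiers_eventually:
  assumes "mollifiers \<omega>" "\<delta> > 0"
  shows "\<forall>\<^sub>F \<epsilon> in at_right 0. \<epsilon> > 0 \<and> (\<forall>x. infdist x {z. \<forall>i. z $ i \<in> \<int>} \<ge> \<delta> \<longrightarrow> \<omega> \<epsilon> x = 0)"
  using assms by (auto simp: mollifiers_def eventually_at_right_less intro!: eventually_conj)

lemma mollify_uniform:
  fixes f :: "real ^ 'n \<Rightarrow> real"
  assumes \<omega>: "mollifiers \<omega>" and f: "periodic f" "continuous_on UNIV f" and e: "e > 0"
  shows "\<forall>\<^sub>F \<epsilon> in at_right 0. \<forall>x. \<bar>conv (\<omega> \<epsilon>) f x - f x\<bar> \<le> e"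
proof -
  obtain d where d: "d > 0" "\<And>x y. dist x y < d \<Longrightarrow> \<bar>f x - f y\<bar> < e"
    using periodic_uniformly_continuous[OF f e] by blast
  show ?thesis
    using mollifiers_eventually[OF \<omega> d(1)]
  proof eventually_elim
    case (elim \<epsilon>)
    show ?case
    proof
      fix x
      have "\<bar>f (x + y) - f x\<bar> \<le> e" if "norm y < d" for y
        using d(2)[of "x + y" x] that by (simp add: dist_norm)
      then show "\<bar>conv (\<omega> \<epsilon>) f x - f x\<bar> \<le> e"
        using elim by (intro mollifier_average_bound[OF \<omega> f, where \<delta> = d]) auto
    qed
  qed
qed

lemma smooth_mollify:
  assumes \<omega>: "mollifiers \<omega>" and f: "periodic f" "continuous_on UNIV f" and \<epsilon>: "\<epsilon> > 0"
  shows "smooth (conv (\<omega> \<epsilon>) f)"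
proof -
  note w = mollifiersD[OF \<omega> \<epsilon>]
  show ?thesis
    unfolding smooth_def conv_commute[OF w(1,6) f]
    using w(1,2) C_k_conv[OF f(1) continuous_integrable_torus[OF f(2)]] by (auto simp: smooth_def)
qed

section \<open>Green identity for functions of class C2\<close>

lemma continuous_laplacian:
  fixes f :: "real ^ 'n \<Rightarrow> real"
  assumes "C_k 2 f"
  shows "continuous_on UNIV (laplacian f)"
proof -
  have "continuous_on UNIV (pd i (pd i f))" for i
    using assms by (simp add: numeral_2_eq_2 axis_in_Basis)
  then have "continuous_on UNIV (\<lambda>x. \<Sum>i\<in>UNIV. pd i (pd i f) x)"
    by (intro continuous_on_sum) auto
  then show ?thesis by (simp add: laplacian_sum[abs_def])
qed

lemma laplacian_conv:
  fixes G h :: "real ^ 'n \<Rightarrow> real"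
  assumes G: "periodic G" "integrable torus G" and h: "periodic h" "C_k 2 h"
  shows "pd i (pd i (conv G h)) = conv G (pd i (pd i h))"
proof -
  have "C_k 1 h" using h(2) by (rule C_k_mono) simp
  moreover have "C_k 1 (pd i h)" using h(2) by (simp add: numeral_2_eq_2 axis_in_Basis)
  ultimately show ?thesis using G h(1) by (simp add: dderiv_conv periodic_dderiv)
qed

text \<open>
  The defining identity of the Green kernel is for smooth test functions. Mollification converges
  uniformly together with the second derivatives, and \<open>g\<close> is integrable.
\<close>

lemma green_identity_C2:
  fixes g :: "real ^ 'n \<Rightarrow> real" and \<omega> :: "real \<Rightarrow> real ^ 'n \<Rightarrow> real"
  assumes g: "green_kernel g" and \<omega>: "mollifiers \<omega>" and \<phi>: "periodic \<phi>" "C_k 2 \<phi>"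
  shows "- (LINT x|torus. g x * laplacian \<phi> x) = \<phi> 0 - (LINT x|torus. \<phi> x)"
proof -
  have gp: "periodic g" "integrable torus g" using g by (auto simp: green_kernel_def)
  define D where "D = - (LINT x|torus. g x * laplacian \<phi> x) - \<phi> 0 + (LINT x|torus. \<phi> x)"
  define n where "n = real CARD('n)"
  define K where "K = n * (LINT x|torus. \<bar>g x\<bar>) + 2"
  have g0: "(LINT x|torus. \<bar>g x\<bar>) \<ge> 0" by (intro integral_nonneg_AE AE_I2) auto
  have K: "K > 0" using g0 by (simp add: K_def n_def add_nonneg_pos)
  have c\<phi>: "continuous_on UNIV \<phi>" using \<phi>(2) by (rule C_k_continuous)
  have c2: "continuous_on UNIV (pd i (pd i \<phi>))" for i
    using \<phi>(2) by (simp add: numeral_2_eq_2 axis_in_Basis)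
  have p2: "periodic (pd i (pd i \<phi>))" for i
    by (intro periodic_dderiv \<phi>(1))
  have "\<bar>D\<bar> \<le> K * e" if e: "e > 0" for e
  proof -
    have "\<forall>\<^sub>F \<epsilon> in at_right 0. \<epsilon> > 0 \<and> (\<forall>x. \<bar>conv (\<omega> \<epsilon>) \<phi> x - \<phi> x\<bar> \<le> e) \<and>
        (\<forall>i. \<forall>x. \<bar>conv (\<omega> \<epsilon>) (pd i (pd i \<phi>)) x - pd i (pd i \<phi>) x\<bar> \<le> e)"
      by (intro eventually_conj eventually_all_finite mollify_uniform[OF \<omega> _ _ e] \<phi>(1) c\<phi> c2 p2)
         (auto simp: eventually_at_right_less)
    then obtain \<epsilon> where \<epsilon>: "\<epsilon> > 0" and b0: "\<And>x. \<bar>conv (\<omega> \<epsilon>) \<phi> x - \<phi> x\<bar> \<le> e"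
      and b2: "\<And>i x. \<bar>conv (\<omega> \<epsilon>) (pd i (pd i \<phi>)) x - pd i (pd i \<phi>) x\<bar> \<le> e"
      using eventually_happens trivial_limit_at_right_real by (metis (no_types, lifting))
    note w = mollifiersD[OF \<omega> \<epsilon>]
    define \<psi> where "\<psi> = conv (\<omega> \<epsilon>) \<phi>"
    have \<psi>: "periodic \<psi>" "smooth \<psi>"
      unfolding \<psi>_def using periodic_conv[OF w(1)] smooth_mollify[OF \<omega> \<phi>(1) c\<phi> \<epsilon>] by auto
    have \<psi>2: "C_k 2 \<psi>" using \<psi>(2) by (simp add: smooth_def)
    have lap: "\<bar>laplacian \<psi> x - laplacian \<phi> x\<bar> \<le> n * e" for x
    proof -
      have "\<bar>laplacian \<psi> x - laplacian \<phi> x\<bar> \<le> (\<Sum>i\<in>(UNIV :: 'n set). e)"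
        unfolding laplacian_sum \<psi>_def laplacian_conv[OF w(1,6) \<phi>] sum_subtractf[symmetric]
        by (rule order.trans[OF sum_abs]) (intro sum_mono b2)
      then show ?thesis by (simp add: n_def)
    qed
    have G\<psi>: "- (LINT x|torus. g x * laplacian \<psi> x) = \<psi> 0 - (LINT x|torus. \<psi> x)"
      using g \<psi> by (simp add: green_kernel_def)
    have c\<psi>: "continuous_on UNIV \<psi>" using \<psi>2 by (rule C_k_continuous)
    note i1 = torus_mult_integrable[OF gp(2) continuous_laplacian[OF \<psi>2]]
    note i2 = torus_mult_integrable[OF gp(2) continuous_laplacian[OF \<phi>(2)]]
    have e1: "\<bar>(LINT x|torus. g x * laplacian \<psi> x) - (LINT x|torus. g x * laplacian \<phi> x)\<bar> \<le> n * (LINT x|torus. \<bar>g x\<bar>) * e"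
    proof -
      have "\<bar>(LINT x|torus. g x * laplacian \<psi> x) - (LINT x|torus. g x * laplacian \<phi> x)\<bar>
          = \<bar>LINT x|torus. g x * laplacian \<psi> x - g x * laplacian \<phi> x\<bar>"
        using i1 i2 by simp
      also have "\<dots> \<le> (LINT x|torus. \<bar>g x * laplacian \<psi> x - g x * laplacian \<phi> x\<bar>)"
        by (rule integral_abs_bound)
      also have "\<dots> \<le> (LINT x|torus. (n * e) * \<bar>g x\<bar>)"
      proof (rule integral_mono)
        show "integrable torus (\<lambda>x. \<bar>g x * laplacian \<psi> x - g x * laplacian \<phi> x\<bar>)"
          using i1 i2 by (intro integrable_abs Bochner_Integration.integrable_diff)
        show "integrable torus (\<lambda>x. (n * e) * \<bar>g x\<bar>)" 
          using integrable_abs[OF gp(2)] by (rule integrable_mult_right)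
        fix x
        show "\<bar>g x * laplacian \<psi> x - g x * laplacian \<phi> x\<bar> \<le> (n * e) * \<bar>g x\<bar>"
          unfolding right_diff_distrib[symmetric] abs_mult
          by (subst mult.commute) (intro mult_right_mono lap abs_ge_zero)
      qed
      finally show ?thesis by (simp add: mult_ac)
    qed
    have e2: "\<bar>(LINT x|torus. \<psi> x) - (LINT x|torus. \<phi> x)\<bar> \<le> e"
    proof -
      have "\<bar>(LINT x|torus. \<psi> x) - (LINT x|torus. \<phi> x)\<bar> = \<bar>LINT x|torus. \<psi> x - \<phi> x\<bar>"
        using c\<psi> c\<phi> by (simp add: continuous_integrable_torus)
      also have "\<dots> \<le> (LINT x|torus. \<bar>\<psi> x - \<phi> x\<bar>)" by (rule integral_abs_bound)
      also have "\<dots> \<le> (LINT x|(torus :: (real ^ 'n) measure). e)"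
        by (intro integral_mono integrable_abs Bochner_Integration.integrable_diff continuous_integrable_torus c\<psi> c\<phi>)
           (auto simp: \<psi>_def b0)
      finally show ?thesis unfolding torus_integral_const by simp
    qed
    have "D = ((LINT x|torus. g x * laplacian \<psi> x) - (LINT x|torus. g x * laplacian \<phi> x))
        + (\<psi> 0 - \<phi> 0) - ((LINT x|torus. \<psi> x) - (LINT x|torus. \<phi> x))"
      using G\<psi> by (simp add: D_def)
    then have "\<bar>D\<bar> \<le> n * (LINT x|torus. \<bar>g x\<bar>) * e + e + e"
      using e1 e2 b0[of 0] unfolding \<psi>_def by linarith
    then show ?thesis by (simp add: K_def algebra_simps)
  qed
  then have "\<bar>D\<bar> \<le> e" if "e > 0" for e
    using K that by (metis divide_pos_pos nonzero_mult_div_cancel_left times_divide_eq_right less_irrefl)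
  then have "D = 0" by (metis abs_le_zero_iff field_le_epsilon add_0)
  then show ?thesis by (simp add: D_def)
qed

text \<open>
  The previous identity for the reflected function \<open>v (x - z)\<close>: on \<open>v\<close> of class \<open>C\<^sup>2\<close>, \<open>g * v\<close> solves the
  Poisson equation in the classical sense.
\<close>

lemma laplacian_conv_green:
  fixes g :: "real ^ 'n \<Rightarrow> real" and \<omega> :: "real \<Rightarrow> real ^ 'n \<Rightarrow> real"
  assumes g: "green_kernel g" and \<omega>: "mollifiers \<omega>" and v: "periodic v" "C_k 2 v"
  shows "laplacian (conv g v) x = mean v - v x"
proof -
  have gp: "periodic g" "integrable torus g" using g by (auto simp: green_kernel_def)
  have c2: "continuous_on UNIV (pd i (pd i v))" for i
    using v(2) by (simp add: numeral_2_eq_2 axis_in_Basis)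
  have p2: "periodic (pd i (pd i v))" for i
    by (intro periodic_dderiv v(1))
  have d: "\<And>x. v differentiable (at x)" "\<And>x i. pd i v differentiable (at x)"
    using v(2) by (auto simp: numeral_2_eq_2 axis_in_Basis)
  have neg: "dderiv w (\<lambda>z. - f z) = (\<lambda>z. - dderiv w f z)" if "\<And>x. f differentiable (at x)" for w and f :: "real ^ 'n \<Rightarrow> real"
  proof
    fix z show "dderiv w (\<lambda>z. - f z) z = - dderiv w f z"
      by (rule dderiv_eqI) (intro has_derivative_minus has_derivative_dderiv that)
  qed
  have dr: "(\<lambda>z. pd i v (x - z)) differentiable (at z)" for i z
    using C_k_reflect[of 1 "pd i v" x] v(2) by (simp add: numeral_2_eq_2 axis_in_Basis)
  have lap: "laplacian (\<lambda>z. v (x - z)) z = laplacian v (x - z)" for z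
    unfolding laplacian_sum dderiv_reflect[OF d(1)] neg[OF dr] dderiv_reflect[OF d(2)] by simp
  have "laplacian (conv g v) x = (\<Sum>i\<in>UNIV. (LINT z|torus. g z * pd i (pd i v) (x - z)))"
    unfolding laplacian_sum laplacian_conv[OF gp v] conv_alt[OF gp p2 c2] ..
  also have "\<dots> = (LINT z|torus. (\<Sum>i\<in>UNIV. g z * pd i (pd i v) (x - z)))"
    using conv_integrable[OF gp p2 c2] by (subst Bochner_Integration.integral_sum) auto
  also have "\<dots> = (LINT z|torus. g z * laplacian (\<lambda>z. v (x - z)) z)"
    unfolding lap laplacian_sum sum_distrib_left ..
  also have "\<dots> = (LINT z|torus. v (x - z)) - v (x - 0)"
    using green_identity_C2[OF g \<omega> periodic_reflect[OF v(1)] C_k_reflect[OF v(2)], of x] by simp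
  also have "(LINT z|torus. v (x - z)) = mean v"
    unfolding mean_def by (rule torus_reflect(2)[OF v(1) continuous_integrable_torus[OF C_k_continuous[OF v(2)]]])
  finally show ?thesis by simp
qed

section \<open>Energy identity for the viscous equation\<close>

text \<open>
  The derivative of \<open>\<xi> powr m\<close> on the closed half line. The case \<open>m = 1\<close> is separate because
  \<open>0 powr 0 = 0\<close> in HOL.
\<close>

definition dpowr :: "real \<Rightarrow> real \<Rightarrow> real" where
  "dpowr m \<xi> = (if m = 1 then 1 else m * \<xi> powr (m - 1))"

lemma continuous_on_powr_nonneg: "a > 0 \<Longrightarrow> continuous_on {0..} (\<lambda>\<xi>::real. \<xi> powr a)"
  by (intro continuous_on_powr') (auto intro: continuous_intros)

lemma continuous_on_dpowr: "m \<ge> 1 \<Longrightarrow> continuous_on {0..} (dpowr m)"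
  unfolding dpowr_def
  by (cases "m = 1") (auto intro!: continuous_intros continuous_on_powr_nonneg)

lemma has_derivative_powr_nonneg:
  assumes m: "m \<ge> 1" and \<xi>: "\<xi> \<ge> 0"
  shows "((\<lambda>\<xi>. \<xi> powr m) has_real_derivative dpowr m \<xi>) (at \<xi> within {0..})"
proof (cases "m = 1")
  case True
  have "((\<lambda>\<xi>. \<xi>) has_real_derivative 1) (at \<xi> within {0..})" by (auto intro!: derivative_eq_intros)
  then have "((\<lambda>\<xi>. \<xi> powr m) has_real_derivative 1) (at \<xi> within {0..})"
    by (rule has_field_derivative_transform_within[where d = 1]) (use \<xi> True in auto)
  then show ?thesis using True by (simp add: dpowr_def)
next
  case False
  show ?thesis
  proof (cases "\<xi> = 0")
    case True
    have "((\<lambda>\<xi>. \<xi> powr (m - 1)) \<longlongrightarrow> 0 powr (m - 1)) (at 0 within {0::real..})"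
      using continuous_on_powr_nonneg[of "m - 1"] m \<open>m \<noteq> 1\<close> unfolding continuous_on_def by force
    then have "((\<lambda>\<xi>. \<xi> powr (m - 1)) \<longlongrightarrow> 0) (at 0 within {0::real..})" by simp
    then have "((\<lambda>\<xi>. (\<xi> powr m - 0 powr m) / (\<xi> - 0)) \<longlongrightarrow> 0) (at 0 within {0::real..})"
      by (rule Lim_transform_eventually)
         (auto simp: eventually_at_filter powr_diff m)
    then show ?thesis
      using True m \<open>m \<noteq> 1\<close> by (simp add: has_field_derivative_iff dpowr_def)
  next
    case False
    then have "((\<lambda>\<xi>. \<xi> powr m) has_real_derivative m * \<xi> powr (m - 1)) (at \<xi>)"
      using \<xi> by (intro has_real_derivative_powr) auto
    then show ?thesis using \<open>m \<noteq> 1\<close> by (simp add: dpowr_def has_field_derivative_at_within)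
  qed
qed

text \<open>
  A one-sided derivative at \<open>0\<close> suffices for the outer function when the inner one is nonnegative. This
  is how the power \<open>m\<close>, which is not smooth across \<open>0\<close>, is handled.
\<close>

lemma has_derivative_compose_nonneg:
  fixes w :: "'a::euclidean_space \<Rightarrow> real"
  assumes w: "\<And>x. w differentiable (at x)" "\<And>x. w x \<ge> 0"
    and b: "\<And>\<xi>. \<xi> \<ge> 0 \<Longrightarrow> (b has_real_derivative b' \<xi>) (at \<xi> within {0..})"
  shows "((\<lambda>x. b (w x)) has_derivative (\<lambda>k. b' (w x) * dderiv k w x)) (at x)"
proof -
  have "(b has_derivative (*) (b' (w x))) (at (w x) within range w)"
    using b[of "w x"] w(2) by (auto simp: has_field_derivative_def intro: has_derivative_subset)
  from has_derivative_in_compose[OF has_derivative_dderiv[OF w(1)] this] show ?thesis by simp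
qed

text \<open>
  The equation is multiplied by \<open>b' (w)\<close> and integrated by parts. The field
  \<open>b' (w) w\<^sup>m \<nabla>p + Q (w) \<nabla>p + \<epsilon> b' (w) \<nabla>w\<close> has integral of divergence zero; by the choice of \<open>Q\<close> the
  products \<open>\<nabla>w \<bullet> \<nabla>p\<close> with the factor \<open>b'' (w)\<close> cancel in its divergence, and \<open>\<Delta>p = c - w\<close> turns the rest
  into a functional of \<open>w\<close> alone.
\<close>

lemma viscous_energy_identity:
  fixes w p :: "real ^ 'n \<Rightarrow> real"
  assumes m: "m \<ge> 1"
    and w: "periodic w" "C_k 2 w" "\<And>x. w x \<ge> 0"
    and p: "periodic p" "C_k 2 p" "\<And>x. laplacian p x = c - w x"
    and b': "\<And>\<xi>. \<xi> \<ge> 0 \<Longrightarrow> (b' has_real_derivative b'' \<xi>) (at \<xi> within {0..})"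
    and b'': "continuous_on {0..} b''"
    and Q: "\<And>\<xi>. \<xi> \<ge> 0 \<Longrightarrow> (Q has_real_derivative - b'' \<xi> * \<xi> powr m) (at \<xi> within {0..})"
  shows "(LINT x|torus. b' (w x) * (divergence (\<lambda>y. (w y powr m) *\<^sub>R grad p y) x + \<epsilon> * laplacian w x))
       = (LINT x|torus. Q (w x) * (w x - c) - \<epsilon> * b'' (w x) * (\<Sum>i\<in>UNIV. (pd i w x)\<^sup>2))"
proof -
  have wd: "w differentiable (at x)" "pd i w differentiable (at x)" "p differentiable (at x)" "pd i p differentiable (at x)" for i x
    using w(2) p(2) by (auto simp: numeral_2_eq_2 axis_in_Basis)
  have cont: "continuous_on UNIV w" "continuous_on UNIV (pd i w)" "continuous_on UNIV (pd i (pd i w))"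
     "continuous_on UNIV (pd i p)" "continuous_on UNIV (pd i (pd i p))" for i
    using C_k_continuous[OF w(2)] wd w(2) p(2) 
    by (auto simp: numeral_2_eq_2 axis_in_Basis intro!: continuous_at_imp_continuous_on differentiable_imp_continuous_within)
  have comp: "continuous_on UNIV (\<lambda>x. h (w x))" if "continuous_on {0..} h" for h :: "real \<Rightarrow> real"
    by (rule continuous_on_compose2[OF that cont(1)]) (use w(3) in auto)
  have cb': "continuous_on {0..} b'" and cQ: "continuous_on {0..} Q"
    using b' Q by (auto simp: continuous_on_eq_continuous_within intro!: DERIV_continuous)
  have cpow: "continuous_on {0..} (\<lambda>\<xi>::real. \<xi> powr m)" using m by (intro continuous_on_powr_nonneg) auto
  define F where "F x = w x powr m" for x
  have dF: "(F has_derivative (\<lambda>k. dpowr m (w x) * dderiv k w x)) (at x)" for x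
    unfolding F_def using m by (intro has_derivative_compose_nonneg wd w(3) has_derivative_powr_nonneg)
  have dFp: "((\<lambda>y. F y * pd i p y) has_derivative (\<lambda>k. F x * dderiv k (pd i p) x + dpowr m (w x) * dderiv k w x * pd i p x)) (at x)" for i x
    by (intro has_derivative_mult dF has_derivative_dderiv wd)
  have dcw: "((\<lambda>x. h (w x)) has_derivative (\<lambda>k. h' (w x) * dderiv k w x)) (at x)" 
    if "\<And>\<xi>. \<xi> \<ge> 0 \<Longrightarrow> (h has_real_derivative h' \<xi>) (at \<xi> within {0..})" for h h' x
    using has_derivative_compose_nonneg[OF wd(1) w(3) that] by auto
  \<comment> \<open>The contribution of direction \<open>i\<close> to the divergence of the field, which has integral zero.\<close>
  define X where "X i x = b' (w x) * (F x * pd i (pd i p) x + dpowr m (w x) * pd i w x * pd i p x)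
      + Q (w x) * pd i (pd i p) x + \<epsilon> * (b'' (w x) * (pd i w x)\<^sup>2 + b' (w x) * pd i (pd i w) x)" for i x
  have cX: "continuous_on UNIV (X i)" for i
    unfolding X_def F_def
    by (intro continuous_intros cont comp[OF cb'] comp[OF cQ] comp[OF b''] comp[OF cpow] comp[OF continuous_on_dpowr[OF m]])
  have X0: "(LINT x|torus. X i x) = 0" for i
  proof -
    define D where "D x k = b' (w x) * (F x * dderiv k (pd i p) x + dpowr m (w x) * dderiv k w x * pd i p x)
         + b'' (w x) * dderiv k w x * (F x * pd i p x)
         + (Q (w x) * dderiv k (pd i p) x + (- b'' (w x) * w x powr m) * dderiv k w x * pd i p x)
         + \<epsilon> * (b' (w x) * dderiv k (pd i w) x + b'' (w x) * dderiv k w x * pd i w x)" for x k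
    have "((\<lambda>x. b' (w x) * (F x * pd i p x) + Q (w x) * pd i p x + \<epsilon> * (b' (w x) * pd i w x)) has_derivative D x) (at x)" for x
      unfolding D_def
      by (intro has_derivative_add has_derivative_mult_right has_derivative_mult[OF dcw[OF b'] dFp] 
          has_derivative_mult[OF dcw[OF Q]] has_derivative_mult[OF dcw[OF b']] has_derivative_dderiv wd)
    moreover have "D x (axis i 1) = X i x" for x
      by (simp add: D_def X_def F_def power2_eq_square algebra_simps)
    moreover have "periodic (\<lambda>x. b' (w x) * (F x * pd i p x) + Q (w x) * pd i p x + \<epsilon> * (b' (w x) * pd i w x))"
      using w(1) periodic_dderiv[OF w(1)] periodic_dderiv[OF p(1)] by (simp add: periodic_def F_def)
    ultimately show ?thesis
      using torus_integral_derivative_zero[of _ D i] cX[of i] by simp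
  qed
  have div: "divergence (\<lambda>y. (w y powr m) *\<^sub>R grad p y) x
      = (\<Sum>i\<in>UNIV. F x * pd i (pd i p) x + dpowr m (w x) * pd i w x * pd i p x)" for x
  proof -
    have "(\<lambda>y. ((w y powr m) *\<^sub>R grad p y) $ i) = (\<lambda>y. F y * pd i p y)" for i
      by (simp add: grad_def F_def)
    then show ?thesis
      unfolding divergence_def by (simp only: dderiv_eqI[OF dFp])
  qed
  let ?A = "\<lambda>x. b' (w x) * (divergence (\<lambda>y. (w y powr m) *\<^sub>R grad p y) x + \<epsilon> * laplacian w x)"
  let ?B = "\<lambda>x. Q (w x) * (w x - c) - \<epsilon> * b'' (w x) * (\<Sum>i\<in>UNIV. (pd i w x)\<^sup>2)"
  have lapp: "laplacian p x = (\<Sum>i\<in>UNIV. pd i (pd i p) x)" for x by (simp add: laplacian_sum)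
  have A: "?A x - ?B x = (\<Sum>i\<in>UNIV. X i x)" for x
  proof -
    have "(\<Sum>i\<in>UNIV. X i x) = b' (w x) * divergence (\<lambda>y. (w y powr m) *\<^sub>R grad p y) x + Q (w x) * laplacian p x
        + \<epsilon> * (b'' (w x) * (\<Sum>i\<in>UNIV. (pd i w x)\<^sup>2) + b' (w x) * laplacian w x)"
      unfolding X_def sum.distrib sum_distrib_left[symmetric] div laplacian_sum ..
    then show ?thesis unfolding p(3) by (simp add: algebra_simps)
  qed
  have cB: "continuous_on UNIV ?B"
    by (intro continuous_intros cont comp[OF cQ] comp[OF b''])
  have iX: "integrable torus (\<lambda>x. \<Sum>i\<in>UNIV. X i x)" 
    by (intro continuous_integrable_torus continuous_intros cX)
  have "?A = (\<lambda>x. ?B x + (\<Sum>i\<in>UNIV. X i x))" using A by (auto simp: fun_eq_iff algebra_simps)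
  then have "(LINT x|torus. ?A x) = (LINT x|torus. ?B x + (\<Sum>i\<in>UNIV. X i x))" by simp
  also have "\<dots> = (LINT x|torus. ?B x) + (LINT x|torus. (\<Sum>i\<in>UNIV. X i x))"
    by (rule Bochner_Integration.integral_add[OF continuous_integrable_torus[OF cB] iX])
  also have "(LINT x|torus. (\<Sum>i\<in>UNIV. X i x)) = 0"
    by (subst Bochner_Integration.integral_sum) (auto intro: continuous_integrable_torus[OF cX] simp: X0)
  finally show ?thesis by simp
qed

section \<open>Evolution of integral functionals along viscous solutions\<close>

lemma classical_viscous_solutionD:
  assumes "classical_viscous_solution m g \<epsilon> v0 v"
  shows "\<And>t. t \<ge> 0 \<Longrightarrow> periodic (v t)" "\<And>t x. t \<ge> 0 \<Longrightarrow> 0 \<le> v t x" "v 0 = v0"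
    "continuous_on ({0..} \<times> UNIV) (\<lambda>(t, x). v t x)"
    "\<And>t. t > 0 \<Longrightarrow> C_k 2 (v t)"
    "\<And>t x. t > 0 \<Longrightarrow> (\<lambda>\<tau>. v \<tau> x) differentiable (at t)"
    "continuous_on ({0<..} \<times> UNIV) (\<lambda>(t, x). deriv (\<lambda>\<tau>. v \<tau> x) t)"
    "\<And>t x. t > 0 \<Longrightarrow> deriv (\<lambda>\<tau>. v \<tau> x) t
        = divergence (\<lambda>y. (v t y powr m) *\<^sub>R grad (conv g (v t)) y) x + \<epsilon> * laplacian (v t) x"
  using assms unfolding classical_viscous_solution_def velocity_def by (auto simp: algebra_simps)

lemma viscous_solution_continuous:
  assumes "classical_viscous_solution m g \<epsilon> v0 v" "t \<ge> 0"
  shows "continuous_on UNIV (v t)"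
proof -
  have "continuous_on UNIV (\<lambda>x. (\<lambda>(t, x). v t x) (t, x))"
    by (rule continuous_on_compose2[OF classical_viscous_solutionD(4)[OF assms(1)]])
       (use assms(2) in \<open>auto intro!: continuous_intros\<close>)
  then show ?thesis by simp
qed

text \<open>
  The mean value theorem instead of an integral in time: up to time \<open>0\<close> the solution is only continuous,
  and later only a lower bound of the derivative at one intermediate time is needed.
\<close>

lemma viscous_evolution:
  fixes v :: "real \<Rightarrow> real ^ 'n \<Rightarrow> real" and \<omega> :: "real \<Rightarrow> real ^ 'n \<Rightarrow> real"
  assumes m: "m \<ge> 1" and g: "green_kernel g" and \<omega>: "mollifiers \<omega>"
    and v: "classical_viscous_solution m g \<epsilon> v0 v"
    and b: "\<And>\<xi>. \<xi> \<ge> 0 \<Longrightarrow> (b has_real_derivative b' \<xi>) (at \<xi> within {0..})"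
    and b': "\<And>\<xi>. \<xi> \<ge> 0 \<Longrightarrow> (b' has_real_derivative b'' \<xi>) (at \<xi> within {0..})"
    and b'': "continuous_on {0..} b''"
    and Q: "\<And>\<xi>. \<xi> \<ge> 0 \<Longrightarrow> (Q has_real_derivative - b'' \<xi> * \<xi> powr m) (at \<xi> within {0..})"
    and st: "0 \<le> s" "s < t"
  obtains z where "s < z" "z < t" 
    "(LINT x|torus. b (v t x)) - (LINT x|torus. b (v s x)) = (t - s) * 
       (LINT x|torus. Q (v z x) * (v z x - mean (v z)) - \<epsilon> * b'' (v z x) * (\<Sum>i\<in>UNIV. (pd i (v z) x)\<^sup>2))"
proof -
  note V = classical_viscous_solutionD[OF v]
  have gp: "periodic g" "integrable torus g" using g by (auto simp: green_kernel_def)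
  have cb: "continuous_on {0..} b" and cb': "continuous_on {0..} b'"
    using b b' by (auto simp: continuous_on_eq_continuous_within intro!: DERIV_continuous)
  have vc: "continuous_on UNIV (\<lambda>x. h (v r x))" if "r \<ge> 0" "continuous_on {0..} h" for r and h :: "real \<Rightarrow> real"
    by (rule continuous_on_compose2[OF that(2) viscous_solution_continuous[OF v that(1)]]) (use V(2)[OF that(1)] in auto)
  define E where "E r = integral (cbox 0 1) (\<lambda>x. b (v r x))" for r
  have E: "(LINT x|torus. b (v r x)) = E r" if "r \<ge> 0" for r
    unfolding E_def by (rule torus_integral_eq[OF continuous_integrable_torus[OF vc[OF that cb]]])
  have "continuous_on ({0..} \<times> cbox 0 1) (\<lambda>x. b ((\<lambda>(t, x). v t x) x))"
    by (rule continuous_on_compose2[OF cb continuous_on_subset[OF V(4)]]) (use V(2) in auto)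
  then have "continuous_on ({0..} \<times> cbox 0 1) (\<lambda>(t, x). b (v t x))"
    by (simp add: split_beta)
  then have Ec: "continuous_on {0..} E"
    unfolding E_def by (rule integral_continuous_on_param)
  define E' where "E' r = integral (cbox 0 1) (\<lambda>x. b' (v r x) * deriv (\<lambda>\<tau>. v \<tau> x) r)" for r
  have Ed: "(E has_real_derivative E' r) (at r)" if r: "r > 0" for r
  proof -
    have "(E has_real_derivative E' r) (at r within {0<..})"
      unfolding E_def E'_def
    proof (rule leibniz_rule_field_derivative[where fx = "\<lambda>r x. b' (v r x) * deriv (\<lambda>\<tau>. v \<tau> x) r"])
      fix \<tau> :: real and x :: "real ^ 'n" assume \<tau>: "\<tau> \<in> {0<..}"
      have "((\<lambda>\<tau>. v \<tau> x) has_real_derivative deriv (\<lambda>\<tau>. v \<tau> x) \<tau>) (at \<tau> within {0<..})"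
        using V(6)[of \<tau> x] \<tau> by (auto simp: real_differentiable_def DERIV_imp_deriv has_field_derivative_at_within)
      moreover have "(b has_real_derivative b' (v \<tau> x)) (at (v \<tau> x) within (\<lambda>\<tau>. v \<tau> x) ` {0<..})"
        using b[of "v \<tau> x"] V(2) \<tau> by (auto intro: has_field_derivative_subset)
      ultimately show "((\<lambda>\<tau>. b (v \<tau> x)) has_real_derivative b' (v \<tau> x) * deriv (\<lambda>\<tau>. v \<tau> x) \<tau>) (at \<tau> within {0<..})"
        using DERIV_image_chain[of b _ "\<lambda>\<tau>. v \<tau> x" \<tau> "{0<..}"] by (simp add: o_def)
    next
      fix \<tau> :: real assume "\<tau> \<in> {0<..}"
      then show "(\<lambda>x. b (v \<tau> x)) integrable_on cbox 0 1"
        using vc[of \<tau>, OF _ cb] by (auto intro!: integrable_continuous intro: continuous_on_subset)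
    next
      have "continuous_on ({0<..} \<times> UNIV) (\<lambda>x. b' ((\<lambda>(t, x). v t x) x))"
        by (rule continuous_on_compose2[OF cb' continuous_on_subset[OF V(4)]]) (use V(2) in auto)
      then have "continuous_on ({0<..} \<times> UNIV) (\<lambda>x. b' ((\<lambda>(t, x). v t x) x) * (\<lambda>(t, x). deriv (\<lambda>\<tau>. v \<tau> x) t) x)"
        by (intro continuous_on_mult V(7))
      then show "continuous_on ({0<..} \<times> cbox 0 1) (\<lambda>(r, x). b' (v r x) * deriv (\<lambda>\<tau>. v \<tau> x) r)"
        by (auto simp: split_beta intro: continuous_on_subset)
    qed (use r in auto)
    then show ?thesis using r by (simp add: at_within_open[of r "{0<..}"])
  qed
  have E'eq: "E' r = (LINT x|torus. Q (v r x) * (v r x - mean (v r)) - \<epsilon> * b'' (v r x) * (\<Sum>i\<in>UNIV. (pd i (v r) x)\<^sup>2))"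
    if r: "r > 0" for r
  proof -
    have "continuous_on UNIV (\<lambda>x. (\<lambda>(t, x). deriv (\<lambda>\<tau>. v \<tau> x) t) (r, x))"
      by (rule continuous_on_compose2[OF V(7)]) (use r in \<open>auto intro!: continuous_intros\<close>)
    then have "continuous_on UNIV (\<lambda>x. b' (v r x) * deriv (\<lambda>\<tau>. v \<tau> x) r)"
      using vc[OF _ cb', of r] r by (intro continuous_on_mult) auto
    then have "E' r = (LINT x|torus. b' (v r x) * deriv (\<lambda>\<tau>. v \<tau> x) r)"
      unfolding E'_def by (rule torus_integral_eq[OF continuous_integrable_torus, symmetric])
    also have "\<dots> = (LINT x|torus. b' (v r x) * (divergence (\<lambda>y. (v r y powr m) *\<^sub>R grad (conv g (v r)) y) x + \<epsilon> * laplacian (v r) x))"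
      using V(8)[OF r] by simp
    also have "\<dots> = (LINT x|torus. Q (v r x) * (v r x - mean (v r)) - \<epsilon> * b'' (v r x) * (\<Sum>i\<in>UNIV. (pd i (v r) x)\<^sup>2))"
      using r by (intro viscous_energy_identity m V periodic_conv gp C_k_conv laplacian_conv_green[OF g \<omega>] b' b'' Q) auto
    finally show ?thesis .
  qed
  obtain z where z: "s < z" "z < t" "E t - E s = (t - s) * E' z"
  proof -
    have "\<exists>l z. z > s \<and> z < t \<and> DERIV E z :> l \<and> E t - E s = (t - s) * l"
    proof (rule MVT[OF st(2)])
      show "continuous_on {s..t} E" by (rule continuous_on_subset[OF Ec]) (use st in auto)
      show "E differentiable (at x)" if "s < x" "x < t" for x
        using Ed[of x] that st real_differentiable_def by force
    qed
    then show ?thesis using that Ed st by (metis DERIV_unique order_le_less_trans)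
  qed
  then show ?thesis using that E'eq[of z] E st by auto
qed

text \<open>
  The case \<open>b (\<xi>) = \<xi>\<close>, \<open>Q = 0\<close>.
\<close>

lemma viscous_mean:
  fixes v :: "real \<Rightarrow> real ^ 'n \<Rightarrow> real" and \<omega> :: "real \<Rightarrow> real ^ 'n \<Rightarrow> real"
  assumes m: "m \<ge> 1" and g: "green_kernel g" and \<omega>: "mollifiers \<omega>"
    and v: "classical_viscous_solution m g \<epsilon> v0 v" and t: "t \<ge> 0"
  shows "mean (v t) = mean v0"
proof (cases "t = 0")
  case True
  then show ?thesis using classical_viscous_solutionD(3)[OF v] by simp
next
  case False
  have "\<exists>z. (LINT x|torus. v t x) - (LINT x|torus. v 0 x) = (t - 0) * 
       (LINT x|torus. 0 * (v z x - mean (v z)) - \<epsilon> * 0 * (\<Sum>i\<in>UNIV. (pd i (v z) x)\<^sup>2))"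
    by (rule viscous_evolution[OF m g \<omega> v, of "\<lambda>\<xi>. \<xi>" "\<lambda>_. 1" "\<lambda>_. 0" "\<lambda>_. 0" 0 t])
       (use t False in \<open>auto intro!: derivative_eq_intros\<close>)
  then show ?thesis using classical_viscous_solutionD(3)[OF v] by (simp add: mean_def)
qed

section \<open>Truncations\<close>

text \<open>
  A \<open>C\<^sup>2\<close> substitute for \<open>min \<xi> \<tau>\<close>: concave, with slope \<open>1\<close> at \<open>0\<close> and constant \<open>\<tau> / 3\<close> above \<open>\<tau>\<close>.
\<close>

definition trunc :: "real \<Rightarrow> real \<Rightarrow> real" where
  "trunc \<tau> \<xi> = \<tau> / 3 * (1 - (max 0 (1 - \<xi> / \<tau>)) ^ 3)"

definition trunc' :: "real \<Rightarrow> real \<Rightarrow> real" where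
  "trunc' \<tau> \<xi> = (max 0 (1 - \<xi> / \<tau>))\<^sup>2"

text \<open>
  The function \<open>Q\<close> of \<open>viscous_evolution\<close> that belongs to \<open>b = trunc \<tau>\<close>.
\<close>

definition trunc_weight :: "real \<Rightarrow> real \<Rightarrow> real \<Rightarrow> real" where
  "trunc_weight m \<tau> \<xi> = integral {0..\<xi>} (\<lambda>r. 2 / \<tau> * max 0 (1 - r / \<tau>) * r powr m)"

lemma has_derivative_pos_part_power:
  assumes "n \<ge> 2"
  shows "((\<lambda>y. (max 0 y) ^ n) has_real_derivative n * (max 0 y) ^ (n - 1)) (at y)"
proof -
  consider "y > 0" | "y < 0" | "y = 0" by linarith
  then show ?thesis
  proof cases
    case 1
    have "((\<lambda>y. y ^ n) has_real_derivative n * y ^ (n - 1)) (at y)"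
      by (auto intro!: derivative_eq_intros)
    from has_field_derivative_transform_within_open[OF this open_greaterThan[of 0], of "\<lambda>y. (max 0 y) ^ n"]
    show ?thesis using 1 by (simp add: max_def)
  next
    case 2
    have "((\<lambda>y. 0) has_real_derivative 0) (at y)" by simp
    from has_field_derivative_transform_within_open[OF this open_lessThan[of 0], of "\<lambda>y. (max 0 y) ^ n"]
    show ?thesis using 2 assms by (simp add: max_def zero_power)
  next
    case 3
    have "((\<lambda>h. (max 0 h) ^ (n - 1)) \<longlongrightarrow> (max 0 (0::real)) ^ (n - 1)) (at 0)"
      by (intro tendsto_intros)
    then have lim: "((\<lambda>h. (max 0 h) ^ (n - 1)) \<longlongrightarrow> (0::real)) (at 0)" using assms by (simp add: zero_power)
    have ev: "\<forall>\<^sub>F h in at 0. (max 0 h) ^ (n - 1) = ((max 0 h) ^ n - (max 0 0) ^ n) / (h :: real)"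
      unfolding eventually_at_filter
    proof (rule always_eventually, intro allI impI)
      fix h :: real assume "h \<noteq> 0"
      obtain k where n: "n = Suc (Suc k)" using assms by (metis Suc_le_D numeral_2_eq_2 Suc_le_mono)
      show "(max 0 h) ^ (n - 1) = ((max 0 h) ^ n - (max 0 0) ^ n) / h"
        using \<open>h \<noteq> 0\<close> by (cases "h > 0") (auto simp: n max_def)
    qed
    have "((\<lambda>h. ((max 0 h) ^ n - (max 0 0) ^ n) / h) \<longlongrightarrow> (0::real)) (at 0)"
      by (rule Lim_transform_eventually[OF lim ev])
    then show ?thesis using 3 assms by (simp add: DERIV_def zero_power)
  qed
qed

lemma has_derivative_trunc:
  assumes "\<tau> > 0"
  shows "(trunc \<tau> has_real_derivative trunc' \<tau> \<xi>) (at \<xi> within S)"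
    and "(trunc' \<tau> has_real_derivative - (2 / \<tau> * max 0 (1 - \<xi> / \<tau>))) (at \<xi> within S)"
proof -
  have d: "((\<lambda>\<xi>. (max 0 (1 - \<xi> / \<tau>)) ^ n) has_real_derivative n * (max 0 (1 - \<xi> / \<tau>)) ^ (n - 1) * (- 1 / \<tau>)) (at \<xi>)"
    if "n \<ge> 2" for n :: nat
    by (rule DERIV_chain2[OF has_derivative_pos_part_power[OF that]]) (use assms in \<open>auto intro!: derivative_eq_intros\<close>)
  have "(trunc \<tau> has_real_derivative \<tau> / 3 * (0 - (real 3 * (max 0 (1 - \<xi> / \<tau>)) ^ (3 - 1) * (- 1 / \<tau>)))) (at \<xi>)"
    unfolding trunc_def[abs_def] by (intro DERIV_cmult DERIV_diff d DERIV_const) simp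
  moreover have "\<tau> / 3 * (0 - (real 3 * (max 0 (1 - \<xi> / \<tau>)) ^ (3 - 1) * (- 1 / \<tau>))) = trunc' \<tau> \<xi>"
    using assms by (simp add: trunc'_def)
  ultimately show "(trunc \<tau> has_real_derivative trunc' \<tau> \<xi>) (at \<xi> within S)"
    by (metis has_field_derivative_at_within)
  have "(trunc' \<tau> has_real_derivative real 2 * (max 0 (1 - \<xi> / \<tau>)) ^ (2 - 1) * (- 1 / \<tau>)) (at \<xi>)"
    unfolding trunc'_def[abs_def] by (intro d) simp
  then show "(trunc' \<tau> has_real_derivative - (2 / \<tau> * max 0 (1 - \<xi> / \<tau>))) (at \<xi> within S)"
    by (simp add: has_field_derivative_at_within)
qed

text \<open>
  With \<open>p\<close> and \<open>q\<close> the positive parts at \<open>\<xi>\<close> and \<open>a\<close>, the difference of the two sides is at least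
  \<open>\<tau> / 3 * (p - q)\<^sup>2 * (p + 2 * q)\<close>.
\<close>

lemma trunc_concave:
  assumes "\<tau> > 0"
  shows "trunc \<tau> \<xi> \<le> trunc \<tau> a + trunc' \<tau> a * (\<xi> - a)"
proof -
  define p q where "p = max 0 (1 - \<xi> / \<tau>)" and "q = max 0 (1 - a / \<tau>)"
  have pq: "p \<ge> 0" "q \<ge> 0" "\<xi> \<ge> \<tau> * (1 - p)" using assms by (auto simp: p_def q_def field_simps max_def)
  have "q\<^sup>2 * (\<xi> - a) \<ge> q\<^sup>2 * (\<tau> * (q - p))"
  proof (cases "q = 0")
    case False
    then have "a = \<tau> * (1 - q)" using assms by (auto simp: q_def field_simps max_def split: if_splits)
    then show ?thesis using pq by (intro mult_left_mono) (auto simp: algebra_simps)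
  qed simp
  moreover have "0 \<le> \<tau> / 3 * ((p - q)\<^sup>2 * (p + 2 * q))" using assms pq by (intro mult_nonneg_nonneg) auto
  moreover have "\<tau> / 3 * ((p - q)\<^sup>2 * (p + 2 * q)) = \<tau> / 3 * (1 - q ^ 3) + q\<^sup>2 * (\<tau> * (q - p)) - \<tau> / 3 * (1 - p ^ 3)"
    by (simp add: power2_eq_square power3_eq_cube field_simps)
  ultimately show ?thesis by (simp add: trunc_def trunc'_def p_def q_def)
qed

lemma trunc'_bounds: "\<tau> > 0 \<Longrightarrow> \<xi> \<ge> 0 \<Longrightarrow> 0 \<le> trunc' \<tau> \<xi> \<and> trunc' \<tau> \<xi> \<le> 1"
  by (auto simp: trunc'_def max_def intro!: power_le_one)

lemma trunc_bounds: 
  assumes "\<tau> > 0" "\<xi> \<ge> 0"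
  shows "0 \<le> trunc \<tau> \<xi>" "trunc \<tau> \<xi> \<le> \<tau> / 3"
proof -
  have "0 \<le> max 0 (1 - \<xi> / \<tau>)" "max 0 (1 - \<xi> / \<tau>) \<le> 1" using assms by (auto simp: max_def)
  then have "0 \<le> (max 0 (1 - \<xi> / \<tau>)) ^ 3" "(max 0 (1 - \<xi> / \<tau>)) ^ 3 \<le> 1" by (auto intro: power_le_one)
  then show "0 \<le> trunc \<tau> \<xi>" "trunc \<tau> \<xi> \<le> \<tau> / 3" unfolding trunc_def using assms
    by (auto simp: mult_le_cancel_left1 )
qed

lemma trunc_0 [simp]: "trunc \<tau> 0 = 0" by (simp add: trunc_def)

lemma trunc_above: "\<tau> > 0 \<Longrightarrow> \<xi> \<ge> \<tau> \<Longrightarrow> trunc \<tau> \<xi> = \<tau> / 3"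
  by (simp add: trunc_def max_def)

lemma trunc_lipschitz:
  assumes "\<tau> > 0" "\<xi> \<ge> 0" "\<eta> \<ge> 0"
  shows "\<bar>trunc \<tau> \<xi> - trunc \<tau> \<eta>\<bar> \<le> \<bar>\<xi> - \<eta>\<bar>"
proof -
  have "trunc \<tau> a - trunc \<tau> b \<le> \<bar>a - b\<bar>" if "b \<ge> 0" for a b
  proof -
    have "trunc' \<tau> b * (a - b) \<le> trunc' \<tau> b * \<bar>a - b\<bar>"
      using trunc'_bounds[OF assms(1) that] by (intro mult_left_mono) auto
    also have "\<dots> \<le> 1 * \<bar>a - b\<bar>"
      using trunc'_bounds[OF assms(1) that] by (intro mult_right_mono) auto
    finally show ?thesis using trunc_concave[OF assms(1), of a b] by simp
  qed
  from this[of \<eta> \<xi>] this[of \<xi> \<eta>] show ?thesis using assms by (simp add: abs_le_iff abs_minus_commute)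
qed

lemma continuous_on_trunc: "\<tau> > 0 \<Longrightarrow> continuous_on S (trunc \<tau>)"
  unfolding trunc_def[abs_def] by (intro continuous_intros) auto

context
  fixes m \<tau> :: real
  assumes m: "m \<ge> 1" and \<tau>: "\<tau> > 0"
begin

lemma continuous_on_weight_density: "continuous_on {0..} (\<lambda>r. 2 / \<tau> * max 0 (1 - r / \<tau>) * r powr m)"
  using \<tau> m by (intro continuous_on_mult continuous_on_powr_nonneg continuous_intros) auto

lemma has_derivative_trunc_weight:
  assumes "\<xi> \<ge> 0"
  shows "(trunc_weight m \<tau> has_real_derivative 2 / \<tau> * max 0 (1 - \<xi> / \<tau>) * \<xi> powr m) (at \<xi> within {0..})"
proof -
  have "(trunc_weight m \<tau> has_real_derivative 2 / \<tau> * max 0 (1 - \<xi> / \<tau>) * \<xi> powr m) (at \<xi> within {0..\<xi> + 1})"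
    unfolding trunc_weight_def[abs_def] using assms
    by (intro integral_has_real_derivative continuous_on_subset[OF continuous_on_weight_density]) auto
  moreover have "at \<xi> within {0..\<xi> + 1} = at \<xi> within {0..}"
    by (rule at_within_nhd[of _ "{..<\<xi> + 1}"]) auto
  ultimately show ?thesis by simp
qed

lemma trunc_weight_diff:
  assumes "0 \<le> a" "a \<le> b"
  shows "trunc_weight m \<tau> b - trunc_weight m \<tau> a = integral {a..b} (\<lambda>r. 2 / \<tau> * max 0 (1 - r / \<tau>) * r powr m)"
proof -
  have "(\<lambda>r. 2 / \<tau> * max 0 (1 - r / \<tau>) * r powr m) integrable_on {0..b}"
    by (intro integrable_continuous_real continuous_on_subset[OF continuous_on_weight_density]) auto
  from Henstock_Kurzweil_Integration.integral_combine[OF assms this] show ?thesis by (simp add: trunc_weight_def)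
qed

lemma trunc_weight_integrable:
  "0 \<le> a \<Longrightarrow> (\<lambda>r. 2 / \<tau> * max 0 (1 - r / \<tau>) * r powr m) integrable_on {a..b}"
  by (intro integrable_continuous_real continuous_on_subset[OF continuous_on_weight_density]) auto

lemma trunc_weight_mono:
  assumes "0 \<le> a" "a \<le> b"
  shows "trunc_weight m \<tau> a \<le> trunc_weight m \<tau> b"
proof -
  have "0 \<le> integral {a..b} (\<lambda>r. 2 / \<tau> * max 0 (1 - r / \<tau>) * r powr m)"
    using \<tau> assms by (intro Henstock_Kurzweil_Integration.integral_nonneg trunc_weight_integrable) auto
  then show ?thesis using trunc_weight_diff[OF assms] by simp
qed

lemma trunc_weight_above:
  assumes "\<xi> \<ge> \<tau>"
  shows "trunc_weight m \<tau> \<xi> = trunc_weight m \<tau> \<tau>"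
proof -
  have "integral {\<tau>..\<xi>} (\<lambda>r. 2 / \<tau> * max 0 (1 - r / \<tau>) * r powr m) = integral {\<tau>..\<xi>} (\<lambda>r. 0)"
    using \<tau> by (intro integral_cong) (auto simp: max_def)
  then show ?thesis using trunc_weight_diff[of \<tau> \<xi>] assms \<tau> by simp
qed

text \<open>
  On the middle part \<open>[\<tau> / 2, 3 \<tau> / 4]\<close> of the range the integrand is at least \<open>(\<tau> / 2) powr m / (2 * \<tau>)\<close>.
\<close>

lemma trunc_weight_gap: "trunc_weight m \<tau> \<tau> - trunc_weight m \<tau> (\<tau> / 2) \<ge> (\<tau> / 2) powr m / 8"
proof -
  have "integral {\<tau> / 2..3 * \<tau> / 4} (\<lambda>r. 1 / (2 * \<tau>) * (\<tau> / 2) powr m) \<le> integral {\<tau> / 2..3 * \<tau> / 4} (\<lambda>r. 2 / \<tau> * max 0 (1 - r / \<tau>) * r powr m)"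
  proof (rule integral_le)
    fix r assume r: "r \<in> {\<tau> / 2..3 * \<tau> / 4}"
    have "1 / (2 * \<tau>) \<le> 2 / \<tau> * max 0 (1 - r / \<tau>)" using r \<tau> by (auto simp: field_simps max_def)
    moreover have "(\<tau> / 2) powr m \<le> r powr m" using r \<tau> m by (intro powr_mono2) auto
    ultimately show "1 / (2 * \<tau>) * (\<tau> / 2) powr m \<le> 2 / \<tau> * max 0 (1 - r / \<tau>) * r powr m"
      using \<tau> by (intro mult_mono) auto
  next
    show "(\<lambda>r. 2 / \<tau> * max 0 (1 - r / \<tau>) * r powr m) integrable_on {\<tau> / 2..3 * \<tau> / 4}"
      using \<tau> by (intro trunc_weight_integrable) auto
  qed (rule integrable_const_ivl)
  also have "\<dots> = trunc_weight m \<tau> (3 * \<tau> / 4) - trunc_weight m \<tau> (\<tau> / 2)"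
    using \<tau> by (intro trunc_weight_diff[symmetric]) auto
  also have "\<dots> \<le> trunc_weight m \<tau> \<tau> - trunc_weight m \<tau> (\<tau> / 2)"
    using \<tau> trunc_weight_mono[of "3 * \<tau> / 4" \<tau>] by simp
  finally show ?thesis using \<tau> by (simp add: field_simps)
qed

end

section \<open>Spreading of viscous solutions\<close>

text \<open>
  Replacing \<open>Q (v)\<close> by \<open>Q (v) - Q (\<tau>)\<close> costs nothing because \<open>v - mean v\<close> has integral zero, and it confines
  the integrand to the points with \<open>v < \<tau>\<close>.
\<close>

lemma viscous_trunc_step:
  fixes v :: "real \<Rightarrow> real ^ 'n \<Rightarrow> real" and \<omega> :: "real \<Rightarrow> real ^ 'n \<Rightarrow> real"
  assumes m: "m \<ge> 1" and g: "green_kernel g" and \<omega>: "mollifiers \<omega>"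
    and v: "classical_viscous_solution m g \<epsilon> v0 v" and \<epsilon>: "\<epsilon> > 0"
    and \<tau>: "\<tau> > 0" and st: "0 \<le> s" "s < t"
  obtains z where "s < z" "z < t" 
    "(LINT x|torus. trunc \<tau> (v t x)) - (LINT x|torus. trunc \<tau> (v s x)) \<ge> (t - s) * 
       (LINT x|torus. (trunc_weight m \<tau> \<tau> - trunc_weight m \<tau> (v z x)) * (mean v0 - v z x))"
proof -
  note V = classical_viscous_solutionD[OF v]
  define b'' where "b'' \<xi> = - (2 / \<tau> * max 0 (1 - \<xi> / \<tau>))" for \<xi>
  define Q where "Q = trunc_weight m \<tau>"
  have Qd: "(Q has_real_derivative - b'' \<xi> * \<xi> powr m) (at \<xi> within {0..})" if "\<xi> \<ge> 0" for \<xi>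
    using has_derivative_trunc_weight[OF m \<tau> that] by (simp add: b''_def Q_def)
  have cb'': "continuous_on {0..} b''" unfolding b''_def[abs_def] using \<tau> by (intro continuous_intros) auto
  have cQ: "continuous_on {0..} Q"
    using Qd by (auto simp: continuous_on_eq_continuous_within intro!: DERIV_continuous)
  obtain z where z: "s < z" "z < t"
    "(LINT x|torus. trunc \<tau> (v t x)) - (LINT x|torus. trunc \<tau> (v s x)) = (t - s) * 
       (LINT x|torus. Q (v z x) * (v z x - mean (v z)) - \<epsilon> * b'' (v z x) * (\<Sum>i\<in>UNIV. (pd i (v z) x)\<^sup>2))"
    using viscous_evolution[OF m g \<omega> v has_derivative_trunc(1)[OF \<tau>] has_derivative_trunc(2)[OF \<tau>, folded b''_def] cb'' Qd st]
    by blast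
  have z0: "z > 0" using z(1) st by simp
  have mean: "mean (v z) = mean v0" using viscous_mean[OF m g \<omega> v] z0 by simp
  define w where "w = v z"
  have w: "periodic w" "C_k 2 w" "\<And>x. w x \<ge> 0" using V z0 by (auto simp: w_def)
  have cw: "continuous_on UNIV w" using w(2) by (rule C_k_continuous)
  have comp: "continuous_on UNIV (\<lambda>x. h (w x))" if "continuous_on {0..} h" for h :: "real \<Rightarrow> real"
    by (rule continuous_on_compose2[OF that cw]) (use w(3) in auto)
  have cdw: "continuous_on UNIV (pd i w)" for i
    using w(2) by (auto simp: numeral_2_eq_2 axis_in_Basis intro!: continuous_at_imp_continuous_on differentiable_imp_continuous_within)
  have "(LINT x|torus. (Q \<tau> - Q (w x)) * (mean v0 - w x))
      = (LINT x|torus. Q (w x) * (w x - mean v0) + Q \<tau> * (mean v0 - w x))"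
    by (simp add: algebra_simps)
  also have "\<dots> = (LINT x|torus. Q (w x) * (w x - mean v0)) + (LINT x|torus. Q \<tau> * (mean v0 - w x))"
    by (intro Bochner_Integration.integral_add continuous_integrable_torus continuous_intros cw comp[OF cQ])
  also have "(LINT x|torus. Q \<tau> * (mean v0 - w x)) = 0"
    using mean by (simp add: continuous_integrable_torus[OF cw] mean_def w_def[symmetric])
  also have "(LINT x|torus. Q (w x) * (w x - mean v0)) + 0
      \<le> (LINT x|torus. Q (w x) * (w x - mean v0) - \<epsilon> * b'' (w x) * (\<Sum>i\<in>UNIV. (pd i w x)\<^sup>2))"
  proof (simp only: add_0_right, rule integral_mono)
    fix x
    have "\<epsilon> * b'' (w x) \<le> 0" using \<epsilon> \<tau> by (simp add: b''_def mult_le_0_iff)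
    then have "\<epsilon> * b'' (w x) * (\<Sum>i\<in>UNIV. (pd i w x)\<^sup>2) \<le> 0"
      by (rule mult_nonpos_nonneg) (simp add: sum_nonneg)
    then show "Q (w x) * (w x - mean v0) \<le> Q (w x) * (w x - mean v0) - \<epsilon> * b'' (w x) * (\<Sum>i\<in>UNIV. (pd i w x)\<^sup>2)"
      by simp
  qed (intro continuous_integrable_torus continuous_intros cw comp[OF cQ] comp[OF cb''] cdw)+
  finally have "(t - s) * (LINT x|torus. (Q \<tau> - Q (w x)) * (mean v0 - w x)) \<le> (t - s) *
      (LINT x|torus. Q (w x) * (w x - mean v0) - \<epsilon> * b'' (w x) * (\<Sum>i\<in>UNIV. (pd i w x)\<^sup>2))"
    using st by (intro mult_left_mono) auto
  then show ?thesis
    using that[OF z(1,2)] z(3) mean by (simp add: w_def Q_def)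
qed

text \<open>
  On \<open>{v < \<tau> / 2}\<close> the growth rate has the integrand at least \<open>\<kappa> = mean v0 / 2 * (\<tau> / 2) powr m / 8\<close>. The
  indicator of this set is bounded below by \<open>1 - 6 / \<tau> * trunc (\<tau> / 2) v\<close>, whose integral is decreasing in
  time by the same growth estimate at height \<open>\<tau> / 2\<close>. So its value at the intermediate time may be
  replaced by the value at the final time \<open>t\<close>.
\<close>

lemma viscous_spreading:
  fixes v :: "real \<Rightarrow> real ^ 'n \<Rightarrow> real" and \<omega> :: "real \<Rightarrow> real ^ 'n \<Rightarrow> real"
  assumes m: "m \<ge> 1" and g: "green_kernel g" and \<omega>: "mollifiers \<omega>"
    and v: "classical_viscous_solution m g \<epsilon> v0 v" and \<epsilon>: "\<epsilon> > 0"
    and \<tau>: "\<tau> > 0" "2 * \<tau> \<le> mean v0" and t: "t > 0"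
  shows "(LINT x|torus. trunc \<tau> (v t x)) \<ge> (LINT x|torus. trunc \<tau> (v0 x))
      + t * (mean v0 / 2 * ((\<tau> / 2) powr m / 8) * (1 - 6 / \<tau> * (LINT x|torus. trunc (\<tau> / 2) (v t x))))"
proof -
  note V = classical_viscous_solutionD[OF v]
  have cont: "continuous_on UNIV (v s)" if "s \<ge> 0" for s using viscous_solution_continuous[OF v that] .
  have tc: "continuous_on UNIV (\<lambda>x. trunc a (v s x))" if "s \<ge> 0" "a > 0" for s a
    by (rule continuous_on_compose2[OF continuous_on_trunc[OF that(2)] cont[OF that(1)]]) auto
  have wd: "continuous_on {0..} (trunc_weight m a)" if "a > 0" for a
    using has_derivative_trunc_weight[OF m that]
    by (auto simp: continuous_on_eq_continuous_within intro!: DERIV_continuous)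
  have wc: "continuous_on UNIV (\<lambda>x. trunc_weight m a (v s x))" if "s \<ge> 0" "a > 0" for s a
    by (rule continuous_on_compose2[OF wd[OF that(2)] cont[OF that(1)]]) (use V(2) that in auto)
  have \<tau>2: "\<tau> / 2 > 0" using \<tau> by simp
  have mono: "(LINT x|torus. trunc (\<tau> / 2) (v s x)) \<le> (LINT x|torus. trunc (\<tau> / 2) (v t x))" if s: "0 \<le> s" "s < t" for s
  proof -
    obtain z where z: "s < z" "z < t" 
      "(LINT x|torus. trunc (\<tau> / 2) (v t x)) - (LINT x|torus. trunc (\<tau> / 2) (v s x)) \<ge> (t - s) * 
       (LINT x|torus. (trunc_weight m (\<tau> / 2) (\<tau> / 2) - trunc_weight m (\<tau> / 2) (v z x)) * (mean v0 - v z x))"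
      using viscous_trunc_step[OF m g \<omega> v \<epsilon> \<tau>2 s] by blast
    have "0 \<le> (trunc_weight m (\<tau> / 2) (\<tau> / 2) - trunc_weight m (\<tau> / 2) (v z x)) * (mean v0 - v z x)" for x
    proof (cases "v z x < \<tau> / 2")
      case True
      then show ?thesis
        using trunc_weight_mono[OF m, of "\<tau> / 2" "v z x" "\<tau> / 2"] V(2)[of z x] \<tau> z(1) s
        by (intro mult_nonneg_nonneg) auto
    next
      case False
      then show ?thesis using trunc_weight_above[OF m, of "\<tau> / 2" "v z x"] \<tau> by simp
    qed
    then have "0 \<le> (LINT x|torus. (trunc_weight m (\<tau> / 2) (\<tau> / 2) - trunc_weight m (\<tau> / 2) (v z x)) * (mean v0 - v z x))"
      by (intro integral_nonneg_AE AE_I2)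
    then have "0 \<le> (t - s) * (LINT x|torus. (trunc_weight m (\<tau> / 2) (\<tau> / 2) - trunc_weight m (\<tau> / 2) (v z x)) * (mean v0 - v z x))"
      using s by (intro mult_nonneg_nonneg) auto
    then show ?thesis using z(3) by linarith
  qed
  obtain z where z: "0 < z" "z < t" 
    "(LINT x|torus. trunc \<tau> (v t x)) - (LINT x|torus. trunc \<tau> (v 0 x)) \<ge> (t - 0) * 
     (LINT x|torus. (trunc_weight m \<tau> \<tau> - trunc_weight m \<tau> (v z x)) * (mean v0 - v z x))"
    using viscous_trunc_step[OF m g \<omega> v \<epsilon> \<tau>(1) order_refl t] by blast
  define \<kappa> where "\<kappa> = mean v0 / 2 * ((\<tau> / 2) powr m / 8)"
  have \<kappa>: "\<kappa> \<ge> 0" using \<tau> by (simp add: \<kappa>_def)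
  have pt: "\<kappa> * (1 - 6 / \<tau> * trunc (\<tau> / 2) (v z x)) \<le> (trunc_weight m \<tau> \<tau> - trunc_weight m \<tau> (v z x)) * (mean v0 - v z x)" for x
  proof -
    have vz: "v z x \<ge> 0" using V(2) z(1) by simp
    have full: "\<kappa> * (1 - 6 / \<tau> * trunc (\<tau> / 2) (v z x)) = 0" if "v z x \<ge> \<tau> / 2"
    proof -
      have "6 / \<tau> * trunc (\<tau> / 2) (v z x) = 1" 
        unfolding trunc_above[OF \<tau>2 that] using \<tau>(1) by simp
      then show ?thesis by simp
    qed
    consider "v z x \<ge> \<tau>" | "\<tau> / 2 \<le> v z x" "v z x < \<tau>" | "v z x < \<tau> / 2" by linarith
    then show ?thesis
    proof cases
      case 1
      then have "v z x \<ge> \<tau> / 2" using \<tau> by simp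
      then show ?thesis unfolding full[OF \<open>v z x \<ge> \<tau> / 2\<close>] trunc_weight_above[OF m \<tau>(1) 1] by simp
    next
      case 2
      then have "(trunc_weight m \<tau> \<tau> - trunc_weight m \<tau> (v z x)) * (mean v0 - v z x) \<ge> 0"
        using trunc_weight_mono[OF m \<tau>(1), of "v z x" \<tau>] vz \<tau> by (intro mult_nonneg_nonneg) auto
      then show ?thesis unfolding full[OF 2(1)] .
    next
      case 3
      have "(\<tau> / 2) powr m / 8 \<le> trunc_weight m \<tau> \<tau> - trunc_weight m \<tau> (v z x)"
        using trunc_weight_gap[OF m \<tau>(1)] trunc_weight_mono[OF m \<tau>(1), of "v z x" "\<tau> / 2"] 3 vz by simp
      then have "((\<tau> / 2) powr m / 8) * (mean v0 / 2) \<le> (trunc_weight m \<tau> \<tau> - trunc_weight m \<tau> (v z x)) * (mean v0 - v z x)"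
      proof (rule mult_mono)
        have "0 \<le> (\<tau> / 2) powr m / 8" by simp
        then show "0 \<le> trunc_weight m \<tau> \<tau> - trunc_weight m \<tau> (v z x)"
          using \<open>(\<tau> / 2) powr m / 8 \<le> _\<close> by linarith
      qed (use 3 \<tau> in auto)
      moreover have "\<kappa> * (1 - 6 / \<tau> * trunc (\<tau> / 2) (v z x)) \<le> \<kappa>"
        using trunc_bounds(1)[of "\<tau> / 2" "v z x"] vz \<tau> \<kappa> by (intro mult_left_le) auto
      ultimately show ?thesis unfolding \<kappa>_def by (simp add: mult.commute)
    qed
  qed
  have "\<kappa> * (1 - 6 / \<tau> * (LINT x|torus. trunc (\<tau> / 2) (v t x))) \<le> \<kappa> * (1 - 6 / \<tau> * (LINT x|torus. trunc (\<tau> / 2) (v z x)))"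
    using mono[of z] z \<tau> \<kappa> by (intro mult_left_mono diff_left_mono) auto
  also have "\<dots> = (LINT x|torus. \<kappa> * (1 - 6 / \<tau> * trunc (\<tau> / 2) (v z x)))"
    using continuous_integrable_torus[OF tc[of z "\<tau> / 2"]] z \<tau> by simp
  also have "\<dots> \<le> (LINT x|torus. (trunc_weight m \<tau> \<tau> - trunc_weight m \<tau> (v z x)) * (mean v0 - v z x))"
    using z \<tau> by (intro integral_mono pt continuous_integrable_torus continuous_intros tc wc cont) auto
  finally have "t * (\<kappa> * (1 - 6 / \<tau> * (LINT x|torus. trunc (\<tau> / 2) (v t x))))
      \<le> t * (LINT x|torus. (trunc_weight m \<tau> \<tau> - trunc_weight m \<tau> (v z x)) * (mean v0 - v z x))"
    using t by (intro mult_left_mono) auto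
  then show ?thesis using z(3) unfolding V(3) diff_zero \<kappa>_def[symmetric] by linarith
qed

section \<open>Mollified initial data\<close>

interpretation torus_pair: pair_sigma_finite "torus :: (real ^ 'n) measure" "torus :: (real ^ 'n) measure"
  by (intro pair_sigma_finite.intro torus.sigma_finite_measure_axioms)

interpretation torus_prod: finite_measure "(torus :: (real ^ 'n) measure) \<Otimes>\<^sub>M (torus :: (real ^ 'n) measure)"
  by (intro finite_measure_pair_measure torus.finite_measure_axioms)

text \<open>
  Fubini holds for the product of two copies of the completed measure: \<open>w (x - z)\<close> is continuous and
  \<open>h\<close> depends on one variable only.
\<close>

lemma kernel_fubini:
  fixes w h :: "real ^ 'n \<Rightarrow> real"
  assumes w: "periodic w" "continuous_on UNIV w"
    and h: "h \<in> borel_measurable torus" "\<And>x. \<bar>h x\<bar> \<le> B"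
  shows "integrable torus (\<lambda>x. LINT z|torus. w (x - z) * h z)"
    "(LINT x|torus. (LINT z|torus. w (x - z) * h z)) = mean w * mean h"
proof -
  obtain W where W: "W > 0" "\<And>x. \<bar>w x\<bar> \<le> W" using periodic_bounded[OF w] by blast
  have id: "(\<lambda>x. x) \<in> borel_measurable (torus :: (real ^ 'n) measure)"
    by (intro continuous_imp_measurable_on_sets_lebesgue continuous_intros) auto
  have [measurable]: "w \<in> borel_measurable borel" using w(2) by (rule borel_measurable_continuous_onI)
  have [measurable]: "h \<in> borel_measurable torus" by fact
  have [measurable]: "(\<lambda>p. fst p - snd p) \<in> borel_measurable ((torus :: (real ^ 'n) measure) \<Otimes>\<^sub>M torus)"
    by (intro borel_measurable_diff measurable_compose[OF measurable_fst id] measurable_compose[OF measurable_snd id])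
  have m: "(\<lambda>p. w (fst p - snd p) * h (snd p)) \<in> borel_measurable (torus \<Otimes>\<^sub>M torus)"
    by measurable
  have i: "integrable (torus \<Otimes>\<^sub>M torus) (\<lambda>p. w (fst p - snd p) * h (snd p))"
  proof (rule torus_prod.integrable_const_bound[OF AE_I2 m])
    fix p :: "(real ^ 'n) \<times> (real ^ 'n)"
    show "norm (w (fst p - snd p) * h (snd p)) \<le> W * B"
      using W h(2) by (auto simp: abs_mult intro!: mult_mono)
  qed
  then have i': "integrable (torus \<Otimes>\<^sub>M torus) (\<lambda>(x, z). w (x - z) * h z)"
    by (simp add: case_prod_beta')
  show "integrable torus (\<lambda>x. LINT z|torus. w (x - z) * h z)"
    using torus_pair.integrable_fst'[OF i] by simp
  have "(LINT x|torus. (LINT z|torus. w (x - z) * h z)) = (LINT z|torus. (LINT x|torus. w (x - z) * h z))"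
    using torus_pair.Fubini_integral[OF i'] by simp
  also have "\<dots> = (LINT z|torus. mean w * h z)"
    using torus_shift(2)[OF w(1) continuous_integrable_torus[OF w(2)], of "- _"] by (simp add: mean_def)
  also have "\<dots> = mean w * mean h" by (simp add: mean_def)
  finally show "(LINT x|torus. (LINT z|torus. w (x - z) * h z)) = mean w * mean h" .
qed

text \<open>
  The second claim is Jensen's inequality for the concave truncation and the probability density
  \<open>\<omega> \<epsilon> (x - z)\<close> in \<open>z\<close>, followed by an integration in \<open>x\<close>.
\<close>

lemma mollified_datum:
  fixes u0 :: "real ^ 'n \<Rightarrow> real" and \<omega> :: "real \<Rightarrow> real ^ 'n \<Rightarrow> real"
  assumes \<omega>: "mollifiers \<omega>" and \<epsilon>: "\<epsilon> > 0" and \<tau>: "\<tau> > 0"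
    and u0: "periodic u0" "essentially_bounded torus u0" "AE x in torus. 0 \<le> u0 x"
  shows "mean (conv u0 (\<omega> \<epsilon>)) = mean u0"
    "(LINT x|torus. trunc \<tau> (u0 x)) \<le> (LINT x|torus. trunc \<tau> (conv u0 (\<omega> \<epsilon>) x))"
proof -
  note w = mollifiersD[OF \<omega> \<epsilon>]
  obtain B where B: "AE x in torus. \<bar>u0 x\<bar> \<le> B" and meas[measurable]: "u0 \<in> borel_measurable torus"
    using u0(2) by (auto simp: essentially_bounded_def)
  \<comment> \<open>A bounded and nonnegative version of the datum, equal to it almost everywhere.\<close>
  define h where "h x = max 0 (min B (u0 x))" for x
  have hm[measurable]: "h \<in> borel_measurable torus" unfolding h_def[abs_def] by measurable
  have hb: "\<bar>h x\<bar> \<le> \<bar>B\<bar>" "h x \<ge> 0" for x by (auto simp: h_def)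
  have hu: "AE x in torus. u0 x = h x" using B u0(3) by eventually_elim (auto simp: h_def)
  have hi: "integrable torus h"
    by (rule torus.integrable_const_bound[OF AE_I2 hm, where B = "\<bar>B\<bar>"]) (use hb in auto)
  have ui: "integrable torus u0"
    using integrable_cong_AE_imp[OF hi meas] hu by (simp add: eq_commute)
  have wx: "continuous_on UNIV (\<lambda>z. \<omega> \<epsilon> (x - z))" for x
    by (rule continuous_on_compose2[OF w(5)]) (auto intro!: continuous_intros)
  have wi: "integrable torus (\<lambda>z. \<omega> \<epsilon> (x - z) * f z)" if "integrable torus f" for f :: "real ^ 'n \<Rightarrow> real" and x
    using torus_mult_integrable[OF that wx] by (simp add: mult.commute)
  have w1: "(LINT z|torus. \<omega> \<epsilon> (x - z)) = 1" for x
    using torus_reflect(2)[OF w(1,6), of x] w(4) by (simp add: mean_def)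
  define a where "a x = conv u0 (\<omega> \<epsilon>) x" for x
  have a: "a x = (LINT z|torus. \<omega> \<epsilon> (x - z) * h z)" for x
  proof -
    have "a x = (LINT z|torus. \<omega> \<epsilon> (x - z) * u0 z)"
      unfolding a_def conv_commute[OF u0(1) ui w(1,5)] by (simp add: conv_def)
    also have "\<dots> = (LINT z|torus. \<omega> \<epsilon> (x - z) * h z)"
      using hu by (intro integral_cong_AE borel_measurable_integrable wi hi ui) (auto elim: eventually_mono)
    finally show ?thesis .
  qed
  have ca: "continuous_on UNIV a"
    unfolding a_def[abs_def] by (rule continuous_on_conv[OF u0(1) ui w(1,5)])
  have "mean a = mean (\<omega> \<epsilon>) * mean h"
    unfolding mean_def[of a] a using kernel_fubini(2)[OF w(1,5) hm hb(1)] .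
  also have "mean h = mean u0"
    unfolding mean_def using hu by (intro integral_cong_AE hm meas) (auto elim: eventually_mono)
  finally show "mean (conv u0 (\<omega> \<epsilon>)) = mean u0" using w(4) by (simp add: a_def[abs_def])
  have tmeas: "(\<lambda>z. trunc \<tau> (h z)) \<in> borel_measurable torus"
    using borel_measurable_continuous_onI[OF continuous_on_trunc[OF \<tau>]] hm by (rule measurable_compose[rotated])
  have thb: "\<bar>trunc \<tau> (h z)\<bar> \<le> \<tau> / 3" for z
    using trunc_bounds[OF \<tau> hb(2), of z] by simp
  have thi: "integrable torus (\<lambda>z. trunc \<tau> (h z))"
    by (rule torus.integrable_const_bound[OF AE_I2 tmeas, where B = "\<tau> / 3"]) (unfold real_norm_def, rule thb)
  have jensen: "(LINT z|torus. \<omega> \<epsilon> (x - z) * trunc \<tau> (h z)) \<le> trunc \<tau> (a x)" for x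
  proof -
    have "(LINT z|torus. \<omega> \<epsilon> (x - z) * trunc \<tau> (h z))
        \<le> (LINT z|torus. trunc \<tau> (a x) * \<omega> \<epsilon> (x - z) + (trunc' \<tau> (a x) * (\<omega> \<epsilon> (x - z) * h z) - trunc' \<tau> (a x) * a x * \<omega> \<epsilon> (x - z)))"
    proof (rule integral_mono[OF wi[OF thi]])
      show "integrable torus (\<lambda>z. trunc \<tau> (a x) * \<omega> \<epsilon> (x - z) + (trunc' \<tau> (a x) * (\<omega> \<epsilon> (x - z) * h z) - trunc' \<tau> (a x) * a x * \<omega> \<epsilon> (x - z)))"
        using wi[OF hi, of x] continuous_integrable_torus[OF wx, of x] by simp
      fix z
      have "\<omega> \<epsilon> (x - z) * trunc \<tau> (h z) \<le> \<omega> \<epsilon> (x - z) * (trunc \<tau> (a x) + trunc' \<tau> (a x) * (h z - a x))"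
        by (intro mult_left_mono trunc_concave \<tau> w(3))
      then show "\<omega> \<epsilon> (x - z) * trunc \<tau> (h z)
          \<le> trunc \<tau> (a x) * \<omega> \<epsilon> (x - z) + (trunc' \<tau> (a x) * (\<omega> \<epsilon> (x - z) * h z) - trunc' \<tau> (a x) * a x * \<omega> \<epsilon> (x - z))"
        by (simp add: algebra_simps)
    qed
    also have "\<dots> = trunc \<tau> (a x)"
      using wi[OF hi, of x] continuous_integrable_torus[OF wx, of x] by (simp add: w1 a[symmetric])
    finally show ?thesis .
  qed
  have "(LINT x|torus. trunc \<tau> (u0 x)) = mean (\<omega> \<epsilon>) * mean (\<lambda>z. trunc \<tau> (h z))"
  proof -
    have "(\<lambda>z. trunc \<tau> (u0 z)) \<in> borel_measurable torus"
      using borel_measurable_continuous_onI[OF continuous_on_trunc[OF \<tau>]] meas by (rule measurable_compose[rotated])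
    then have "(LINT x|torus. trunc \<tau> (u0 x)) = (LINT x|torus. trunc \<tau> (h x))"
      using hu tmeas by (intro integral_cong_AE) (auto elim: eventually_mono)
    then show ?thesis using w(4) by (simp add: mean_def)
  qed
  also have "\<dots> = (LINT x|torus. (LINT z|torus. \<omega> \<epsilon> (x - z) * trunc \<tau> (h z)))"
    using kernel_fubini(2)[OF w(1,5) tmeas thb] by simp
  also have "\<dots> \<le> (LINT x|torus. trunc \<tau> (a x))"
  proof (rule integral_mono[OF kernel_fubini(1)[OF w(1,5) tmeas thb]])
    show "integrable torus (\<lambda>x. trunc \<tau> (a x))"
      by (intro continuous_integrable_torus continuous_on_compose2[OF continuous_on_trunc[OF \<tau>] ca]) auto
  qed (rule jensen)
  finally show "(LINT x|torus. trunc \<tau> (u0 x)) \<le> (LINT x|torus. trunc \<tau> (conv u0 (\<omega> \<epsilon>) x))"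
    by (simp add: a_def)
qed

section \<open>The limit of vanishing viscosity\<close>

lemma trunc_integrable:
  fixes f :: "real ^ 'n \<Rightarrow> real"
  assumes f: "f \<in> borel_measurable torus" "AE x in torus. 0 \<le> f x" and \<tau>: "\<tau> > 0"
  shows "integrable torus (\<lambda>x. trunc \<tau> (f x))"
proof (rule torus.integrable_const_bound)
  show "AE x in torus. norm (trunc \<tau> (f x)) \<le> \<tau> / 3"
    using f(2) by eventually_elim (use trunc_bounds[OF \<tau>] in auto)
  show "(\<lambda>x. trunc \<tau> (f x)) \<in> borel_measurable torus"
    using borel_measurable_continuous_onI[OF continuous_on_trunc[OF \<tau>]] f(1) by (rule measurable_compose[rotated])
qed

lemma tendsto_integral_trunc:
  fixes f :: "real ^ 'n \<Rightarrow> real"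
  assumes f: "integrable torus f" "\<And>x. 0 \<le> f x" and F: "\<And>k. integrable torus (F k)" "\<And>k x. 0 \<le> F k x"
    and lim: "(\<lambda>k. LINT x|torus. \<bar>F k x - f x\<bar>) \<longlonglongrightarrow> 0" and \<tau>: "\<tau> > 0"
  shows "(\<lambda>k. LINT x|torus. trunc \<tau> (F k x)) \<longlonglongrightarrow> (LINT x|torus. trunc \<tau> (f x))"
proof (rule LIM_zero_cancel, rule Lim_null_comparison[OF _ lim], rule always_eventually, rule allI)
  fix k
  have i: "integrable torus (\<lambda>x. trunc \<tau> (f x))" "integrable torus (\<lambda>x. trunc \<tau> (F k x))"
    using f F \<tau> by (auto intro!: trunc_integrable)
  have "norm ((LINT x|torus. trunc \<tau> (F k x)) - (LINT x|torus. trunc \<tau> (f x))) = \<bar>LINT x|torus. trunc \<tau> (F k x) - trunc \<tau> (f x)\<bar>"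
    using i by simp
  also have "\<dots> \<le> (LINT x|torus. \<bar>trunc \<tau> (F k x) - trunc \<tau> (f x)\<bar>)" by (rule integral_abs_bound)
  also have "\<dots> \<le> (LINT x|torus. \<bar>F k x - f x\<bar>)"
    using i f F \<tau> by (intro integral_mono integrable_abs Bochner_Integration.integrable_diff trunc_lipschitz) auto
  finally show "norm ((LINT x|torus. trunc \<tau> (F k x)) - (LINT x|torus. trunc \<tau> (f x))) \<le> (LINT x|torus. \<bar>F k x - f x\<bar>)" .
qed

text \<open>
  All quantities in \<open>viscous_spreading\<close> refer to the times \<open>0\<close> and \<open>t\<close>. At \<open>t\<close> they converge because
  \<open>trunc\<close> is Lipschitz; at \<open>0\<close> Jensen's inequality already compares them with the datum.
\<close>

lemma limit_spreading:
  fixes g u0 :: "real ^ 'n \<Rightarrow> real" and u :: "real \<Rightarrow> real ^ 'n \<Rightarrow> real"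
  assumes m: "m \<ge> 1" and g: "green_kernel g"
    and u0: "periodic u0" "essentially_bounded torus u0" "AE x in torus. 0 \<le> u0 x"
    and u: "\<forall>t\<ge>0. \<forall>x. 0 \<le> u t x" "vanishing_viscosity_limit m g u0 u"
  shows "AE t in lebesgue. t > 0 \<longrightarrow> integrable torus (u t) \<and> (\<forall>\<tau>>0. 2 * \<tau> \<le> mean u0 \<longrightarrow>
      (LINT x|torus. trunc \<tau> (u t x)) \<ge> (LINT x|torus. trunc \<tau> (u0 x))
      + t * (mean u0 / 2 * ((\<tau> / 2) powr m / 8) * (1 - 6 / \<tau> * (LINT x|torus. trunc (\<tau> / 2) (u t x)))))"
proof -
  obtain \<omega> \<epsilon> v where \<omega>: "mollifiers \<omega>" and \<epsilon>: "\<And>k. \<epsilon> k > (0 :: real)"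
    and v: "\<And>k. classical_viscous_solution m g (\<epsilon> k) (conv u0 (\<omega> (\<epsilon> k))) (v k)"
    and lim: "AE t in lebesgue_on {0<..}. integrable torus (u t) \<and> (\<lambda>k :: nat. LINT x|torus. \<bar>v k t x - u t x\<bar>) \<longlonglongrightarrow> 0"
    using u(2) unfolding vanishing_viscosity_limit_def by blast
  have "AE t in lebesgue. t \<in> {0<..} \<longrightarrow> (integrable torus (u t) \<and> (\<lambda>k :: nat. LINT x|torus. \<bar>v k t x - u t x\<bar>) \<longlonglongrightarrow> 0)"
    using lim by (subst (asm) AE_restrict_space_iff) auto
  then show ?thesis
  proof (rule eventually_mono, intro impI conjI allI)
    fix t \<tau> :: real
    assume t: "t > 0" and \<tau>: "\<tau> > 0" "2 * \<tau> \<le> mean u0"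
      and "t \<in> {0<..} \<longrightarrow> (integrable torus (u t) \<and> (\<lambda>k :: nat. LINT x|torus. \<bar>v k t x - u t x\<bar>) \<longlonglongrightarrow> 0)"
    then have ut: "integrable torus (u t)" "(\<lambda>k :: nat. LINT x|torus. \<bar>v k t x - u t x\<bar>) \<longlonglongrightarrow> 0" by auto
    have L: "(\<lambda>k. LINT x|torus. trunc a (v k t x)) \<longlonglongrightarrow> (LINT x|torus. trunc a (u t x))" if "a > 0" for a
      using t u(1) viscous_solution_continuous[OF v, of t] classical_viscous_solutionD(2)[OF v, of t]
      by (intro tendsto_integral_trunc ut that continuous_integrable_torus) auto
    have "(LINT x|torus. trunc \<tau> (u0 x))
      + t * (mean u0 / 2 * ((\<tau> / 2) powr m / 8) * (1 - 6 / \<tau> * (LINT x|torus. trunc (\<tau> / 2) (v k t x))))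
      \<le> (LINT x|torus. trunc \<tau> (v k t x))" for k
      using viscous_spreading[OF m g \<omega> v \<epsilon> \<tau>(1) _ t, of k] mollified_datum[OF \<omega> \<epsilon> \<tau>(1) u0, of k] \<tau>(2) by simp
    moreover have "(\<lambda>k. (LINT x|torus. trunc \<tau> (u0 x))
      + t * (mean u0 / 2 * ((\<tau> / 2) powr m / 8) * (1 - 6 / \<tau> * (LINT x|torus. trunc (\<tau> / 2) (v k t x)))))
      \<longlonglongrightarrow> (LINT x|torus. trunc \<tau> (u0 x))
      + t * (mean u0 / 2 * ((\<tau> / 2) powr m / 8) * (1 - 6 / \<tau> * (LINT x|torus. trunc (\<tau> / 2) (u t x))))"
      using \<tau>(1) by (intro tendsto_intros L) auto
    ultimately show "(LINT x|torus. trunc \<tau> (u t x)) \<ge> (LINT x|torus. trunc \<tau> (u0 x))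
      + t * (mean u0 / 2 * ((\<tau> / 2) powr m / 8) * (1 - 6 / \<tau> * (LINT x|torus. trunc (\<tau> / 2) (u t x))))"
      using LIMSEQ_le[OF _ L[OF \<tau>(1)]] by blast
  qed auto
qed

section \<open>No waiting time\<close>

lemma torus_indicator:
  assumes "A \<in> sets (torus :: (real ^ 'n) measure)"
  shows "integrable torus (\<lambda>x. c * indicator A x :: real)" "(LINT x|torus. c * indicator A x) = c * measure torus A"
proof -
  have eq: "A \<inter> space torus = A" using sets.sets_into_space[OF assms] by blast
  have "integrable torus (indicator A :: _ \<Rightarrow> real)"
    unfolding integrable_indicator_iff eq using assms torus.emeasure_finite[of A] by (metis infinity_ennreal_def less_top)
  then show "integrable torus (\<lambda>x. c * indicator A x :: real)" "(LINT x|torus. c * indicator A x) = c * measure torus A"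
    using eq by (auto simp del: space_restrict_space)
qed

lemma trunc_support_bound:
  fixes f :: "real ^ 'n \<Rightarrow> real"
  assumes f: "integrable torus f" "\<And>x. 0 \<le> f x" and \<tau>: "\<tau> > 0"
  shows "(LINT x|torus. trunc \<tau> (f x)) \<le> \<tau> / 3 * support_size f"
proof -
  let ?A = "{x \<in> cbox 0 1. f x > 0}"
  have "{x \<in> space torus. f x > 0} \<in> sets torus"
    using borel_measurable_integrable[OF f(1)] by measurable
  then have A: "?A \<in> sets torus" by simp
  have "(LINT x|torus. trunc \<tau> (f x)) \<le> (LINT x|torus. \<tau> / 3 * indicator ?A x)"
  proof (rule integral_mono_AE)
    show "AE x in torus. trunc \<tau> (f x) \<le> \<tau> / 3 * indicator ?A x"
    proof (rule AE_I2)
      fix x :: "real ^ 'n" assume "x \<in> space torus"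
      then show "trunc \<tau> (f x) \<le> \<tau> / 3 * indicator ?A x"
        using trunc_bounds(2)[OF \<tau> f(2), of x] f(2)[of x] by (cases "f x = 0") (auto simp: indicator_def)
    qed
  qed (rule trunc_integrable[OF borel_measurable_integrable[OF f(1)] _ \<tau>], simp add: f(2), rule torus_indicator(1)[OF A])
  also have "\<dots> = \<tau> / 3 * support_size f"
    unfolding torus_indicator(2)[OF A] support_size_def ..
  finally show ?thesis .
qed

text \<open>
  If the positivity set of \<open>v\<close> is not larger than that of the datum, then the growth of the truncated
  integral can only be paid for by points where the datum lies strictly between \<open>0\<close> and \<open>\<tau>\<close>.
\<close>

lemma small_values_lower_bound:
  fixes g u0 :: "real ^ 'n \<Rightarrow> real" and u :: "real \<Rightarrow> real ^ 'n \<Rightarrow> real"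
  assumes m: "m \<ge> 1"
    and u0: "u0 \<in> borel_measurable torus" "AE x in torus. 0 \<le> u0 x"
    and u: "\<And>x. 0 \<le> v x" "integrable torus v" and supp: "support_size v \<le> S0" and S0: "support_size u0 = S0" "S0 < 1"
    and t: "t > 0" and \<tau>: "\<tau> > 0" "2 * \<tau> \<le> mean u0"
    and spread: "(LINT x|torus. trunc \<tau> (v x)) \<ge> (LINT x|torus. trunc \<tau> (u0 x))
      + t * (mean u0 / 2 * ((\<tau> / 2) powr m / 8) * (1 - 6 / \<tau> * (LINT x|torus. trunc (\<tau> / 2) (v x))))"
  shows "measure torus {x \<in> cbox 0 1. u0 x \<ge> \<tau>} \<le> S0 - 3 * t * mean u0 * (1 - S0) / (16 * 2 powr m) * \<tau> powr (m - 1)"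
proof -
  let ?A = "{x \<in> cbox 0 1. u0 x \<ge> \<tau>}"
  have "{x \<in> space torus. u0 x \<ge> \<tau>} \<in> sets torus" using u0(1) by measurable
  then have A: "?A \<in> sets torus" by simp
  have "\<tau> / 3 * measure torus ?A = (LINT x|torus. \<tau> / 3 * indicator ?A x)"
    unfolding torus_indicator(2)[OF A] ..
  also have "\<dots> \<le> (LINT x|torus. trunc \<tau> (u0 x))"
  proof (rule integral_mono_AE)
    show "AE x in torus. \<tau> / 3 * indicator ?A x \<le> trunc \<tau> (u0 x)"
      using u0(2) by eventually_elim (use trunc_bounds[OF \<tau>(1)] trunc_above[OF \<tau>(1)] in \<open>auto simp: indicator_def\<close>)
  qed (rule torus_indicator(1)[OF A], use u0 \<tau> in \<open>auto intro!: trunc_integrable\<close>)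
  finally have 1: "\<tau> / 3 * measure torus ?A \<le> (LINT x|torus. trunc \<tau> (u0 x))" .
  have 2: "(LINT x|torus. trunc \<tau> (v x)) \<le> \<tau> / 3 * S0"
    using trunc_support_bound[OF u(2,1) \<tau>(1)] mult_left_mono[OF supp, of "\<tau> / 3"] \<tau>(1) by linarith
  have "6 / \<tau> * (LINT x|torus. trunc (\<tau> / 2) (v x)) \<le> 6 / \<tau> * ((\<tau> / 2) / 3 * support_size v)"
    using trunc_support_bound[OF u(2,1), of "\<tau> / 2"] \<tau> by (intro mult_left_mono) auto
  also have "\<dots> \<le> S0" using \<tau> supp by simp
  finally have "1 - S0 \<le> 1 - 6 / \<tau> * (LINT x|torus. trunc (\<tau> / 2) (v x))" by simp
  then have "t * (mean u0 / 2 * ((\<tau> / 2) powr m / 8) * (1 - S0))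
     \<le> t * (mean u0 / 2 * ((\<tau> / 2) powr m / 8) * (1 - 6 / \<tau> * (LINT x|torus. trunc (\<tau> / 2) (v x))))"
    using t \<tau> by (intro mult_left_mono) auto
  then have "\<tau> / 3 * measure torus ?A + t * (mean u0 / 2 * ((\<tau> / 2) powr m / 8) * (1 - S0)) \<le> \<tau> / 3 * S0"
    using 1 2 spread by linarith
  moreover have "(\<tau> / 2) powr m = \<tau> * \<tau> powr (m - 1) / 2 powr m"
    using \<tau>(1) by (simp add: powr_divide powr_diff)
  ultimately have "\<tau> / 3 * (measure torus ?A + 3 * t * mean u0 * (1 - S0) / (16 * 2 powr m) * \<tau> powr (m - 1)) \<le> \<tau> / 3 * S0"
    using \<tau>(1) by (simp add: field_simps)
  then show ?thesis using \<tau>(1) by (simp add: mult_le_cancel_left)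
qed

lemma sets_torus_iff: "A \<in> sets (torus :: (real ^ 'n) measure) \<longleftrightarrow> A \<subseteq> cbox 0 1 \<and> A \<in> sets lebesgue"
  by (subst sets_restrict_space_iff) auto

lemma measure_torus_eq:
  "A \<in> sets (torus :: (real ^ 'n) measure) \<Longrightarrow> measure torus A = measure lebesgue A"
  by (intro measure_restrict_space) (auto simp: sets_torus_iff)

text \<open>
  The positivity sets differ by a null set, and by completeness of Lebesgue measure that of \<open>h\<close> is
  measurable too.
\<close>

lemma support_size_cong_AE:
  fixes f h :: "real ^ 'n \<Rightarrow> real"
  assumes f: "f \<in> borel_measurable torus" and fh: "AE x in torus. h x = f x"
  shows "support_size h = support_size f"
proof -
  let ?F = "{x \<in> cbox 0 1. f x > 0}" and ?H = "{x \<in> cbox 0 1. h x > 0}"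
  have "{x \<in> space torus. f x > 0} \<in> sets torus" using f by measurable
  then have F: "?F \<in> sets torus" by simp
  have "AE x in lebesgue. x \<in> cbox 0 1 \<longrightarrow> h x = f x"
    using fh by (subst (asm) AE_restrict_space_iff) auto
  then obtain N where N: "N \<in> null_sets lebesgue" "{x. \<not> (x \<in> cbox 0 1 \<longrightarrow> h x = f x)} \<subseteq> N"
    unfolding eventually_ae_filter space_completion space_lborel by auto
  then have "negligible N" by (simp add: negligible_iff_null_sets)
  then have neg: "negligible (?F - ?H \<union> (?H - ?F))"
    by (rule negligible_subset) (use N(2) in force)
  have "?F \<in> lmeasurable"
    using F by (intro bounded_set_imp_lmeasurable) (auto simp: sets_torus_iff intro: bounded_subset[OF bounded_cbox])
  then have "?H \<in> lmeasurable" "measure lebesgue ?H = measure lebesgue ?F"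
    using neg by (auto intro: lmeasurable_negligible_symdiff measure_negligible_symdiff)
  then show ?thesis
    unfolding support_size_def using F by (simp add: measure_torus_eq sets_torus_iff fmeasurableD)
qed

lemma mean_pos:
  fixes u0 :: "real ^ 'n \<Rightarrow> real"
  assumes u0: "integrable torus u0" "AE x in torus. 0 \<le> u0 x" and pos: "support_size u0 > 0"
  shows "mean u0 > 0"
proof (rule ccontr)
  assume "\<not> mean u0 > 0"
  moreover have "mean u0 \<ge> 0" unfolding mean_def using u0(2) by (rule integral_nonneg_AE)
  ultimately have "(LINT x|torus. u0 x) = 0" by (simp add: mean_def)
  then have z: "AE x in torus. u0 x = 0"
    using integral_nonneg_eq_0_iff_AE[OF u0] by simp
  have "support_size (\<lambda>x :: real ^ 'n. 0) = 0" by (simp add: support_size_def)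
  then show False using support_size_cong_AE[OF borel_measurable_const z] pos by simp
qed

lemma rearrangement_le:
  fixes f :: "real ^ 'n \<Rightarrow> real"
  assumes f: "AE x in torus. 0 \<le> f x" "f \<in> borel_measurable torus" and \<sigma>: "\<sigma> < 1"
    and le: "measure torus {x \<in> cbox 0 1. f x > \<tau>} \<le> \<sigma>"
  shows "decreasing_rearrangement f \<sigma> \<le> \<tau>"
proof -
  have "\<tau>' \<ge> 0" if "measure torus {x \<in> cbox 0 1. f x > \<tau>'} \<le> \<sigma>" for \<tau>'
  proof (rule ccontr)
    assume neg: "\<not> \<tau>' \<ge> 0"
    have "{x \<in> space torus. f x > \<tau>'} \<in> sets torus" using f(2) by measurable
    then have "measure torus {x \<in> cbox 0 1. f x > \<tau>'} = measure torus (cbox (0 :: real ^ 'n) 1)"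
      using f(1) neg by (intro measure_eq_AE) (auto simp: sets_torus_iff elim!: eventually_mono)
    then show False using that \<sigma> by simp
  qed
  then have "bdd_below {\<tau>. measure torus {x \<in> cbox 0 1. f x > \<tau>} \<le> \<sigma>}" by (intro bdd_belowI[of _ 0]) auto
  then show ?thesis
    unfolding decreasing_rearrangement_def using \<sigma> le by (auto intro!: cInf_lower)
qed

text \<open>
  If \<open>f\<close> is not integrable its integral is \<open>0\<close> by convention, and the bound holds as well.
\<close>

lemma set_integral_le_const:
  fixes f :: "real \<Rightarrow> real"
  assumes "a \<le> b" and "K \<ge> 0" and "\<And>\<sigma>. a < \<sigma> \<Longrightarrow> \<sigma> < b \<Longrightarrow> f \<sigma> \<le> K"
  shows "(LINT \<sigma>:{a<..<b}|lebesgue. f \<sigma>) \<le> K * (b - a)"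
proof (cases "set_integrable lebesgue {a<..<b} f")
  case True
  have c: "set_integrable lebesgue {a<..<b} (\<lambda>_. K)"
    using assms(1) by (simp add: set_integrable_def integrable_indicator_iff)
  have "(LINT \<sigma>:{a<..<b}|lebesgue. f \<sigma>) \<le> (LINT \<sigma>:{a<..<b}|lebesgue. K)"
    using True c assms(3) by (intro set_integral_mono) auto
  also have "\<dots> = K * (b - a)"
    using assms(1) by (simp add: set_lebesgue_integral_def)
  finally show ?thesis .
next
  case False
  then show ?thesis
    using assms by (simp add: set_lebesgue_integral_def set_integrable_def not_integrable_integral_eq)
qed

text \<open>
  The hypothesis \<open>small\<close> says that the distribution function of \<open>u0\<close> leaves \<open>S0\<close> at least like
  \<open>c * \<tau> powr (m - 1)\<close>. Solving \<open>S0 - c * \<tau> powr (m - 1) = \<sigma>\<close> for \<open>\<tau>\<close> bounds the rearrangement at \<open>\<sigma>\<close>.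
\<close>

lemma no_waiting_condition_imp_small_values:
  fixes u0 :: "real ^ 'n \<Rightarrow> real"
  assumes m: "m > 1"
    and u0: "u0 \<in> borel_measurable torus" "AE x in torus. 0 \<le> u0 x"
    and S0: "0 < S0" "S0 < 1" and c: "c > 0" and \<theta>: "\<theta> > 0"
    and small: "\<And>\<tau>. 0 < \<tau> \<Longrightarrow> \<tau> \<le> \<theta> \<Longrightarrow> measure torus {x \<in> cbox 0 1. u0 x \<ge> \<tau>} \<le> S0 - c * \<tau> powr (m - 1)"
  shows "\<not> no_waiting_condition m S0 u0"
proof -
  define d where "d = min S0 (c * \<theta> powr (m - 1))"
  have d: "d > 0" using c \<theta> S0 by (simp add: d_def)
  define K where "K = (1 / c) powr (1 / (m - 1))"
  have rear: "decreasing_rearrangement u0 \<sigma> \<le> K * (S0 - \<sigma>) powr (1 / (m - 1))" if \<sigma>: "S0 - d < \<sigma>" "\<sigma> < S0" for \<sigma>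
  proof -
    \<comment> \<open>The height at which the bound \<open>S0 - c * \<tau> powr (m - 1)\<close> on the distribution function equals \<open>\<sigma>\<close>.\<close>
    define \<tau> where "\<tau> = ((S0 - \<sigma>) / c) powr (1 / (m - 1))"
    have \<tau>p: "\<tau> powr (m - 1) = (S0 - \<sigma>) / c" using m c \<sigma> by (simp add: \<tau>_def powr_powr)
    have \<tau>1: "\<tau> > 0" using \<sigma> c by (simp add: \<tau>_def)
    have "\<tau> \<le> (\<theta> powr (m - 1)) powr (1 / (m - 1))"
      unfolding \<tau>_def using \<sigma> c m by (intro powr_mono2) (auto simp: d_def field_simps)
    also have "\<dots> = \<theta>" using m \<theta> by (simp add: powr_powr)
    finally have \<tau>2: "\<tau> \<le> \<theta>" .
    have meas: "{x \<in> space torus. u0 x \<ge> \<tau>} \<in> sets torus" using u0(1) by measurable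
    have "measure torus {x \<in> cbox 0 1. u0 x > \<tau>} \<le> measure torus {x \<in> cbox 0 1. u0 x \<ge> \<tau>}"
      using meas by (intro torus.finite_measure_mono) auto
    also have "\<dots> \<le> S0 - c * \<tau> powr (m - 1)" by (rule small[OF \<tau>1 \<tau>2])
    also have "\<dots> = \<sigma>" using c by (simp add: \<tau>p)
    finally have "decreasing_rearrangement u0 \<sigma> \<le> \<tau>"
      using \<sigma> S0 by (intro rearrangement_le u0) auto
    also have "\<tau> = K * (S0 - \<sigma>) powr (1 / (m - 1))"
      using \<sigma> c by (simp add: \<tau>_def K_def powr_mult[symmetric])
    finally show ?thesis .
  qed
  have quot: "ereal (LINT \<sigma>:{s<..<S0}|lebesgue. decreasing_rearrangement u0 \<sigma>) / ereal (critical_power m (S0 - s)) \<le> ereal K"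
    if s: "S0 - d < s" "s < S0" for s
  proof -
    have "(LINT \<sigma>:{s<..<S0}|lebesgue. decreasing_rearrangement u0 \<sigma>) \<le> K * (S0 - s) powr (1 / (m - 1)) * (S0 - s)"
    proof (rule set_integral_le_const)
      fix \<sigma> assume \<sigma>: "s < \<sigma>" "\<sigma> < S0"
      have "decreasing_rearrangement u0 \<sigma> \<le> K * (S0 - \<sigma>) powr (1 / (m - 1))" using \<sigma> s by (intro rear) auto
      also have "\<dots> \<le> K * (S0 - s) powr (1 / (m - 1))"
        using \<sigma> m by (intro mult_left_mono powr_mono2) (auto simp: K_def)
      finally show "decreasing_rearrangement u0 \<sigma> \<le> K * (S0 - s) powr (1 / (m - 1))" .
    qed (use s in \<open>auto simp: K_def\<close>)
    also have "\<dots> = K * ((S0 - s) powr (1 / (m - 1)) * (S0 - s) powr 1)" using s by simp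
    also have "\<dots> = K * (S0 - s) powr (m / (m - 1))"
      unfolding powr_add[symmetric] using m by (simp add: field_simps)
    finally show ?thesis
      using s m by (simp add: critical_power_def ereal_divide divide_le_eq)
  qed
  have "\<forall>\<^sub>F s in at S0 within {0..<S0}. ereal (LINT \<sigma>:{s<..<S0}|lebesgue. decreasing_rearrangement u0 \<sigma>)
             / ereal (critical_power m (S0 - s)) \<le> ereal K"
    unfolding eventually_at
  proof (intro exI[of _ d] conjI ballI impI d)
    fix s assume "s \<in> {0..<S0}" "s \<noteq> S0 \<and> dist s S0 < d"
    then show "ereal (LINT \<sigma>:{s<..<S0}|lebesgue. decreasing_rearrangement u0 \<sigma>)
             / ereal (critical_power m (S0 - s)) \<le> ereal K"
      by (intro quot) (auto simp: dist_real_def)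
  qed
  then have "Limsup (at S0 within {0..<S0}) (\<lambda>s. ereal (LINT \<sigma>:{s<..<S0}|lebesgue. decreasing_rearrangement u0 \<sigma>)
             / ereal (critical_power m (S0 - s))) \<le> ereal K"
    by (rule Limsup_bounded)
  then show ?thesis by (auto simp: no_waiting_condition_def)
qed

text \<open>
  Continuity of the measure along the sets \<open>{u0 \<ge> \<theta> / n}\<close>.
\<close>

lemma positivity_set_approximation:
  fixes u0 :: "real ^ 'n \<Rightarrow> real"
  assumes u0: "u0 \<in> borel_measurable torus"
    and small: "\<And>\<tau>. 0 < \<tau> \<Longrightarrow> \<tau> \<le> \<theta> \<Longrightarrow> measure torus {x \<in> cbox 0 1. u0 x \<ge> \<tau>} \<le> K" and \<theta>: "\<theta> > 0"
  shows "support_size u0 \<le> K"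
proof -
  define A where "A n = {x \<in> cbox 0 1. u0 x \<ge> \<theta> / real (Suc n)}" for n
  have meas: "A n \<in> sets torus" for n
  proof -
    have "{x \<in> space torus. u0 x \<ge> \<theta> / real (Suc n)} \<in> sets torus" using u0 by measurable
    then show ?thesis by (simp add: A_def)
  qed
  have "incseq A"
  proof (rule incseq_SucI)
    fix n
    have "\<theta> / real (Suc (Suc n)) \<le> \<theta> / real (Suc n)" using \<theta> by (intro divide_left_mono) auto
    then show "A n \<subseteq> A (Suc n)" unfolding A_def by auto
  qed
  then have "(\<lambda>n. measure torus (A n)) \<longlonglongrightarrow> measure torus (\<Union>n. A n)"
    using meas by (intro torus.finite_Lim_measure_incseq) auto
  moreover have "(\<Union>n. A n) = {x \<in> cbox 0 1. u0 x > 0}"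
  proof safe
    fix x assume x: "x \<in> cbox 0 1" "u0 x > 0"
    obtain n where "\<theta> / u0 x < real (Suc n)" using reals_Archimedean2 by (metis less_SucI of_nat_less_iff order_less_trans lessI)
    then have "u0 x \<ge> \<theta> / real (Suc n)" using x by (simp add: field_simps)
    then show "x \<in> (\<Union>n. A n)" using x by (auto simp: A_def)
  next
    fix x n assume "x \<in> A n"
    moreover have "\<theta> / real (Suc n) > 0" using \<theta> by simp
    ultimately show "u0 x > 0" unfolding A_def by (metis (mono_tags, lifting) mem_Collect_eq order_less_le_trans)
  qed (auto simp: A_def)
  moreover have "measure torus (A n) \<le> K" for n
    unfolding A_def using \<theta> by (intro small) (auto simp: divide_le_eq)
  ultimately show ?thesis unfolding support_size_def by (metis (no_types, lifting) LIMSEQ_le_const2)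
qed

text \<open>
  The hypothesis also supplies \<open>S(0) > 0\<close>, because the limit superior over the empty interval is \<open>- \<infinity>\<close>;
  the mean of the datum is therefore positive.
\<close>

lemma no_waiting_time:
  fixes g u0 :: "real ^ 'n \<Rightarrow> real" and u :: "real \<Rightarrow> real ^ 'n \<Rightarrow> real"
  assumes m: "m \<ge> 1" and g: "green_kernel g"
    and u0: "periodic u0" "essentially_bounded torus u0" "AE x in torus. 0 \<le> u0 x"
    and u: "constructed_solution m g u0 u"
    and S0: "support_size (u 0) < 1"
    and cond: "no_waiting_condition m (support_size (u 0)) u0"
  shows "AE t in lebesgue. t > 0 \<longrightarrow> support_size (u t) > support_size (u 0)"
proof -
  define S0 where "S0 = support_size (u 0)"
  have unn: "\<forall>t\<ge>0. \<forall>x. 0 \<le> u t x" and u00: "AE x in torus. u 0 x = u0 x"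
    and vv: "vanishing_viscosity_limit m g u0 u"
    using u by (auto simp: constructed_solution_def entropy_solution_def)
  obtain B where B: "AE x in torus. \<bar>u0 x\<bar> \<le> B" and meas: "u0 \<in> borel_measurable torus"
    using u0(2) by (auto simp: essentially_bounded_def)
  have ui: "integrable torus u0"
    by (rule torus.integrable_const_bound[OF _ meas, of B]) (use B in auto)
  have S0eq: "support_size u0 = S0"
    unfolding S0_def by (rule support_size_cong_AE[OF meas u00, symmetric])
  have "S0 \<noteq> 0"
  proof
    assume "S0 = 0"
    then have "at S0 within {0..<S0} = bot" by simp
    then show False using cond by (simp add: no_waiting_condition_def S0_def[symmetric] Limsup_bot bot_ereal_def)
  qed
  moreover have "S0 \<ge> 0" by (simp add: S0_def support_size_def)
  ultimately have S0pos: "S0 > 0" by simp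
  have mp: "mean u0 > 0" using mean_pos[OF ui u0(3)] S0pos S0eq by simp
  show ?thesis
    using limit_spreading[OF m g u0 unn vv]
  proof (rule eventually_mono, intro impI)
    fix t :: real
    assume t: "t > 0" and good: "t > 0 \<longrightarrow> integrable torus (u t) \<and> (\<forall>\<tau>>0. 2 * \<tau> \<le> mean u0 \<longrightarrow>
      (LINT x|torus. trunc \<tau> (u t x)) \<ge> (LINT x|torus. trunc \<tau> (u0 x))
      + t * (mean u0 / 2 * ((\<tau> / 2) powr m / 8) * (1 - 6 / \<tau> * (LINT x|torus. trunc (\<tau> / 2) (u t x)))))"
    show "support_size (u 0) < support_size (u t)"
    proof (rule ccontr)
      assume "\<not> support_size (u 0) < support_size (u t)"
      then have supp: "support_size (u t) \<le> S0" by (simp add: S0_def)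
      have S01: "S0 < 1" using S0 by (simp add: S0_def)
      define c where "c = 3 * t * mean u0 * (1 - S0) / (16 * 2 powr m)"
      have c: "c > 0" using t mp S01 by (simp add: c_def)
      have small: "measure torus {x \<in> cbox 0 1. u0 x \<ge> \<tau>} \<le> S0 - c * \<tau> powr (m - 1)"
        if "0 < \<tau>" "\<tau> \<le> mean u0 / 2" for \<tau>
        unfolding c_def using that t good unn supp S01 S0eq
        by (intro small_values_lower_bound[OF m meas u0(3), of "u t" S0 t \<tau>]) auto
      show False
      proof (cases "m = 1")
        case True
        have "support_size u0 \<le> S0 - c"
          using small True mp by (intro positivity_set_approximation[OF meas, of "mean u0 / 2"]) force+
        then show False using S0eq c by simp
      next
        case False
        then have "\<not> no_waiting_condition m S0 u0"
          using m mp small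
          by (intro no_waiting_condition_imp_small_values[where \<theta> = "mean u0 / 2", OF _ meas u0(3) S0pos S01 c]) auto
        then show False using cond by (simp add: S0_def)
      qed
    qed
  qed
qed

section \<open>An interior gradient estimate for the Poisson equation\<close>

lemma second_derivative_at_min:
  fixes f f' :: "real \<Rightarrow> real"
  assumes \<delta>: "\<delta> > 0" and f: "\<And>s. \<bar>s\<bar> < \<delta> \<Longrightarrow> (f has_real_derivative f' s) (at s)"
    and f': "(f' has_real_derivative D) (at 0)" and min: "\<And>s. \<bar>s\<bar> < \<delta> \<Longrightarrow> f 0 \<le> f s"
  shows "D \<ge> 0"
proof (rule ccontr)
  assume "\<not> D \<ge> 0"
  then have "D < 0" by simp
  have "f' 0 = 0"
    using DERIV_local_min[OF f[of 0] \<delta>] min \<delta> by simp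
  obtain d where d: "d > 0" "\<And>h. h > 0 \<Longrightarrow> h < d \<Longrightarrow> f' (0 + h) < f' 0"
    using DERIV_neg_dec_right[OF f' \<open>D < 0\<close>] by auto
  define h where "h = min d \<delta> / 2"
  have h: "0 < h" "h < d" "h < \<delta>" using d(1) \<delta> by (auto simp: h_def)
  obtain z where z: "0 < z" "z < h" "f h - f 0 = (h - 0) * f' z"
    using MVT2[of 0 h f f'] f h by auto
  have "f' z < 0" using d(2)[of z] z h \<open>f' 0 = 0\<close> by simp
  then have "h * f' z < 0" using h by (simp add: mult_pos_neg)
  then have "f h < f 0" using z by simp
  then show False using min[of h] h by simp
qed

lemma has_real_derivative_line:
  assumes "\<And>x. f differentiable (at x)"
  shows "((\<lambda>s. f (x + (c * s) *\<^sub>R v)) has_real_derivative c * dderiv v f (x + (c * s) *\<^sub>R v)) (at s)"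
proof -
  have "((\<lambda>s. f (x + (c * s) *\<^sub>R v)) has_derivative (\<lambda>t. dderiv ((c * t) *\<^sub>R v) f (x + (c * s) *\<^sub>R v))) (at s)"
    by (rule has_derivative_compose[OF _ has_derivative_dderiv[OF assms]]) (auto intro!: derivative_eq_intros)
  moreover have "dderiv ((c * t) *\<^sub>R v) f y = (c * t) * dderiv v f y" for t y
    using linear_cmul[OF has_derivative_linear[OF has_derivative_dderiv[OF assms]]] by simp
  ultimately have "((\<lambda>s. f (x + (c * s) *\<^sub>R v)) has_derivative (\<lambda>t. (c * t) * dderiv v f (x + (c * s) *\<^sub>R v))) (at s)"
    by simp
  moreover have "(\<lambda>t. (c * t) * K) = (*) (c * K)" for K by auto
  ultimately show ?thesis by (simp add: has_field_derivative_def)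
qed

context
  fixes p :: "real ^ 'n \<Rightarrow> real" and i :: 'n and x :: "real ^ 'n" and M N N' \<sigma> :: real
  assumes p: "C_k 2 p" "\<And>y. \<bar>p y\<bar> \<le> M" "\<And>y. \<bar>laplacian p y\<bar> \<le> N"
    and N': "N < N'" and \<sigma>: "\<bar>\<sigma>\<bar> = 1"
begin

private definition n where "n = real CARD('n)"

text \<open>
  The terms of the barrier in the half cube \<open>0 \<le> y $ i \<le> 1\<close>, \<open>\<bar>y $ k\<bar> \<le> 1\<close>. On each face other than
  \<open>y $ i = 0\<close> one of them is at least \<open>M\<close>; the term for \<open>k = i\<close> vanishes at \<open>0\<close> and carries all the
  negative part of the Laplacian.
\<close>

private definition a :: "'n \<Rightarrow> real \<Rightarrow> real" where
  "a k \<xi> = (if k = i then M * (\<xi> * (n - (n - 1) * \<xi>)) + N' / 2 * (\<xi> * (1 - \<xi>)) else M * \<xi>\<^sup>2)"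

private definition a' :: "'n \<Rightarrow> real \<Rightarrow> real" where
  "a' k \<xi> = (if k = i then M * (n - 2 * (n - 1) * \<xi>) + N' / 2 * (1 - 2 * \<xi>) else 2 * M * \<xi>)"

private definition a'' :: "'n \<Rightarrow> real" where
  "a'' k = (if k = i then - 2 * M * (n - 1) - N' else 2 * M)"

private definition R :: "real ^ 'n \<Rightarrow> real ^ 'n" where
  "R y = y - (2 * y $ i) *\<^sub>R axis i 1"

text \<open>
  The barrier minus \<open>\<sigma>\<close> times the odd part of \<open>p\<close> with respect to the reflection \<open>R\<close>. Its Laplacian
  is at most \<open>N - N' < 0\<close>, so it has no minimum in the interior.
\<close>

private definition F :: "real ^ 'n \<Rightarrow> real" where
  "F y = (\<Sum>k\<in>UNIV. a k (y $ k)) - \<sigma> / 2 * (p (x + y) - p (x + R y))"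

private definition low :: "'n \<Rightarrow> real" where "low k = (if k = i then 0 else - 1)"

private lemma n1: "n \<ge> 1" by (simp add: n_def Suc_leI)

private lemma M0: "M \<ge> 0" using p(2)[of 0] by linarith

private lemma N0: "N \<ge> 0" using p(3)[of 0] by linarith

private lemma a_deriv: "(a k has_real_derivative a' k \<xi>) (at \<xi>)" "(a' k has_real_derivative a'' k) (at \<xi>)"
  unfolding a_def[abs_def] a'_def[abs_def] a''_def
  by (auto intro!: derivative_eq_intros simp: field_simps power2_eq_square)

private lemma a_nonneg:
  assumes "low k \<le> \<xi>" "\<xi> \<le> 1"
  shows "a k \<xi> \<ge> 0"
proof (cases "k = i")
  case True
  then have \<xi>: "0 \<le> \<xi>" "\<xi> \<le> 1" using assms by (auto simp: low_def)
  have "(n - 1) * \<xi> \<le> (n - 1) * 1" using n1 \<xi> by (intro mult_left_mono) auto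
  then have "0 \<le> \<xi> * (n - (n - 1) * \<xi>)" "0 \<le> \<xi> * (1 - \<xi>)" using \<xi> by (auto intro!: mult_nonneg_nonneg)
  then show ?thesis using True M0 N0 N' by (auto simp: a_def intro!: add_nonneg_nonneg mult_nonneg_nonneg)
qed (use M0 in \<open>auto simp: a_def\<close>)

private lemma sum_a'': "(\<Sum>k\<in>UNIV. a'' k) = - N'"
proof -
  have "(\<Sum>k\<in>UNIV. a'' k) = a'' i + (\<Sum>k\<in>UNIV - {i}. a'' k)" by (simp add: sum.remove)
  also have "(\<Sum>k\<in>UNIV - {i}. a'' k) = (n - 1) * (2 * M)"
    by (simp add: a''_def n_def of_nat_diff Suc_leI)
  finally show ?thesis by (simp add: a''_def algebra_simps)
qed

private lemma F_line:
  fixes j :: 'n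
  defines "c \<equiv> (if j = i then - 1 else 1 :: real)"
  shows "((\<lambda>s. F (y + s *\<^sub>R axis j 1)) has_real_derivative
       a' j (y $ j + s) - \<sigma> / 2 * (pd j p (x + y + s *\<^sub>R axis j 1) - c * pd j p (x + R y + (c * s) *\<^sub>R axis j 1))) (at s)"
    and "((\<lambda>s. a' j (y $ j + s) - \<sigma> / 2 * (pd j p (x + y + s *\<^sub>R axis j 1) - c * pd j p (x + R y + (c * s) *\<^sub>R axis j 1)))
       has_real_derivative a'' j - \<sigma> / 2 * (pd j (pd j p) (x + y) - pd j (pd j p) (x + R y))) (at 0)"
proof -
  have d: "\<And>x. p differentiable (at x)" "\<And>x. pd j p differentiable (at x)"
    using p(1) by (auto simp: numeral_2_eq_2 axis_in_Basis)
  have eq: "F (y + s *\<^sub>R axis j 1) = (\<Sum>k\<in>UNIV. a k (y $ k + (if k = j then s else 0)))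
      - \<sigma> / 2 * (p (x + y + (1 * s) *\<^sub>R axis j 1) - p (x + R y + (c * s) *\<^sub>R axis j 1))" for s
  proof -
    have "R (y + s *\<^sub>R axis j 1) = R y + (c * s) *\<^sub>R axis j 1"
      by (auto simp: R_def c_def axis_def vec_eq_iff)
    moreover have "(y + s *\<^sub>R axis j 1) $ k = y $ k + (if k = j then s else 0)" for k
      by (auto simp: axis_def)
    ultimately show ?thesis by (simp add: F_def add.assoc)
  qed
  have "((\<lambda>s. a k (y $ k + (if k = j then s else 0))) has_real_derivative (if k = j then a' j (y $ j + s) else 0)) (at s)" for k s
    by (cases "k = j") (auto intro!: DERIV_chain2[OF a_deriv(1), THEN DERIV_cong] derivative_eq_intros)
  then have "((\<lambda>s. \<Sum>k\<in>UNIV. a k (y $ k + (if k = j then s else 0))) has_real_derivative (\<Sum>k\<in>UNIV. if k = j then a' j (y $ j + s) else 0)) (at s)" for s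
    by (intro DERIV_sum) 
  then have A: "((\<lambda>s. \<Sum>k\<in>UNIV. a k (y $ k + (if k = j then s else 0))) has_real_derivative a' j (y $ j + s)) (at s)" for s
    by simp
  show "((\<lambda>s. F (y + s *\<^sub>R axis j 1)) has_real_derivative
       a' j (y $ j + s) - \<sigma> / 2 * (pd j p (x + y + s *\<^sub>R axis j 1) - c * pd j p (x + R y + (c * s) *\<^sub>R axis j 1))) (at s)"
    unfolding eq
    using DERIV_diff[OF A DERIV_cmult[OF DERIV_diff[OF
        has_real_derivative_line[OF d(1), where x = "x + y" and c = 1 and v = "axis j 1"]
        has_real_derivative_line[OF d(1), where x = "x + R y" and c = c and v = "axis j 1"]], where c = "\<sigma> / 2"]]
    by simp
  have B: "((\<lambda>s. a' j (y $ j + s)) has_real_derivative a'' j) (at 0)"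
    by (rule DERIV_chain2[OF a_deriv(2), THEN DERIV_cong]) (auto intro!: derivative_eq_intros)
  have "c * c = 1" by (simp add: c_def)
  then show "((\<lambda>s. a' j (y $ j + s) - \<sigma> / 2 * (pd j p (x + y + s *\<^sub>R axis j 1) - c * pd j p (x + R y + (c * s) *\<^sub>R axis j 1)))
       has_real_derivative a'' j - \<sigma> / 2 * (pd j (pd j p) (x + y) - pd j (pd j p) (x + R y))) (at 0)"
    using DERIV_diff[OF B DERIV_cmult[OF DERIV_diff[OF
        has_real_derivative_line[OF d(2), where x = "x + y" and c = 1 and v = "axis j 1"]
        DERIV_cmult[OF has_real_derivative_line[OF d(2), where x = "x + R y" and c = c and v = "axis j 1"], where c = c]], where c = "\<sigma> / 2"]]
    by (simp add: mult.assoc[symmetric])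
qed

private lemma F_nonneg:
  assumes "\<And>k. low k \<le> y $ k \<and> y $ k \<le> 1"
  shows "F y \<ge> 0"
proof -
  define K where "K = cbox (\<chi> k. low k) (1 :: real ^ 'n)"
  have K: "z \<in> K \<longleftrightarrow> (\<forall>k. low k \<le> z $ k \<and> z $ k \<le> 1)" for z
    by (auto simp: K_def mem_box_cart)
  have cp: "continuous_on UNIV p" using p(1) by (rule C_k_continuous)
  have ca: "continuous_on UNIV (a k)" for k
    using a_deriv(1) by (auto intro!: continuous_at_imp_continuous_on DERIV_isCont)
  have "continuous_on K F"
    unfolding F_def R_def
    by (intro continuous_intros continuous_on_compose2[OF ca] continuous_on_compose2[OF cp]) auto
  moreover have "compact K" by (simp add: K_def)
  moreover have "y \<in> K" unfolding K using assms by auto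
  ultimately obtain z where z: "z \<in> K" "\<And>w. w \<in> K \<Longrightarrow> F z \<le> F w"
    using continuous_attains_inf[of K F] by blast
  have bd: "\<bar>\<sigma> / 2 * (p (x + z) - p (x + R z))\<bar> \<le> M"
    using p(2)[of "x + z"] p(2)[of "x + R z"] \<sigma> by (simp add: abs_mult)
  have big: "F z \<ge> 0" if "a j (z $ j) \<ge> M" for j
  proof -
    have "a j (z $ j) \<le> (\<Sum>k\<in>UNIV. a k (z $ k))"
      using z(1) by (intro member_le_sum) (auto simp: K intro!: a_nonneg)
    then show ?thesis using that bd unfolding F_def by linarith
  qed
  have "F z \<ge> 0"
  proof (cases "\<forall>k. low k < z $ k \<and> z $ k < 1")
    case True
    have "a'' j - \<sigma> / 2 * (pd j (pd j p) (x + z) - pd j (pd j p) (x + R z)) \<ge> 0" for j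
    proof (rule second_derivative_at_min[OF _ F_line])
      show "min (z $ j - low j) (1 - z $ j) > 0" using True by simp
      fix s assume s: "\<bar>s\<bar> < min (z $ j - low j) (1 - z $ j)"
      have "z + s *\<^sub>R axis j 1 \<in> K"
        using z(1) s by (auto simp: K axis_def)
      then show "F (z + 0 *\<^sub>R axis j 1) \<le> F (z + s *\<^sub>R axis j 1)" using z(2) by simp
    qed
    then have "0 \<le> (\<Sum>j\<in>UNIV. a'' j - \<sigma> / 2 * (pd j (pd j p) (x + z) - pd j (pd j p) (x + R z)))"
      by (intro sum_nonneg) auto
    also have "\<dots> = - N' - \<sigma> / 2 * (laplacian p (x + z) - laplacian p (x + R z))"
      by (simp add: sum_subtractf sum_a'' laplacian_sum sum_distrib_left right_diff_distrib)
    also have "\<dots> \<le> - N' + N"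
    proof -
      have "\<bar>\<sigma> / 2 * (laplacian p (x + z) - laplacian p (x + R z))\<bar> \<le> N"
        using p(3)[of "x + z"] p(3)[of "x + R z"] \<sigma> by (simp add: abs_mult)
      then show ?thesis by linarith
    qed
    finally show ?thesis using N' by simp
  next
    case False
    then obtain j where "\<not> (low j < z $ j \<and> z $ j < 1)" by blast
    moreover have "low j \<le> z $ j" "z $ j \<le> 1" using z(1) unfolding K by auto
    ultimately have "z $ j = low j \<or> z $ j = 1" by auto
    then consider "j = i" "z $ i = 0" | "j = i" "z $ i = 1" | "j \<noteq> i" "(z $ j)\<^sup>2 = 1"
      by (auto simp: low_def split: if_splits)
    then show ?thesis
    proof cases
      case 1
      then have "R z = z" by (simp add: R_def)
      moreover have "(\<Sum>k\<in>UNIV. a k (z $ k)) \<ge> 0" using z(1) by (intro sum_nonneg a_nonneg) (auto simp: K)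
      ultimately show ?thesis by (simp add: F_def)
    next
      case 2
      then show ?thesis by (intro big[of i]) (simp add: a_def)
    next
      case 3
      then show ?thesis by (intro big[of j]) (simp add: a_def)
    qed
  qed
  then show ?thesis using z(2)[of y] \<open>y \<in> K\<close> by simp
qed

text \<open>
  The barrier \<open>\<Sum>k. a k (y $ k)\<close> has Laplacian \<open>- N'\<close> (\<open>sum_a''\<close>) and dominates the odd part of \<open>p\<close> on the
  boundary of the half cube, so it dominates it inside, in particular on the axis.
\<close>

lemma odd_part_bound_aux:
  assumes s: "0 \<le> s" "s \<le> 1"
  shows "\<sigma> / 2 * (p (x + s *\<^sub>R axis i 1) - p (x - s *\<^sub>R axis i 1)) \<le> s * (real CARD('n) * M + N' / 2)"
proof -
  let ?y = "s *\<^sub>R axis i 1 :: real ^ 'n"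
  have yk: "?y $ k = (if k = i then s else 0)" for k by (simp add: axis_def)
  have "F ?y \<ge> 0" by (rule F_nonneg) (use s in \<open>auto simp: axis_def low_def\<close>)
  moreover have "R ?y = - ?y" by (auto simp: R_def axis_def vec_eq_iff)
  moreover have "(\<Sum>k\<in>UNIV. a k (?y $ k)) = a i s"
  proof -
    have "a k (?y $ k) = (if k = i then a i s else 0)" for k by (auto simp: axis_def a_def)
    then show ?thesis by simp
  qed
  moreover have "a i s \<le> s * (n * M + N' / 2)"
  proof -
    have "s * (n * M + N' / 2) - a i s = s * s * (M * (n - 1) + N' / 2)"
      by (simp add: a_def field_simps)
    moreover have "0 \<le> s * s * (M * (n - 1) + N' / 2)"
      using s M0 N0 N' n1 by (intro mult_nonneg_nonneg add_nonneg_nonneg) auto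
    ultimately show ?thesis by simp
  qed
  ultimately show ?thesis by (simp add: F_def n_def)
qed

end

text \<open>
  The odd part of \<open>p\<close> in the direction \<open>i\<close> vanishes on the symmetry plane through \<open>x\<close> and has the same
  bounds as \<open>p\<close>. Division of the comparison estimate by \<open>s\<close> and \<open>s \<rightarrow> 0\<close> give the derivative. This is the
  classical argument by barriers in a half cube, here in a cube of side two around \<open>x\<close>.
\<close>

lemma gradient_estimate:
  fixes p :: "real ^ 'n \<Rightarrow> real"
  assumes p: "C_k 2 p" "\<And>y. \<bar>p y\<bar> \<le> M" "\<And>y. \<bar>laplacian p y\<bar> \<le> N"
  shows "\<bar>pd i p x\<bar> \<le> real CARD('n) * M + N / 2"
proof -
  have d: "\<And>x. p differentiable (at x)" using p(1) by (simp add: numeral_2_eq_2)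
  define h where "h s = 1 / 2 * (p (x + (1 * s) *\<^sub>R axis i 1) - p (x + (- 1 * s) *\<^sub>R axis i 1))" for s
  have "(h has_real_derivative 1 / 2 * (1 * pd i p (x + (1 * 0) *\<^sub>R axis i 1) - - 1 * pd i p (x + (- 1 * 0) *\<^sub>R axis i 1))) (at 0)"
    unfolding h_def[abs_def] by (intro DERIV_cmult DERIV_diff has_real_derivative_line d)
  then have "(h has_real_derivative pd i p x) (at 0)" by simp
  then have "((\<lambda>s. (h s - h 0) / (s - 0)) \<longlongrightarrow> pd i p x) (at 0)"
    by (simp add: has_field_derivative_iff)
  moreover have "h 0 = 0" by (simp add: h_def)
  ultimately have "((\<lambda>s. h s / s) \<longlongrightarrow> pd i p x) (at 0)" by simp
  then have "((\<lambda>s. \<bar>h s / s\<bar>) \<longlongrightarrow> \<bar>pd i p x\<bar>) (at 0)" by (rule tendsto_rabs)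
  then have lim: "((\<lambda>s. \<bar>h s / s\<bar>) \<longlongrightarrow> \<bar>pd i p x\<bar>) (at_right 0)"
    by (rule filterlim_mono) (auto simp: at_le)
  have "\<bar>pd i p x\<bar> \<le> real CARD('n) * M + N / 2 + e" if e: "e > 0" for e
  proof (rule tendsto_upperbound[OF lim])
    have "\<forall>\<^sub>F s in at_right 0. s \<in> {0<..<1 :: real}" by (rule eventually_at_right_real) simp
    then show "\<forall>\<^sub>F s in at_right 0. \<bar>h s / s\<bar> \<le> real CARD('n) * M + N / 2 + e"
    proof eventually_elim
      case (elim s)
      have "h s \<le> s * (real CARD('n) * M + (N + 2 * e) / 2)"
        using odd_part_bound_aux[OF p, of "N + 2 * e" 1 s x i] e elim by (simp add: h_def)
      moreover have "- h s \<le> s * (real CARD('n) * M + (N + 2 * e) / 2)"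
        using odd_part_bound_aux[OF p, of "N + 2 * e" "- 1" s x i] e elim by (simp add: h_def)
      ultimately have "\<bar>h s\<bar> \<le> s * (real CARD('n) * M + N / 2 + e)" by (simp add: abs_le_iff add_divide_distrib add.assoc)
      then show ?case using elim by (simp add: abs_divide divide_le_eq mult.commute)
    qed
  qed simp
  then show ?thesis by (rule field_le_epsilon)
qed

section \<open>The velocity field\<close>

lemma periodic_C2_approximation:
  fixes \<omega> :: "real \<Rightarrow> real ^ 'n \<Rightarrow> real" and u :: "real ^ 'n \<Rightarrow> real"
  assumes \<omega>: "mollifiers \<omega>" and u: "periodic u" "continuous_on UNIV u" and e: "e > 0"
  obtains w where "periodic w" "C_k 2 w" "\<And>x. \<bar>w x - u x\<bar> \<le> e"
proof -
  have "\<forall>\<^sub>F \<epsilon> in at_right 0. \<epsilon> > 0 \<and> (\<forall>x. \<bar>conv (\<omega> \<epsilon>) u x - u x\<bar> \<le> e)"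
    by (intro eventually_conj mollify_uniform[OF \<omega> u e]) (auto simp: eventually_at_right_less)
  then obtain \<epsilon> where "\<epsilon> > 0" "\<And>x. \<bar>conv (\<omega> \<epsilon>) u x - u x\<bar> \<le> e"
    using eventually_happens trivial_limit_at_right_real by (metis (no_types, lifting))
  then show ?thesis
    using that[of "conv (\<omega> \<epsilon>) u"] smooth_mollify[OF \<omega> u] periodic_conv[OF mollifiersD(1)[OF \<omega>]]
    by (auto simp: smooth_def)
qed

context
  fixes g :: "real ^ 'n \<Rightarrow> real" and \<omega> :: "real \<Rightarrow> real ^ 'n \<Rightarrow> real" and C :: real
  assumes g: "green_kernel g" and \<omega>: "mollifiers \<omega>"
  defines "C \<equiv> real CARD('n) * (LINT y|torus. \<bar>g y\<bar>) + 1"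
begin

private lemma gp: "periodic g" "integrable torus g"
  using g by (auto simp: green_kernel_def)

private lemma C_pos: "C > 0"
proof -
  have "0 \<le> (LINT y|torus. \<bar>g y\<bar>)" by (intro integral_nonneg_AE AE_I2) auto
  then show ?thesis by (simp add: C_def add_nonneg_pos)
qed

lemma velocity_bound_C2:
  assumes v: "periodic v" "C_k 2 v" and B: "\<And>x. \<bar>v x\<bar> \<le> B"
  shows "\<bar>pd i (conv g v) x\<bar> \<le> C * B"
proof -
  have cv: "continuous_on UNIV v" using v(2) by (rule C_k_continuous)
  have "\<bar>mean v\<bar> \<le> B"
  proof -
    have "\<bar>mean v\<bar> \<le> (LINT x|torus. \<bar>v x\<bar>)" unfolding mean_def by (rule integral_abs_bound)
    also have "\<dots> \<le> (LINT x|(torus :: (real ^ 'n) measure). B)"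
      using continuous_integrable_torus[OF cv] B by (intro integral_mono integrable_abs) auto
    finally show ?thesis by (simp only: torus_integral_const)
  qed
  then have "\<bar>laplacian (conv g v) y\<bar> \<le> 2 * B" for y
    using B[of y] unfolding laplacian_conv_green[OF g \<omega> v] by linarith
  then have "\<bar>pd i (conv g v) x\<bar> \<le> real CARD('n) * (B * (LINT y|torus. \<bar>g y\<bar>)) + 2 * B / 2"
    by (intro gradient_estimate C_k_conv gp v conv_bound cv B)
  then show ?thesis by (simp add: C_def algebra_simps)
qed

lemma velocity_diff_bound_C2:
  assumes v: "periodic v" "C_k 2 v" and w: "periodic w" "C_k 2 w" and B: "\<And>x. \<bar>v x - w x\<bar> \<le> B"
  shows "\<bar>pd i (conv g v) x - pd i (conv g w) x\<bar> \<le> C * B"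
proof -
  have cv: "continuous_on UNIV v" "continuous_on UNIV w" using v w by (auto intro: C_k_continuous)
  have d: "conv g v differentiable (at x)" "conv g w differentiable (at x)"
    using C_k_conv[OF gp v] C_k_conv[OF gp w] by (auto simp: numeral_2_eq_2)
  have "C_k 2 (\<lambda>x. v x + (- 1) * w x)" by (intro C_k_add C_k_cmult v w)
  then have vw: "periodic (\<lambda>x. v x - w x)" "C_k 2 (\<lambda>x. v x - w x)"
    using v w by (auto simp: periodic_def)
  have "conv g (\<lambda>x. v x - w x) = (\<lambda>x. conv g v x - conv g w x)"
    by (rule ext) (intro conv_diff gp v w cv)
  moreover have "pd i (\<lambda>x. conv g v x - conv g w x) x = pd i (conv g v) x - pd i (conv g w) x"
    by (rule dderiv_eqI) (intro has_derivative_diff has_derivative_dderiv d)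
  ultimately show ?thesis using velocity_bound_C2[OF vw B, of i x] by simp
qed

context
  fixes u :: "real ^ 'n \<Rightarrow> real"
  assumes u: "periodic u" "continuous_on UNIV u"
begin

text \<open>
  The functions \<open>g * w\<^sub>k\<close> for \<open>C\<^sup>2\<close> approximations \<open>w\<^sub>k\<close> of \<open>u\<close> have uniformly convergent gradients, by
  \<open>velocity_diff_bound_C2\<close>.
\<close>

private lemma velocity_limit:
  "\<exists>V. (\<forall>x. (conv g u has_derivative (\<lambda>h. \<Sum>i\<in>UNIV. h $ i * V i x)) (at x)) \<and>
    (\<forall>w e. periodic w \<and> C_k 2 w \<and> (\<forall>x. \<bar>w x - u x\<bar> \<le> e) \<longrightarrow>
        (\<forall>i x. \<bar>pd i (conv g w) x - V i x\<bar> \<le> C * e))"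
proof -
  have "\<exists>w. periodic w \<and> C_k 2 w \<and> (\<forall>x. \<bar>w x - u x\<bar> \<le> 1 / real (Suc k))" for k
    using periodic_C2_approximation[OF \<omega> u, of "1 / real (Suc k)"] by (metis of_nat_0_less_iff zero_less_Suc zero_less_divide_1_iff)
  then obtain w where w: "\<And>k. periodic (w k)" "\<And>k. C_k 2 (w k)" "\<And>k x. \<bar>w k x - u x\<bar> \<le> 1 / real (Suc k)"
    by metis
  have inv0: "(\<lambda>k. 1 / real (Suc k)) \<longlonglongrightarrow> 0" by (rule LIMSEQ_Suc[OF lim_1_over_n])
  define P where "P k i x = pd i (conv g (w k)) x" for k i x
  have diff: "\<bar>pd i (conv g w') x - P l i x\<bar> \<le> C * (e + 1 / real (Suc l))"
    if "periodic w'" "C_k 2 w'" "\<And>x. \<bar>w' x - u x\<bar> \<le> e" for w' e i x l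
  proof -
    have "\<bar>w' x - w l x\<bar> \<le> e + 1 / real (Suc l)" for x
      using w(3)[of l x] that(3)[of x] by linarith
    then show ?thesis unfolding P_def by (intro velocity_diff_bound_C2 that w)
  qed
  have "Cauchy (\<lambda>k. P k i x)" for i x
  proof (rule metric_CauchyI)
    fix e :: real assume "e > 0"
    have "(\<lambda>k. C * (1 / real (Suc k) + 1 / real (Suc k))) \<longlonglongrightarrow> C * (0 + 0)" by (intro tendsto_intros inv0)
    then have "\<forall>\<^sub>F k in sequentially. C * (1 / real (Suc k) + 1 / real (Suc k)) < e"
      using \<open>e > 0\<close> by (intro order_tendstoD) auto
    then obtain K where K: "C * (1 / real (Suc K) + 1 / real (Suc K)) < e" by (auto simp: eventually_sequentially)
    have "dist (P k i x) (P l i x) < e" if "k \<ge> K" "l \<ge> K" for k l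
    proof -
      have "\<bar>P k i x - P l i x\<bar> \<le> C * (1 / real (Suc k) + 1 / real (Suc l))"
        unfolding P_def[of k] by (intro diff w)
      also have "\<dots> \<le> C * (1 / real (Suc K) + 1 / real (Suc K))"
        using that C_pos by (intro mult_left_mono add_mono divide_left_mono) auto
      finally show ?thesis using K by (simp add: dist_real_def)
    qed
    then show "\<exists>M. \<forall>m\<ge>M. \<forall>n\<ge>M. dist (P m i x) (P n i x) < e" by blast
  qed
  then obtain V where V: "\<And>i x. (\<lambda>k. P k i x) \<longlonglongrightarrow> V i x"
    unfolding Cauchy_convergent_iff convergent_def by metis
  have close: "\<bar>pd i (conv g w') x - V i x\<bar> \<le> C * e"
    if w': "periodic w'" "C_k 2 w'" "\<And>x. \<bar>w' x - u x\<bar> \<le> e" for w' e i x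
  proof (rule LIMSEQ_le)
    show "(\<lambda>l. \<bar>pd i (conv g w') x - P l i x\<bar>) \<longlonglongrightarrow> \<bar>pd i (conv g w') x - V i x\<bar>"
      by (intro tendsto_intros V)
    have "(\<lambda>l. C * (e + 1 / real (Suc l))) \<longlonglongrightarrow> C * (e + 0)" by (intro tendsto_intros inv0)
    then show "(\<lambda>l. C * (e + 1 / real (Suc l))) \<longlonglongrightarrow> C * e" by simp
  qed (use diff[OF w'] in blast)
  have lim0: "(\<lambda>k. conv g (w k) x) \<longlonglongrightarrow> conv g u x" for x
  proof (rule LIM_zero_cancel, rule Lim_null_comparison, rule always_eventually, rule allI)
    fix k
    have cw: "continuous_on UNIV (w k)" using w(2) by (rule C_k_continuous)
    have "norm (conv g (w k) x - conv g u x) = \<bar>conv g (\<lambda>y. w k y - u y) x\<bar>"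
      using conv_diff[OF gp w(1) cw u] by simp
    also have "\<dots> \<le> 1 / real (Suc k) * (LINT y|torus. \<bar>g y\<bar>)"
      using w(1) u by (intro conv_bound gp w(3) continuous_intros cw) (auto simp: periodic_def)
    finally show "norm (conv g (w k) x - conv g u x) \<le> 1 / real (Suc k) * (LINT y|torus. \<bar>g y\<bar>)" .
  next
    have "(\<lambda>k. 1 / real (Suc k) * (LINT y|torus. \<bar>g y\<bar>)) \<longlonglongrightarrow> 0 * (LINT y|torus. \<bar>g y\<bar>)" by (intro tendsto_intros inv0)
    then show "(\<lambda>k. 1 / real (Suc k) * (LINT y|torus. \<bar>g y\<bar>)) \<longlonglongrightarrow> 0" by simp
  qed
  have "\<exists>p. \<forall>x\<in>UNIV. (\<lambda>k. conv g (w k) x) \<longlonglongrightarrow> p x \<and> (p has_derivative (\<lambda>h. \<Sum>i\<in>UNIV. h $ i * V i x)) (at x within UNIV)"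
  proof (rule has_derivative_sequence[where f' = "\<lambda>k x h. \<Sum>i\<in>UNIV. h $ i * P k i x"])
    fix k x
    have d: "conv g (w k) differentiable (at x)" using C_k_conv[OF gp w(1,2)[of k]] by (simp add: numeral_2_eq_2)
    have "(\<lambda>h. dderiv h (conv g (w k)) x) = (\<lambda>h. \<Sum>i\<in>UNIV. h $ i * P k i x)"
      unfolding P_def by (rule ext) (rule dderiv_sum_axis[OF d])
    then show "(conv g (w k) has_derivative (\<lambda>h. \<Sum>i\<in>UNIV. h $ i * P k i x)) (at x within UNIV)"
      using has_derivative_dderiv[OF d] by simp
  next
    fix e :: real assume "e > 0"
    define N where "N = real CARD('n)"
    have "(\<lambda>k. N * (C * (1 / real (Suc k)))) \<longlonglongrightarrow> N * (C * 0)" by (intro tendsto_intros inv0)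
    then have "\<forall>\<^sub>F k in sequentially. N * (C * (1 / real (Suc k))) < e" using \<open>e > 0\<close> by (intro order_tendstoD) auto
    then show "\<forall>\<^sub>F k in sequentially. \<forall>x\<in>UNIV. \<forall>h. norm ((\<Sum>i\<in>UNIV. h $ i * P k i x) - (\<Sum>i\<in>UNIV. h $ i * V i x)) \<le> e * norm h"
    proof eventually_elim
      case (elim k)
      show ?case
      proof (intro ballI allI)
        fix x and h :: "real ^ 'n"
        have "norm ((\<Sum>i\<in>UNIV. h $ i * P k i x) - (\<Sum>i\<in>UNIV. h $ i * V i x)) = \<bar>\<Sum>i\<in>UNIV. h $ i * (P k i x - V i x)\<bar>"
          by (simp add: sum_subtractf right_diff_distrib)
        also have "\<dots> \<le> (\<Sum>i\<in>(UNIV :: 'n set). norm h * (C * (1 / real (Suc k))))"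
        proof (rule order.trans[OF sum_abs], rule sum_mono)
          fix i
          have "\<bar>P k i x - V i x\<bar> \<le> C * (1 / real (Suc k))" unfolding P_def by (intro close w)
          then show "\<bar>h $ i * (P k i x - V i x)\<bar> \<le> norm h * (C * (1 / real (Suc k)))"
            unfolding abs_mult using component_le_norm_cart[of h i] by (intro mult_mono) auto
        qed
        also have "\<dots> = N * (C * (1 / real (Suc k))) * norm h" by (simp add: N_def)
        also have "\<dots> \<le> e * norm h" using elim by (intro mult_right_mono) auto
        finally show "norm ((\<Sum>i\<in>UNIV. h $ i * P k i x) - (\<Sum>i\<in>UNIV. h $ i * V i x)) \<le> e * norm h" .
      qed
    qed
  next
    show "(\<lambda>k. conv g (w k) 0) \<longlonglongrightarrow> conv g u 0" by (rule lim0)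
  qed auto
  then obtain p where p: "\<And>x. (\<lambda>k. conv g (w k) x) \<longlonglongrightarrow> p x"
    "\<And>x. (p has_derivative (\<lambda>h. \<Sum>i\<in>UNIV. h $ i * V i x)) (at x)" by auto
  have pu: "p = conv g u" using LIMSEQ_unique[OF p(1) lim0] by (rule ext)
  show ?thesis
  proof (intro exI conjI allI impI)
    show "(conv g u has_derivative (\<lambda>h. \<Sum>i\<in>UNIV. h $ i * V i x)) (at x)" for x
      using p(2)[of x] unfolding pu .
  qed (rule close, auto)
qed

lemma velocity_approx:
  assumes "periodic w" "C_k 2 w" "\<And>x. \<bar>w x - u x\<bar> \<le> e"
  shows "\<bar>pd i (conv g w) x - pd i (conv g u) x\<bar> \<le> C * e"
proof -
  obtain V where V1: "\<forall>x. (conv g u has_derivative (\<lambda>h. \<Sum>i\<in>UNIV. h $ i * V i x)) (at x)" 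
    and V2: "\<forall>w e. periodic w \<and> C_k 2 w \<and> (\<forall>x. \<bar>w x - u x\<bar> \<le> e) \<longrightarrow>
        (\<forall>i x. \<bar>pd i (conv g w) x - V i x\<bar> \<le> C * e)"
    using velocity_limit by (elim exE conjE)
  note V = V1[rule_format]
  have "pd i (conv g u) x = V i x"
    by (simp add: dderiv_eqI[OF V] axis_def if_distrib[of "\<lambda>a. a * _"] cong: if_cong)
  then show ?thesis using V2 assms by simp
qed

lemma continuous_on_velocity: "continuous_on UNIV (pd i (conv g u))"
proof -
  have "\<exists>w. periodic w \<and> C_k 2 w \<and> (\<forall>x. \<bar>w x - u x\<bar> \<le> 1 / real (Suc k))" for k
    using periodic_C2_approximation[OF \<omega> u, of "1 / real (Suc k)"] by (metis of_nat_0_less_iff zero_less_Suc zero_less_divide_1_iff)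
  then obtain w where w: "\<And>k. periodic (w k)" "\<And>k. C_k 2 (w k)" "\<And>k x. \<bar>w k x - u x\<bar> \<le> 1 / real (Suc k)"
    by metis
  show ?thesis
  proof (rule uniform_limit_theorem)
  show "\<forall>\<^sub>F k in sequentially. continuous_on UNIV (pd i (conv g (w k)))"
    using C_k_conv[OF gp w(1,2)] by (intro always_eventually allI) (auto simp: numeral_2_eq_2 axis_in_Basis intro: C_k_continuous[of 1])
  show "uniform_limit UNIV (\<lambda>k. pd i (conv g (w k))) (pd i (conv g u)) sequentially"
  proof (rule uniform_limitI)
    fix e :: real assume "e > 0"
    have "(\<lambda>k. C * (1 / real (Suc k))) \<longlonglongrightarrow> C * 0" by (intro tendsto_intros LIMSEQ_Suc[OF lim_1_over_n])
    then have "\<forall>\<^sub>F k in sequentially. C * (1 / real (Suc k)) < e" using \<open>e > 0\<close> by (intro order_tendstoD) auto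
    then show "\<forall>\<^sub>F k in sequentially. \<forall>x\<in>UNIV. dist (pd i (conv g (w k)) x) (pd i (conv g u) x) < e"
      by eventually_elim (use velocity_approx[OF w] in \<open>auto simp: dist_real_def intro: order_le_less_trans\<close>)
  qed
  qed simp
qed

lemma velocity_bound:
  assumes "\<And>x. \<bar>u x\<bar> \<le> B"
  shows "\<bar>pd i (conv g u) x\<bar> \<le> C * B"
proof -
  have "conv g (\<lambda>x. 0) = (\<lambda>x. 0)" by (simp add: conv_def fun_eq_iff)
  moreover have "pd i (\<lambda>x. 0) x = 0" by (rule dderiv_eqI) (rule has_derivative_const)
  ultimately show ?thesis
    using velocity_approx[of "\<lambda>x. 0" B i x] assms C_k_const[of 2 0] by (simp add: periodic_def)
qed

text \<open>
  Weak form of \<open>- \<Delta> (g * u) = u - mean u\<close> for continuous \<open>u\<close>: both sides are continuous in \<open>u\<close> for the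
  supremum norm, and for \<open>C\<^sup>2\<close> functions the identity is an integration by parts.
\<close>

lemma velocity_weak_divergence:
  assumes \<psi>: "periodic \<psi>" "C_k 1 \<psi>"
  shows "(LINT x|torus. (\<Sum>i\<in>UNIV. pd i (conv g u) x * pd i \<psi> x)) = (LINT x|torus. (u x - mean u) * \<psi> x)"
proof -
  have c\<psi>: "continuous_on UNIV \<psi>" using \<psi>(2) by (rule C_k_continuous)
  have d\<psi>: "\<psi> differentiable (at x)" for x using \<psi>(2) by simp
  have cd\<psi>: "continuous_on UNIV (pd i \<psi>)" for i using \<psi>(2) by (simp add: axis_in_Basis)
  have p\<psi>: "periodic (pd i \<psi>)" for i by (rule periodic_dderiv[OF \<psi>(1)])
  obtain X where X: "X > 0" "\<And>x. \<bar>\<psi> x\<bar> \<le> X" using periodic_bounded[OF \<psi>(1) c\<psi>] by blast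
  have "\<exists>Y. \<forall>x. \<bar>pd i \<psi> x\<bar> \<le> Y" for i using periodic_bounded[OF p\<psi> cd\<psi>] by metis
  then obtain Y where Y: "\<And>i x. \<bar>pd i \<psi> x\<bar> \<le> Y i" by metis
  have Y0: "Y i \<ge> 0" for i using Y[of i 0] by linarith
  have smooth_case: "(LINT x|torus. (\<Sum>i\<in>UNIV. pd i (conv g w) x * pd i \<psi> x)) = (LINT x|torus. (w x - mean w) * \<psi> x)"
    if w: "periodic w" "C_k 2 w" for w
  proof -
    have pw: "C_k 2 (conv g w)" by (rule C_k_conv[OF gp w])
    have dp: "pd i (conv g w) differentiable (at x)" for i x
      using pw by (simp add: numeral_2_eq_2 axis_in_Basis)
    have cp: "continuous_on UNIV (pd i (conv g w))" "continuous_on UNIV (pd i (pd i (conv g w)))" for i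
      using pw by (auto simp: numeral_2_eq_2 axis_in_Basis intro: C_k_continuous[of 1])
    have 0: "(LINT x|torus. pd i (conv g w) x * pd i \<psi> x + pd i (pd i (conv g w)) x * \<psi> x) = 0" for i
    proof (rule torus_integral_derivative_zero[where f = "\<lambda>x. pd i (conv g w) x * \<psi> x"
          and D = "\<lambda>x k. pd i (conv g w) x * dderiv k \<psi> x + dderiv k (pd i (conv g w)) x * \<psi> x"])
      show "periodic (\<lambda>x. pd i (conv g w) x * \<psi> x)"
        using periodic_dderiv[OF periodic_conv[OF gp(1)]] \<psi>(1) by (simp add: periodic_def)
    qed (intro has_derivative_mult has_derivative_dderiv d\<psi> dp, intro continuous_intros cp c\<psi> cd\<psi>)
    have "(LINT x|torus. (\<Sum>i\<in>UNIV. pd i (conv g w) x * pd i \<psi> x + pd i (pd i (conv g w)) x * \<psi> x)) = 0"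
      by (subst Bochner_Integration.integral_sum) (auto simp: 0 intro!: continuous_integrable_torus continuous_intros cp c\<psi> cd\<psi>)
    then have "(LINT x|torus. (\<Sum>i\<in>UNIV. pd i (conv g w) x * pd i \<psi> x) + laplacian (conv g w) x * \<psi> x) = 0"
      by (simp add: sum.distrib laplacian_sum sum_distrib_right)
    then have "(LINT x|torus. (\<Sum>i\<in>UNIV. pd i (conv g w) x * pd i \<psi> x)) + (LINT x|torus. (mean w - w x) * \<psi> x) = 0"
      unfolding laplacian_conv_green[OF g \<omega> w]
      by (subst (asm) Bochner_Integration.integral_add)
         (auto intro!: continuous_integrable_torus continuous_intros cp c\<psi> cd\<psi> C_k_continuous[OF w(2)])
    moreover have "(LINT x|torus. (w x - mean w) * \<psi> x) = - (LINT x|torus. (mean w - w x) * \<psi> x)"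
      by (simp add: algebra_simps flip: Bochner_Integration.integral_minus)
    ultimately show ?thesis by linarith
  qed
  define I where "I w = (LINT x|torus. (\<Sum>i\<in>UNIV. pd i (conv g w) x * pd i \<psi> x)) - (LINT x|torus. (w x - mean w) * \<psi> x)" for w
  define K where "K = (\<Sum>i\<in>UNIV. C * Y i) + 2 * X"
  have K: "K > 0" unfolding K_def using X C_pos Y0 by (intro add_nonneg_pos sum_nonneg mult_nonneg_nonneg) auto
  have abs_int: "\<bar>(LINT x|torus. f x) - (LINT x|torus. h x)\<bar> \<le> b" if "continuous_on UNIV f" "continuous_on UNIV h" "\<And>x. \<bar>f x - h x\<bar> \<le> b"
    for f h :: "real ^ 'n \<Rightarrow> real" and b
  proof -
    have "\<bar>(LINT x|torus. f x) - (LINT x|torus. h x)\<bar> = \<bar>LINT x|torus. f x - h x\<bar>"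
      using that by (simp add: continuous_integrable_torus)
    also have "\<dots> \<le> (LINT x|torus. \<bar>f x - h x\<bar>)" by (rule integral_abs_bound)
    also have "\<dots> \<le> (LINT x|(torus :: (real ^ 'n) measure). b)"
      using that by (intro integral_mono integrable_abs Bochner_Integration.integrable_diff continuous_integrable_torus) auto
    finally show ?thesis by (simp only: torus_integral_const)
  qed
  have "\<bar>I u\<bar> \<le> K * e" if e: "e > 0" for e
  proof -
    obtain w where w: "periodic w" "C_k 2 w" "\<And>x. \<bar>w x - u x\<bar> \<le> e" using periodic_C2_approximation[OF \<omega> u e] by blast
    have cw: "continuous_on UNIV w" using w(2) by (rule C_k_continuous)
    have cp: "continuous_on UNIV (pd i (conv g w))" for i
      using C_k_conv[OF gp w(1,2)] by (auto simp: numeral_2_eq_2 axis_in_Basis intro: C_k_continuous[of 1])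
    have "I w = 0" using smooth_case[OF w(1,2)] by (simp add: I_def)
    have 1: "\<bar>(LINT x|torus. (\<Sum>i\<in>UNIV. pd i (conv g w) x * pd i \<psi> x))
        - (LINT x|torus. (\<Sum>i\<in>UNIV. pd i (conv g u) x * pd i \<psi> x))\<bar> \<le> (\<Sum>i\<in>UNIV. C * e * Y i)"
    proof (intro abs_int continuous_intros cp cd\<psi> continuous_on_velocity)
      fix x
      show "\<bar>(\<Sum>i\<in>UNIV. pd i (conv g w) x * pd i \<psi> x) - (\<Sum>i\<in>UNIV. pd i (conv g u) x * pd i \<psi> x)\<bar> \<le> (\<Sum>i\<in>UNIV. C * e * Y i)"
        unfolding sum_subtractf[symmetric] left_diff_distrib[symmetric]
      proof (rule order.trans[OF sum_abs], rule sum_mono)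
        fix i
        show "\<bar>(pd i (conv g w) x - pd i (conv g u) x) * pd i \<psi> x\<bar> \<le> C * e * Y i"
          unfolding abs_mult using velocity_approx[OF w, of i x] Y[of i x] C_pos e by (intro mult_mono) auto
      qed
    qed
    have mw: "\<bar>mean w - mean u\<bar> \<le> e" unfolding mean_def by (intro abs_int cw u w)
    have 2: "\<bar>(LINT x|torus. (w x - mean w) * \<psi> x) - (LINT x|torus. (u x - mean u) * \<psi> x)\<bar> \<le> 2 * e * X"
    proof (intro abs_int continuous_intros cw u c\<psi>)
      fix x
      have "\<bar>(w x - mean w) - (u x - mean u)\<bar> \<le> 2 * e" using w(3)[of x] mw by linarith
      then show "\<bar>(w x - mean w) * \<psi> x - (u x - mean u) * \<psi> x\<bar> \<le> 2 * e * X"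
        unfolding left_diff_distrib[symmetric] abs_mult using X e by (intro mult_mono) auto
    qed
    have "\<bar>I u\<bar> = \<bar>I u - I w\<bar>" using \<open>I w = 0\<close> by simp
    also have "\<dots> \<le> (\<Sum>i\<in>UNIV. C * e * Y i) + 2 * e * X" unfolding I_def using 1 2 by linarith
    also have "\<dots> = K * e" by (simp add: K_def algebra_simps sum_distrib_left)
    finally show ?thesis .
  qed
  then have "\<bar>I u\<bar> \<le> e" if "e > 0" for e
    using K that by (metis divide_pos_pos nonzero_mult_div_cancel_left times_divide_eq_right less_irrefl)
  then have "I u = 0" by (metis abs_le_zero_iff field_le_epsilon add_0)
  then show ?thesis by (simp add: I_def)
qed

end

lemma velocity_diff_bound:
  assumes u: "periodic u" "continuous_on UNIV u" and v: "periodic v" "continuous_on UNIV v"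
    and B: "\<And>x. \<bar>u x - v x\<bar> \<le> B"
  shows "\<bar>pd i (conv g u) x - pd i (conv g v) x\<bar> \<le> C * B"
proof (rule field_le_epsilon)
  fix e :: real assume e: "e > 0"
  define d where "d = e / (2 * C)"
  have d: "d > 0" using e C_pos by (simp add: d_def)
  obtain w where w: "periodic w" "C_k 2 w" "\<And>x. \<bar>w x - u x\<bar> \<le> d" using periodic_C2_approximation[OF \<omega> u d] by blast
  have "\<bar>w x - v x\<bar> \<le> B + d" for x using w(3)[of x] B[of x] by linarith
  then have "\<bar>pd i (conv g w) x - pd i (conv g v) x\<bar> \<le> C * (B + d)"
    by (intro velocity_approx v w)
  moreover have "\<bar>pd i (conv g w) x - pd i (conv g u) x\<bar> \<le> C * d"
    by (intro velocity_approx u w)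
  ultimately have "\<bar>pd i (conv g u) x - pd i (conv g v) x\<bar> \<le> C * (B + d) + C * d" by linarith
  also have "\<dots> = C * B + e" using C_pos by (simp add: d_def field_simps)
  finally show "\<bar>pd i (conv g u) x - pd i (conv g v) x\<bar> \<le> C * B + e" .
qed

end

section \<open>A smooth bump\<close>

text \<open>
  The family is closed under differentiation up to linear combinations, which reduces smoothness of
  \<open>exp (- 1 / x)\<close>, continued by \<open>0\<close>, to one derivative computation.
\<close>

definition flat :: "nat \<Rightarrow> real \<Rightarrow> real" where
  "flat j x = (if x > 0 then exp (- 1 / x) / x ^ j else 0)"

lemma tendsto_flat: "(flat j \<longlongrightarrow> 0) (at 0)"
proof -
  have "((\<lambda>y :: real. y ^ j / exp y) \<longlongrightarrow> 0) at_top" by (rule tendsto_power_div_exp_0)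
  then have "((\<lambda>x :: real. (inverse x) ^ j / exp (inverse x)) \<longlongrightarrow> 0) (at_right 0)"
    by (rule filterlim_compose[OF _ filterlim_inverse_at_top_right])
  moreover have "\<forall>\<^sub>F x in at_right 0. (inverse x) ^ j / exp (inverse x) = flat j x"
    by (auto simp: eventually_at_filter flat_def exp_minus field_simps)
  ultimately have "(flat j \<longlongrightarrow> 0) (at_right 0)" by (rule Lim_transform_eventually)
  moreover have "\<forall>\<^sub>F x in at_left 0. 0 = flat j x" by (auto simp: eventually_at_filter flat_def)
  then have "(flat j \<longlongrightarrow> 0) (at_left 0)" by (rule Lim_transform_eventually[OF tendsto_const])
  ultimately show ?thesis by (simp add: filterlim_at_split)
qed

lemma has_derivative_flat: "(flat j has_real_derivative flat (j + 2) x + (- real j) * flat (j + 1) x) (at x)"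
proof -
  consider "x > 0" | "x < 0" | "x = 0" by linarith
  then show ?thesis
  proof cases
    case 1
    have "((\<lambda>x. exp (- 1 / x) / x ^ j) has_real_derivative
        (exp (- 1 / x) * (1 / x ^ 2) * x ^ j - exp (- 1 / x) * (real j * x ^ (j - 1))) / (x ^ j * x ^ j)) (at x)"
      using 1 by (auto intro!: derivative_eq_intros simp: power2_eq_square)
    moreover have "(exp (- 1 / x) * (1 / x ^ 2) * x ^ j - exp (- 1 / x) * (real j * x ^ (j - 1))) / (x ^ j * x ^ j)
        = flat (j + 2) x + (- real j) * flat (j + 1) x"
    proof (cases j)
      case (Suc k)
      then show ?thesis using 1 by (simp add: flat_def field_simps power2_eq_square)
    qed (use 1 in \<open>simp add: flat_def power2_eq_square\<close>)
    ultimately have d: "((\<lambda>x. exp (- 1 / x) / x ^ j) has_real_derivative flat (j + 2) x + (- real j) * flat (j + 1) x) (at x)" by simp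
    show ?thesis
      by (rule has_field_derivative_transform_within_open[OF d open_greaterThan[of 0]]) (use 1 in \<open>auto simp: flat_def\<close>)
  next
    case 2
    have d: "((\<lambda>x. 0) has_real_derivative flat (j + 2) x + (- real j) * flat (j + 1) x) (at x)" using 2 by (simp add: flat_def)
    show ?thesis
      by (rule has_field_derivative_transform_within_open[OF d open_lessThan[of 0]]) (use 2 in \<open>auto simp: flat_def\<close>)
  next
    case 3
    have "\<forall>\<^sub>F y in at 0. flat (j + 1) y = (flat j y - flat j 0) / (y - 0)"
      by (auto simp: eventually_at_filter flat_def)
    then have "((\<lambda>y. (flat j y - flat j 0) / (y - 0)) \<longlongrightarrow> 0) (at 0)"
      by (rule Lim_transform_eventually[OF tendsto_flat])
    then show ?thesis unfolding 3 has_field_derivative_iff by (simp add: flat_def)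
  qed
qed

lemma dderiv_real: "(f has_real_derivative D) (at x) \<Longrightarrow> dderiv 1 f x = D"
  by (subst dderiv_eqI[where D = "(*) D"]) (auto simp: has_field_derivative_def)

lemma C_k_flat: "C_k k (flat j)"
proof (induction k arbitrary: j)
  case 0
  show ?case by (auto intro!: continuous_at_imp_continuous_on DERIV_isCont[OF has_derivative_flat])
next
  case (Suc k)
  have "dderiv 1 (flat j) = (\<lambda>x. flat (j + 2) x + (- real j) * flat (j + 1) x)"
    by (rule ext) (rule dderiv_real[OF has_derivative_flat])
  moreover have "C_k k (\<lambda>x. flat (j + 2) x + (- real j) * flat (j + 1) x)"
    by (intro C_k_add C_k_cmult Suc.IH)
  ultimately show ?case
    using has_derivative_flat[of j] by (auto simp: has_field_derivative_def differentiable_def)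
qed

definition bump :: "real \<Rightarrow> real \<Rightarrow> real" where
  "bump \<delta> t = flat 0 (\<delta> + t) * flat 0 (\<delta> - t)"

lemma C_k_bump: "C_k k (bump \<delta>)"
proof -
  have "C_k k (\<lambda>t. flat 0 (\<delta> + t) * flat 0 (\<delta> + (- t)))"
    by (intro C_k_mult C_k_affine[of "\<lambda>t. t"] C_k_affine[of "\<lambda>t. - t"] C_k_flat bounded_linear_ident
        bounded_linear_minus)
  then show ?thesis by (simp add: bump_def[abs_def])
qed

lemma bump_nonneg: "bump \<delta> t \<ge> 0"
  by (simp add: bump_def flat_def)

lemma bump_pos: "\<bar>t\<bar> < \<delta> \<Longrightarrow> bump \<delta> t > 0"
  by (auto simp: bump_def flat_def abs_less_iff)

lemma bump_zero: "\<bar>t\<bar> \<ge> \<delta> \<Longrightarrow> bump \<delta> t = 0"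
  by (auto simp: bump_def flat_def abs_if split: if_splits)

section \<open>Lipschitz bound for powers\<close>

lemma powr_lipschitz:
  fixes x y q :: real
  assumes "0 \<le> x" "0 \<le> y" "q > 1"
  shows "\<bar>x powr q - y powr q\<bar> \<le> q * (max x y) powr (q - 1) * \<bar>x - y\<bar>"
proof -
  have *: "y powr q - x powr q \<le> q * y powr (q - 1) * (y - x)" if "0 \<le> x" "x < y" for x y
  proof -
    have "\<exists>l z. z > x \<and> z < y \<and> DERIV (\<lambda>\<xi>. \<xi> powr q) z :> l \<and> y powr q - x powr q = (y - x) * l"
    proof (rule MVT[OF that(2)])
      show "continuous_on {x..y} (\<lambda>\<xi>. \<xi> powr q)" using that assms by (intro continuous_on_powr') (auto intro: continuous_intros)
      show "(\<lambda>\<xi>. \<xi> powr q) differentiable (at \<xi>)" if "x < \<xi>" "\<xi> < y" for \<xi>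
        using that \<open>0 \<le> x\<close> has_real_derivative_powr[of \<xi> q] real_differentiable_def by auto
    qed
    then obtain l z where z: "x < z" "z < y" "DERIV (\<lambda>\<xi>. \<xi> powr q) z :> l" "y powr q - x powr q = (y - x) * l" by blast
    have "l = q * z powr (q - 1)"
      using DERIV_unique[OF z(3) has_real_derivative_powr[of z q]] z that by simp
    also have "\<dots> \<le> q * y powr (q - 1)" using z that assms by (intro mult_left_mono powr_mono2) auto
    finally show ?thesis using z(4) that by (simp add: mult.commute mult_left_mono)
  qed
  have mono: "x powr q \<le> y powr q" if "0 \<le> x" "x \<le> y" for x y using that assms by (intro powr_mono2) auto
  consider "x < y" | "x = y" | "y < x" by linarith
  then show ?thesis
  proof cases
    case 1 then show ?thesis using *[of x y] mono[of x y] assms by (simp add: max_def)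
  next
    case 3 then show ?thesis using *[of y x] mono[of y x] assms by (simp add: max_def)
  qed simp
qed

section \<open>The flux is controlled by the density\<close>

lemma dderiv_bound_of_difference:
  assumes "f differentiable (at x)" "d > 0" "\<And>h. 0 < h \<Longrightarrow> h < d \<Longrightarrow> \<bar>f (x + h *\<^sub>R v) - f x\<bar> \<le> K * h"
  shows "\<bar>dderiv v f x\<bar> \<le> K"
proof -
  have "((\<lambda>h. f (x + h *\<^sub>R v)) has_derivative (\<lambda>t. dderiv (t *\<^sub>R v) f (x + 0 *\<^sub>R v))) (at 0)"
    by (rule has_derivative_compose[of "\<lambda>h. x + h *\<^sub>R v" "\<lambda>t. t *\<^sub>R v", OF _ has_derivative_dderiv])
       (use assms(1) in \<open>auto intro!: derivative_eq_intros\<close>)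
  moreover have "(\<lambda>t. dderiv (t *\<^sub>R v) f (x + 0 *\<^sub>R v)) = (*) (dderiv v f x)"
    using linear_cmul[OF has_derivative_linear[OF has_derivative_dderiv[OF assms(1)]]] by (auto simp: mult.commute)
  ultimately have "((\<lambda>h. (f (x + h *\<^sub>R v) - f x) / h) \<longlongrightarrow> dderiv v f x) (at 0)"
    by (simp add: has_field_derivative_def[symmetric] has_field_derivative_iff)
  then have "((\<lambda>h. (f (x + h *\<^sub>R v) - f x) / h) \<longlongrightarrow> dderiv v f x) (at_right 0)"
    by (rule filterlim_mono) (auto simp: at_le)
  then have "((\<lambda>h. \<bar>(f (x + h *\<^sub>R v) - f x) / h\<bar>) \<longlongrightarrow> \<bar>dderiv v f x\<bar>) (at_right 0)" by (rule tendsto_rabs)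
  moreover have "\<forall>\<^sub>F h in at_right 0. h \<in> {0<..<d}" using assms(2) by (rule eventually_at_right_real)
  then have "\<forall>\<^sub>F h in at_right 0. \<bar>(f (x + h *\<^sub>R v) - f x) / h\<bar> \<le> K"
    by eventually_elim (use assms(3) in \<open>auto simp: abs_divide divide_le_eq\<close>)
  ultimately show ?thesis by (rule tendsto_upperbound) simp
qed

lemma conv_shift: "conv G h (x + a) = conv (\<lambda>y. G (y + a)) h x"
  by (simp add: conv_def algebra_simps)

text \<open>
  The derivative of the mollified function at \<open>x\<close> is an average of difference quotients of \<open>f\<close> near \<open>x\<close>,
  where \<open>u\<close> exceeds \<open>u x\<close> by at most \<open>e\<close>.
\<close>

lemma mollified_derivative_bound:
  fixes f u :: "real ^ 'n \<Rightarrow> real" and \<omega> :: "real \<Rightarrow> real ^ 'n \<Rightarrow> real"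
  assumes \<omega>: "mollifiers \<omega>" and f: "periodic f" "continuous_on UNIV f" and u: "periodic u" "continuous_on UNIV u"
    and lip: "\<And>x y. \<bar>f x - f y\<bar> \<le> \<kappa> * max (u x) (u y) * dist x y" and \<kappa>: "\<kappa> \<ge> 0" and e: "e > 0"
  shows "\<forall>\<^sub>F \<epsilon> in at_right 0. \<epsilon> > 0 \<and> (\<forall>x. \<bar>conv (\<omega> \<epsilon>) f x - f x\<bar> \<le> e) \<and>
    (\<forall>i x. \<bar>pd i (conv (\<omega> \<epsilon>) f) x\<bar> \<le> \<kappa> * (u x + e))"
proof -
  obtain d where d: "d > 0" "\<And>x y. dist x y < d \<Longrightarrow> \<bar>u x - u y\<bar> < e"
    using periodic_uniformly_continuous[OF u e] by blast
  have "d / 2 > 0" using d by simp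
  from mollifiers_eventually[OF \<omega> this] mollify_uniform[OF \<omega> f e] show ?thesis
  proof eventually_elim
    case (elim \<epsilon>)
    note w = mollifiersD[OF \<omega>, of \<epsilon>]
    have "\<bar>pd i (conv (\<omega> \<epsilon>) f) x\<bar> \<le> \<kappa> * (u x + e)" for i x
    proof (rule dderiv_bound_of_difference[where d = "d / 2"])
      have "C_k 1 (conv (\<omega> \<epsilon>) f)" using smooth_mollify[OF \<omega> f, of \<epsilon>] elim by (simp add: smooth_def)
      then show "conv (\<omega> \<epsilon>) f differentiable (at x)" by simp
      fix h :: real assume h: "0 < h" "h < d / 2"
      have fs: "periodic (\<lambda>y. f (y + h *\<^sub>R axis i 1))" "continuous_on UNIV (\<lambda>y. f (y + h *\<^sub>R axis i 1))"
        using f by (auto intro!: periodic_shift continuous_on_compose2[OF f(2)] continuous_intros)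
      have D: "periodic (\<lambda>y. f (y + h *\<^sub>R axis i 1) - f y)" "continuous_on UNIV (\<lambda>y. f (y + h *\<^sub>R axis i 1) - f y)"
        using fs f by (auto simp: periodic_def intro!: continuous_intros)
      have "conv (\<omega> \<epsilon>) f (x + h *\<^sub>R axis i 1) = conv f (\<omega> \<epsilon>) (x + h *\<^sub>R axis i 1)"
        using elim by (simp add: conv_commute[OF w(1,6) f])
      also have "\<dots> = conv (\<omega> \<epsilon>) (\<lambda>y. f (y + h *\<^sub>R axis i 1)) x"
        unfolding conv_shift using elim by (simp add: conv_commute[OF w(1,6) fs])
      finally have "conv (\<omega> \<epsilon>) f (x + h *\<^sub>R axis i 1) - conv (\<omega> \<epsilon>) f x = conv (\<omega> \<epsilon>) (\<lambda>y. f (y + h *\<^sub>R axis i 1) - f y) x"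
        using elim conv_diff[OF w(1,6) fs f] by simp
      moreover have "\<bar>conv (\<omega> \<epsilon>) (\<lambda>y. f (y + h *\<^sub>R axis i 1) - f y) x - 0\<bar> \<le> \<kappa> * (u x + e) * h"
      proof (rule mollifier_average_bound[OF \<omega> D, where \<delta> = "d / 2"])
        show "\<epsilon> > 0" using elim by simp
        show "\<omega> \<epsilon> y = 0" if "d / 2 \<le> infdist y {z. \<forall>i. z $ i \<in> \<int>}" for y using elim that by blast
        fix y :: "real ^ 'n" assume y: "norm y < d / 2"
        have nh: "norm (h *\<^sub>R axis i 1 :: real ^ 'n) = h" using h by (simp add: norm_axis_1)
        have "norm (y + h *\<^sub>R axis i 1) < d" using norm_triangle_ineq[of y "h *\<^sub>R axis i 1"] y h nh by linarith
        then have "u (x + y + h *\<^sub>R axis i 1) \<le> u x + e"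
          using d(2)[of "x + y + h *\<^sub>R axis i 1" x] by (simp add: dist_norm add.assoc)
        moreover have "u (x + y) \<le> u x + e"
          using d(2)[of "x + y" x] y d(1) by (simp add: dist_norm)
        ultimately have "\<kappa> * max (u (x + y + h *\<^sub>R axis i 1)) (u (x + y)) * h \<le> \<kappa> * (u x + e) * h"
          using \<kappa> h by (intro mult_right_mono mult_left_mono) auto
        then show "\<bar>f (x + y + h *\<^sub>R axis i 1) - f (x + y) - 0\<bar> \<le> \<kappa> * (u x + e) * h"
          using lip[of "x + y + h *\<^sub>R axis i 1" "x + y"] nh by (simp add: dist_norm)
      qed
      ultimately show "\<bar>conv (\<omega> \<epsilon>) f (x + h *\<^sub>R axis i 1) - conv (\<omega> \<epsilon>) f x\<bar> \<le> \<kappa> * (u x + e) * h" by simp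
    qed (use d in simp)
    then show ?case using elim by blast
  qed
qed

text \<open>
  Formally \<open>\<integral> f \<nabla>p \<bullet> \<nabla>\<psi> = \<integral> (u - mean u) f \<psi> - \<integral> \<psi> \<nabla>p \<bullet> \<nabla>f\<close>, where \<open>f \<le> A u\<close> and \<open>\<bar>\<nabla>f\<bar>\<close> is controlled by
  \<open>\<kappa> u\<close>. Since \<open>f\<close> need not be differentiable it is mollified, and the errors vanish in the limit.
\<close>

lemma flux_bound:
  fixes f u \<psi> g :: "real ^ 'n \<Rightarrow> real" and \<omega> :: "real \<Rightarrow> real ^ 'n \<Rightarrow> real"
  assumes g: "green_kernel g" and \<omega>: "mollifiers \<omega>"
    and u: "periodic u" "continuous_on UNIV u" "\<And>x. 0 \<le> u x" "\<And>x. u x \<le> B"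
    and f: "periodic f" "continuous_on UNIV f" "\<And>x. 0 \<le> f x" "\<And>x. f x \<le> A * u x"
    and lip: "\<And>x y. \<bar>f x - f y\<bar> \<le> \<kappa> * max (u x) (u y) * dist x y" and \<kappa>: "\<kappa> \<ge> 0"
    and \<psi>: "periodic \<psi>" "C_k 1 \<psi>" "\<And>x. 0 \<le> \<psi> x"
    and P: "\<And>i x. \<bar>pd i (conv g u) x\<bar> \<le> P"
  shows "\<bar>LINT x|torus. f x * (\<Sum>i\<in>UNIV. pd i (conv g u) x * pd i \<psi> x)\<bar>
     \<le> (B * A + real CARD('n) * P * \<kappa>) * (LINT x|torus. u x * \<psi> x)"
proof -
  define V where "V i x = pd i (conv g u) x" for i x
  define d\<psi> where "d\<psi> i x = pd i \<psi> x" for i x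
  define n where "n = real CARD('n)"
  have cV: "continuous_on UNIV (V i)" for i unfolding V_def[abs_def] by (rule continuous_on_velocity[OF g \<omega> u(1,2)])
  have c\<psi>: "continuous_on UNIV \<psi>" using \<psi>(2) by (rule C_k_continuous)
  have cd\<psi>: "continuous_on UNIV (d\<psi> i)" for i unfolding d\<psi>_def[abs_def] using \<psi>(2) by (simp add: axis_in_Basis)
  have P0: "P \<ge> 0" using P[of undefined 0] by linarith
  have B0: "B \<ge> 0" using u(3)[of 0] u(4)[of 0] by linarith
  have mean: "0 \<le> mean u" "mean u \<le> B"
  proof -
    show "0 \<le> mean u" unfolding mean_def by (intro integral_nonneg_AE AE_I2 u)
    have "mean u \<le> (LINT x|(torus :: (real ^ 'n) measure). B)"
      unfolding mean_def by (intro integral_mono continuous_integrable_torus u continuous_on_const)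
    then show "mean u \<le> B" by (simp only: torus_integral_const)
  qed
  define Z where "Z = (LINT x|torus. (\<Sum>i\<in>UNIV. \<bar>V i x * d\<psi> i x\<bar>))"
  define K where "K = Z + (B + n * P * \<kappa>) * (LINT x|torus. \<psi> x)"
  have main: "\<bar>LINT x|torus. f x * (\<Sum>i\<in>UNIV. V i x * d\<psi> i x)\<bar>
     \<le> (B * A + n * P * \<kappa>) * (LINT x|torus. u x * \<psi> x) + K * e" if e: "e > 0" for e
  proof -
    obtain \<epsilon> where \<epsilon>: "\<epsilon> > 0" "\<And>x. \<bar>conv (\<omega> \<epsilon>) f x - f x\<bar> \<le> e"
      "\<And>i x. \<bar>pd i (conv (\<omega> \<epsilon>) f) x\<bar> \<le> \<kappa> * (u x + e)"
      using eventually_happens'[OF trivial_limit_at_right_real mollified_derivative_bound[OF \<omega> f(1,2) u(1,2) lip \<kappa> e]] by blast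
    \<comment> \<open>The test function of the weak divergence identity is the mollified flux density times the weight.\<close>
    define F where "F = conv (\<omega> \<epsilon>) f"
    define dF where "dF i x = pd i F x" for i x
    have F: "periodic F" "C_k 1 F"
      unfolding F_def using periodic_conv[OF mollifiersD(1)[OF \<omega> \<epsilon>(1)]] smooth_mollify[OF \<omega> f(1,2) \<epsilon>(1)] by (auto simp: smooth_def)
    have cF: "continuous_on UNIV F" using F(2) by (rule C_k_continuous)
    have cdF: "continuous_on UNIV (dF i)" for i unfolding dF_def[abs_def] using F(2) by (simp add: axis_in_Basis)
    have dprod: "pd i (\<lambda>x. F x * \<psi> x) x = F x * d\<psi> i x + dF i x * \<psi> x" for i x
    proof -
      have "F differentiable (at x)" "\<psi> differentiable (at x)" using F(2) \<psi>(2) by auto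
      from has_derivative_mult[OF this[THEN has_derivative_dderiv]] show ?thesis
        unfolding dF_def d\<psi>_def by (rule dderiv_eqI)
    qed
    have "periodic (\<lambda>x. F x * \<psi> x)" using F(1) \<psi>(1) by (simp add: periodic_def)
    from velocity_weak_divergence[OF g \<omega> u(1,2) this C_k_mult[OF F(2) \<psi>(2)]]
    have "(LINT x|torus. (\<Sum>i\<in>UNIV. V i x * (F x * d\<psi> i x + dF i x * \<psi> x))) = (LINT x|torus. (u x - mean u) * (F x * \<psi> x))"
      unfolding dprod V_def .
    moreover have "(\<Sum>i\<in>UNIV. V i x * (F x * d\<psi> i x + dF i x * \<psi> x)) = F x * (\<Sum>i\<in>UNIV. V i x * d\<psi> i x) + \<psi> x * (\<Sum>i\<in>UNIV. V i x * dF i x)" for x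
      by (simp add: distrib_left sum.distrib sum_distrib_left mult_ac)
    ultimately have eq: "(LINT x|torus. F x * (\<Sum>i\<in>UNIV. V i x * d\<psi> i x) + \<psi> x * (\<Sum>i\<in>UNIV. V i x * dF i x)) = (LINT x|torus. (u x - mean u) * (F x * \<psi> x))"
      by simp
    let ?G = "\<lambda>x. f x * (\<Sum>i\<in>UNIV. V i x * d\<psi> i x)"
    let ?H = "\<lambda>x. (F x * (\<Sum>i\<in>UNIV. V i x * d\<psi> i x) + \<psi> x * (\<Sum>i\<in>UNIV. V i x * dF i x)) - (u x - mean u) * (F x * \<psi> x)"
    let ?b = "\<lambda>x. (B * A + n * P * \<kappa>) * (u x * \<psi> x) + (e * (\<Sum>i\<in>UNIV. \<bar>V i x * d\<psi> i x\<bar>) + e * (B + n * P * \<kappa>) * \<psi> x)"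
    have "(LINT x|torus. ?H x) = 0"
      using eq by (subst Bochner_Integration.integral_diff) (auto intro!: continuous_integrable_torus continuous_intros cF c\<psi> cd\<psi> cdF cV u)
    then have "\<bar>LINT x|torus. ?G x\<bar> = \<bar>LINT x|torus. ?G x - ?H x\<bar>"
      by (subst Bochner_Integration.integral_diff) (auto intro!: continuous_integrable_torus continuous_intros cF c\<psi> cd\<psi> cdF cV u f)
    also have "\<dots> \<le> (LINT x|torus. \<bar>?G x - ?H x\<bar>)" by (rule integral_abs_bound)
    also have "\<dots> \<le> (LINT x|torus. ?b x)"
    proof (rule integral_mono)
      show "integrable torus (\<lambda>x. \<bar>?G x - ?H x\<bar>)" "integrable torus ?b"
        by (intro continuous_integrable_torus continuous_intros cF c\<psi> cd\<psi> cdF cV u f)+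
      fix x
      have 1: "\<bar>(f x - F x) * (\<Sum>i\<in>UNIV. V i x * d\<psi> i x)\<bar> \<le> e * (\<Sum>i\<in>UNIV. \<bar>V i x * d\<psi> i x\<bar>)"
        unfolding abs_mult[of "f x - F x"] using \<epsilon>(2)[of x] by (intro mult_mono sum_abs) (auto simp: F_def abs_minus_commute)
      have "\<bar>\<Sum>i\<in>UNIV. V i x * dF i x\<bar> \<le> (\<Sum>i\<in>(UNIV :: 'n set). P * (\<kappa> * (u x + e)))"
      proof (rule order.trans[OF sum_abs], rule sum_mono)
        fix i
        show "\<bar>V i x * dF i x\<bar> \<le> P * (\<kappa> * (u x + e))"
          unfolding abs_mult V_def dF_def F_def using P[of i x] \<epsilon>(3)[of i x] P0 by (intro mult_mono) auto
      qed
      then have 2: "\<bar>\<psi> x * (\<Sum>i\<in>UNIV. V i x * dF i x)\<bar> \<le> \<psi> x * (n * (P * (\<kappa> * (u x + e))))"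
        using \<psi>(3)[of x] by (simp add: abs_mult n_def mult_left_mono)
      have 3: "\<bar>(u x - mean u) * (F x * \<psi> x)\<bar> \<le> B * ((A * u x + e) * \<psi> x)"
      proof -
        have "\<bar>u x - mean u\<bar> \<le> B" using mean u(3)[of x] u(4)[of x] by linarith
        moreover have "\<bar>F x\<bar> \<le> A * u x + e" using \<epsilon>(2)[of x] f(3)[of x] f(4)[of x] unfolding F_def by linarith
        ultimately show ?thesis unfolding abs_mult using \<psi>(3)[of x] B0 by (intro mult_mono) auto
      qed
      have "?G x - ?H x = (f x - F x) * (\<Sum>i\<in>UNIV. V i x * d\<psi> i x) - \<psi> x * (\<Sum>i\<in>UNIV. V i x * dF i x) + (u x - mean u) * (F x * \<psi> x)"
        by (simp add: algebra_simps)
      then have "\<bar>?G x - ?H x\<bar> \<le> e * (\<Sum>i\<in>UNIV. \<bar>V i x * d\<psi> i x\<bar>) + \<psi> x * (n * (P * (\<kappa> * (u x + e)))) + B * ((A * u x + e) * \<psi> x)"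
        using 1 2 3 by linarith
      also have "\<dots> = ?b x" by (simp add: algebra_simps)
      finally show "\<bar>?G x - ?H x\<bar> \<le> ?b x" .
    qed
    also have "\<dots> = (B * A + n * P * \<kappa>) * (LINT x|torus. u x * \<psi> x) + (e * Z + e * (B + n * P * \<kappa>) * (LINT x|torus. \<psi> x))"
      unfolding Z_def
      by (subst Bochner_Integration.integral_add; (subst Bochner_Integration.integral_add)?)
         (auto intro!: continuous_integrable_torus continuous_intros c\<psi> cd\<psi> cV u)
    also have "\<dots> = (B * A + n * P * \<kappa>) * (LINT x|torus. u x * \<psi> x) + K * e" by (simp add: K_def algebra_simps)
    finally show ?thesis .
  qed
  have "\<bar>LINT x|torus. f x * (\<Sum>i\<in>UNIV. V i x * d\<psi> i x)\<bar> \<le> (B * A + n * P * \<kappa>) * (LINT x|torus. u x * \<psi> x)"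
  proof (rule field_le_epsilon)
    fix e :: real assume e: "e > 0"
    define \<eta> where "\<eta> = e / (\<bar>K\<bar> + 1)"
    have \<eta>: "\<eta> > 0" using e by (simp add: \<eta>_def)
    have "K * \<eta> \<le> \<bar>K\<bar> * \<eta>" using \<eta> by (intro mult_right_mono) auto
    also have "\<dots> \<le> e" using e by (simp add: \<eta>_def divide_le_eq)
    finally show "\<bar>LINT x|torus. f x * (\<Sum>i\<in>UNIV. V i x * d\<psi> i x)\<bar> \<le> (B * A + n * P * \<kappa>) * (LINT x|torus. u x * \<psi> x) + e"
      using main[OF \<eta>] by linarith
  qed
  then show ?thesis by (simp add: V_def d\<psi>_def n_def)
qed

section \<open>Regularity in space and time\<close>

lemma periodic_uniform_in_time:
  fixes u :: "real \<Rightarrow> real ^ 'n \<Rightarrow> real"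
  assumes c: "continuous_on ({0..b} \<times> UNIV) (\<lambda>(t, x). u t x)" and per: "\<And>t. t \<in> {0..b} \<Longrightarrow> periodic (u t)" and e: "e > 0"
  obtains d where "d > 0" "\<And>s t x. s \<in> {0..b} \<Longrightarrow> t \<in> {0..b} \<Longrightarrow> \<bar>s - t\<bar> < d \<Longrightarrow> \<bar>u s x - u t x\<bar> \<le> e"
proof -
  have "uniformly_continuous_on ({0..b} \<times> cbox 0 1) (\<lambda>(t, x). u t x)"
    by (intro compact_uniformly_continuous continuous_on_subset[OF c] compact_Times) auto
  then obtain d where d: "d > 0" "\<And>p q. p \<in> {0..b} \<times> cbox 0 1 \<Longrightarrow> q \<in> {0..b} \<times> cbox 0 1 \<Longrightarrow> dist q p < d \<Longrightarrow>
      dist ((\<lambda>(t, x). u t x) q) ((\<lambda>(t, x). u t x) p) < e"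
    unfolding uniformly_continuous_on_def using e by metis
  have "\<bar>u s x - u t x\<bar> \<le> e" if st: "s \<in> {0..b}" "t \<in> {0..b}" "\<bar>s - t\<bar> < d" for s t x
  proof -
    obtain z where z: "\<And>i. z $ i \<in> \<int>" "x + z \<in> cbox 0 1" using periodic_reduce[of x] by blast
    have "dist (u s (x + z)) (u t (x + z)) < e"
      using d(2)[of "(t, x + z)" "(s, x + z)"] st z(2) by (simp add: dist_Pair_Pair dist_real_def)
    then show ?thesis
      using periodic_add_lattice[OF per[OF st(1)] z(1)] periodic_add_lattice[OF per[OF st(2)] z(1)] by (simp add: dist_real_def)
  qed
  then show ?thesis using that d(1) by blast
qed

lemma continuous_on_slice:
  assumes "continuous_on (T \<times> UNIV) (\<lambda>(t, x). u t x)" "t \<in> T"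
  shows "continuous_on UNIV (u t)"
proof -
  have "continuous_on UNIV (\<lambda>x. (\<lambda>(t, x). u t x) (t, x))"
    by (rule continuous_on_compose2[OF assms(1)]) (use assms(2) in \<open>auto intro!: continuous_intros\<close>)
  then show ?thesis by simp
qed

text \<open>
  Continuity in time is uniform in space because the velocity depends on \<open>u t\<close> continuously in the
  supremum norm.
\<close>

lemma continuous_on_velocity_spacetime:
  fixes u :: "real \<Rightarrow> real ^ 'n \<Rightarrow> real" and \<omega> :: "real \<Rightarrow> real ^ 'n \<Rightarrow> real"
  assumes g: "green_kernel g" and \<omega>: "mollifiers \<omega>"
    and c: "continuous_on ({0..b} \<times> UNIV) (\<lambda>(t, x). u t x)" and per: "\<And>t. t \<in> {0..b} \<Longrightarrow> periodic (u t)"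
  shows "continuous_on ({0..b} \<times> UNIV) (\<lambda>(t, x). pd i (conv g (u t)) x)"
  unfolding continuous_on_iff
proof (intro ballI allI impI)
  fix p :: "real \<times> (real ^ 'n)" and e :: real assume p: "p \<in> {0..b} \<times> UNIV" and e: "e > 0"
  obtain t x where tx: "p = (t, x)" "t \<in> {0..b}" using p by auto
  define C where "C = real CARD('n) * (LINT y|torus. \<bar>g y\<bar>) + 1"
  have "0 \<le> (LINT y|torus. \<bar>g y\<bar>)" by (intro integral_nonneg_AE AE_I2) auto
  then have C: "C > 0" by (simp add: C_def add_nonneg_pos)
  have "e / (2 * C) / 2 > 0" using e C by simp
  then obtain d where d: "d > 0" "\<And>s t x. s \<in> {0..b} \<Longrightarrow> t \<in> {0..b} \<Longrightarrow> \<bar>s - t\<bar> < d \<Longrightarrow> \<bar>u s x - u t x\<bar> \<le> e / (2 * C) / 2"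
    using periodic_uniform_in_time[OF c per] by metis
  have "continuous_on UNIV (pd i (conv g (u t)))"
    by (rule continuous_on_velocity[OF g \<omega> per[OF tx(2)] continuous_on_slice[OF c tx(2)]])
  then obtain r where r: "r > 0" "\<And>y. dist y x < r \<Longrightarrow> dist (pd i (conv g (u t)) y) (pd i (conv g (u t)) x) < e / 2"
    unfolding continuous_on_iff using e by (metis UNIV_I half_gt_zero)
  show "\<exists>d>0. \<forall>q\<in>{0..b} \<times> UNIV. dist q p < d \<longrightarrow>
      dist (case q of (t, x) \<Rightarrow> pd i (conv g (u t)) x) (case p of (t, x) \<Rightarrow> pd i (conv g (u t)) x) < e"
  proof (intro exI[of _ "min d r"] conjI ballI impI)
    show "min d r > 0" using d r by simp
    fix q :: "real \<times> (real ^ 'n)" assume "q \<in> {0..b} \<times> UNIV" and dq: "dist q p < min d r"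
    then obtain s y where sy: "q = (s, y)" "s \<in> {0..b}" by auto
    have "\<bar>s - t\<bar> < d" "dist y x < r"
      using dq dist_fst_le[of q p] dist_snd_le[of q p] by (auto simp: sy tx dist_real_def)
    have "\<bar>pd i (conv g (u s)) y - pd i (conv g (u t)) y\<bar> \<le> C * (e / (2 * C) / 2)"
      unfolding C_def
      by (intro velocity_diff_bound[OF g \<omega>] per sy tx continuous_on_slice[OF c] d(2)[OF sy(2) tx(2) \<open>\<bar>s - t\<bar> < d\<close>, unfolded C_def])
    also have "\<dots> < e / 2" using C e by simp
    finally show "dist (case q of (t, x) \<Rightarrow> pd i (conv g (u t)) x) (case p of (t, x) \<Rightarrow> pd i (conv g (u t)) x) < e"
      using r(2)[OF \<open>dist y x < r\<close>] unfolding sy(1) tx(1) prod.case dist_real_def by linarith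
  qed
qed

section \<open>The weak formulation against product test functions\<close>

lemma has_derivative_product_test:
  fixes \<theta> :: "real \<Rightarrow> real" and \<psi> :: "real ^ 'n \<Rightarrow> real"
  assumes "C_k 1 \<theta>" "C_k 1 \<psi>"
  shows "dderiv (1, 0) (\<lambda>z. \<theta> (fst z) * \<psi> (snd z)) (t, x) = dderiv 1 \<theta> t * \<psi> x"
    and "grad (\<lambda>y. \<theta> t * \<psi> y) x $ i = \<theta> t * pd i \<psi> x"
proof -
  have d: "\<theta> differentiable (at t)" "\<psi> differentiable (at x)" using assms by auto
  have "((\<lambda>z. \<theta> (fst z)) has_derivative (\<lambda>z. dderiv (fst z) \<theta> t)) (at (t, x))"
    by (rule has_derivative_compose[OF has_derivative_fst[OF has_derivative_ident]]) (simp add: has_derivative_dderiv d)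
  moreover have "((\<lambda>z. \<psi> (snd z)) has_derivative (\<lambda>z. dderiv (snd z) \<psi> x)) (at (t, x))"
    by (rule has_derivative_compose[OF has_derivative_snd[OF has_derivative_ident]]) (simp add: has_derivative_dderiv d)
  ultimately have "((\<lambda>z. \<theta> (fst z) * \<psi> (snd z)) has_derivative (\<lambda>z. \<theta> (fst (t, x)) * dderiv (snd z) \<psi> x + dderiv (fst z) \<theta> t * \<psi> (snd (t, x)))) (at (t, x))"
    by (rule has_derivative_mult)
  moreover have "dderiv 0 \<psi> x = 0"
    using linear_0[OF has_derivative_linear[OF has_derivative_dderiv[OF d(2)]]] .
  ultimately show "dderiv (1, 0) (\<lambda>z. \<theta> (fst z) * \<psi> (snd z)) (t, x) = dderiv 1 \<theta> t * \<psi> x"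
    by (simp add: dderiv_eqI)
  show "grad (\<lambda>y. \<theta> t * \<psi> y) x $ i = \<theta> t * pd i \<psi> x"
    using has_derivative_mult_right[OF has_derivative_dderiv[OF d(2)], of "\<theta> t"] by (simp add: grad_def dderiv_eqI)
qed

text \<open>
  For a test function \<open>\<theta> (t) \<psi> (x)\<close> with \<open>\<theta>\<close> supported in \<open>[0, b]\<close> the space-time integrand is continuous
  on the compact box, and the integral can be computed by iteration.
\<close>

lemma weak_solution_product_test:
  fixes u :: "real \<Rightarrow> real ^ 'n \<Rightarrow> real" and \<omega> :: "real \<Rightarrow> real ^ 'n \<Rightarrow> real"
  assumes m: "m > 0" and g: "green_kernel g" and \<omega>: "mollifiers \<omega>" and ws: "weak_solution m g u0 u"
    and b: "b > 0" and c: "continuous_on ({0..b} \<times> UNIV) (\<lambda>(t, x). u t x)"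
    and per: "\<And>t. t \<in> {0..b} \<Longrightarrow> periodic (u t)" and nonneg: "\<And>t x. t \<in> {0..b} \<Longrightarrow> 0 \<le> u t x"
    and \<theta>: "smooth \<theta>" "\<And>t. t \<le> 0 \<Longrightarrow> \<theta> t = 0" "\<And>t. t \<ge> b \<Longrightarrow> \<theta> t = 0" "\<And>t. t \<ge> b \<Longrightarrow> dderiv 1 \<theta> t = 0"
    and \<psi>: "periodic \<psi>" "smooth \<psi>"
  shows "integral {0..b} (\<lambda>t. dderiv 1 \<theta> t * (LINT x|torus. u t x * \<psi> x)
      - \<theta> t * (LINT x|torus. u t x powr m * (\<Sum>i\<in>UNIV. pd i (conv g (u t)) x * pd i \<psi> x))) = 0"
proof -
  define \<phi> where "\<phi> z = \<theta> (fst z) * \<psi> (snd z)" for z :: "real \<times> (real ^ 'n)"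
  have C: "C_k k \<theta>" "C_k k \<psi>" for k using \<theta>(1) \<psi>(2) by (auto simp: smooth_def)
  have "smooth \<phi>"
    unfolding smooth_def
  proof
    fix k
    have "C_k k (\<lambda>z :: real \<times> (real ^ 'n). \<theta> (0 + fst z) * \<psi> (0 + snd z))"
      by (intro C_k_mult C_k_affine C bounded_linear_fst bounded_linear_snd)
    then show "C_k k \<phi>" by (simp add: \<phi>_def[abs_def])
  qed
  then have "test_closed \<phi>"
    unfolding test_closed_def using \<psi>(1) \<theta>(3) by (auto simp: \<phi>_def periodic_def)
  moreover have "\<phi> (0, x) = 0" for x using \<theta>(2) by (simp add: \<phi>_def)
  ultimately have ws0: "(LINT (t, x)|spacetime. u t x * dderiv (1, 0) \<phi> (t, x)
           - (u t x powr m) * (velocity g (u t) x \<bullet> grad (\<lambda>y. \<phi> (t, y)) x)) = 0"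
    using ws unfolding weak_solution_def by auto
  define V where "V t i x = pd i (conv g (u t)) x" for t i x
  define N where "N t x = (\<Sum>i\<in>UNIV. V t i x * pd i \<psi> x)" for t x
  define H where "H z = (case z of (t, x) \<Rightarrow> u t x * (dderiv 1 \<theta> t * \<psi> x) - u t x powr m * (\<theta> t * N t x))" for z
  have H: "u t x * dderiv (1, 0) \<phi> (t, x) - (u t x powr m) * (velocity g (u t) x \<bullet> grad (\<lambda>y. \<phi> (t, y)) x) = H (t, x)" for t x
  proof -
    have "velocity g (u t) x \<bullet> grad (\<lambda>y. \<phi> (t, y)) x = \<theta> t * N t x"
      unfolding inner_vec_def \<phi>_def fst_conv snd_conv has_derivative_product_test(2)[OF C]
      by (simp add: velocity_def grad_def N_def V_def sum_distrib_left mult_ac)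
    moreover have "dderiv (1, 0) \<phi> (t, x) = dderiv 1 \<theta> t * \<psi> x"
      unfolding \<phi>_def by (rule has_derivative_product_test(1)[OF C])
    ultimately show ?thesis by (simp add: H_def)
  qed
  have Hzero: "H z = 0" if "fst z > b" for z
    using \<theta>(3)[of "fst z"] \<theta>(4)[of "fst z"] that by (simp add: H_def split_beta)
  have cu: "continuous_on ({0..b} \<times> UNIV) (\<lambda>z. u (fst z) (snd z))" using c by (simp add: split_beta)
  have cV: "continuous_on ({0..b} \<times> UNIV) (\<lambda>z. V (fst z) i (snd z))" for i
    using continuous_on_velocity_spacetime[OF g \<omega> c per, of i] by (simp add: split_beta V_def)
  have c\<theta>: "continuous_on S (\<lambda>z. \<theta> (fst z))" "continuous_on S (\<lambda>z. dderiv 1 \<theta> (fst z))" for S :: "(real \<times> (real ^ 'n)) set"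
    using C(1)[of 1] C_k_continuous[OF C(1)[of 0]] by (auto intro!: continuous_on_compose2[of UNIV _ S fst] continuous_intros)
  have c\<psi>: "continuous_on S (\<lambda>z. \<psi> (snd z))" "continuous_on S (\<lambda>z. pd i \<psi> (snd z))" for S :: "(real \<times> (real ^ 'n)) set" and i
    using C(2)[of 1] C_k_continuous[OF C(2)[of 0]]
    by (auto intro!: continuous_on_compose2[of UNIV _ S snd] continuous_intros simp: axis_in_Basis)
  have cN: "continuous_on ({0..b} \<times> UNIV) (\<lambda>z. N (fst z) (snd z))"
    unfolding N_def by (intro continuous_intros cV c\<psi>)
  have cum: "continuous_on ({0..b} \<times> UNIV) (\<lambda>z. u (fst z) (snd z) powr m)"
    using m nonneg by (intro continuous_on_powr' cu continuous_on_const) auto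
  have cH: "continuous_on ({0..b} \<times> UNIV) H"
    unfolding H_def split_beta by (intro continuous_intros cu cum cN c\<theta> c\<psi>)
  have box: "{0..b} \<times> cbox 0 1 = cbox (0, 0) (b, 1 :: real ^ 'n)" by (simp add: cbox_Pair_eq)
  have cHb: "continuous_on (cbox (0, 0) (b, 1)) H"
    unfolding box[symmetric] by (rule continuous_on_subset[OF cH]) auto
  have big: "({0..} \<times> cbox 0 1 :: (real \<times> (real ^ 'n)) set) \<in> sets lebesgue"
    using borel_closed[OF closed_Times[OF closed_atLeast[of "0 :: real"] closed_cbox[of "0 :: real ^ 'n" 1]]]
    by (simp add: sets_completionI_sets)
  have "0 = (LINT z|spacetime. H z)"
    using ws0 unfolding H by (simp add: split_beta)
  also have "\<dots> = (LINT z|lebesgue. indicator ({0..} \<times> cbox 0 1) z *\<^sub>R H z)"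
    by (rule integral_restrict_space) (use big in simp)
  also have "\<dots> = (LINT z|lebesgue. indicator (cbox (0, 0) (b, 1)) z *\<^sub>R H z)"
  proof (rule Bochner_Integration.integral_cong)
    fix z
    show "indicator ({0..} \<times> cbox 0 1) z *\<^sub>R H z = indicator (cbox (0, 0) (b, 1)) z *\<^sub>R H z"
      using Hzero[of z] by (cases "fst z > b") (auto simp: indicator_def box[symmetric])
  qed simp
  also have "\<dots> = (LINT z|lebesgue_on (cbox (0, 0) (b, 1)). H z)"
    by (rule integral_restrict_space[symmetric]) simp
  also have "\<dots> = integral (cbox (0, 0) (b, 1)) H"
    by (rule lebesgue_integral_eq_integral[OF continuous_imp_integrable[OF cHb]]) simp
  also have "\<dots> = integral (cbox 0 b) (\<lambda>t. integral (cbox 0 1) (\<lambda>x. H (t, x)))"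
    by (rule integral_prod_continuous[OF cHb])
  also have "\<dots> = integral {0..b} (\<lambda>t. dderiv 1 \<theta> t * (LINT x|torus. u t x * \<psi> x) - \<theta> t * (LINT x|torus. u t x powr m * N t x))"
    unfolding interval_cbox
  proof (rule integral_cong)
    fix t assume t: "t \<in> cbox 0 b"
    have slice: "continuous_on UNIV (\<lambda>x. h (t, x))" if "continuous_on ({0..b} \<times> UNIV) h" for h :: "real \<times> (real ^ 'n) \<Rightarrow> real"
      by (rule continuous_on_compose2[OF that]) (use t in \<open>auto intro!: continuous_intros\<close>)
    have i1: "integrable torus (\<lambda>x. u t x * \<psi> x)"
      using slice[OF cu] c\<psi>(1)[of UNIV] C_k_continuous[OF C(2)[of 0]] by (intro continuous_integrable_torus continuous_intros) auto
    have i2: "integrable torus (\<lambda>x. u t x powr m * N t x)"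
      using slice[OF cum] slice[OF cN] by (intro continuous_integrable_torus continuous_on_mult) auto
    have "integral (cbox 0 1) (\<lambda>x. H (t, x)) = (LINT x|torus. H (t, x))"
      by (rule torus_integral_eq[OF continuous_integrable_torus[OF slice[OF cH]], symmetric])
    also have "\<dots> = (LINT x|torus. dderiv 1 \<theta> t * (u t x * \<psi> x) - \<theta> t * (u t x powr m * N t x))"
      by (simp add: H_def mult_ac)
    also have "\<dots> = dderiv 1 \<theta> t * (LINT x|torus. u t x * \<psi> x) - \<theta> t * (LINT x|torus. u t x powr m * N t x)"
      using i1 i2 by simp
    finally show "integral (cbox 0 1) (\<lambda>x. H (t, x)) = dderiv 1 \<theta> t * (LINT x|torus. u t x * \<psi> x) - \<theta> t * (LINT x|torus. u t x powr m * N t x)" .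
  qed
  finally show ?thesis by (simp add: N_def V_def)
qed

section \<open>Gronwall in distributional form\<close>

lemma has_integral_bump:
  assumes "\<delta> > 0"
  obtains M where "M > 0" "\<And>\<tau> b. \<delta> \<le> \<tau> \<Longrightarrow> \<tau> \<le> b - \<delta> \<Longrightarrow> ((\<lambda>r. bump \<delta> (r - \<tau>)) has_integral M) {0..b}"
proof
  define M where "M = integral {-\<delta>..\<delta>} (bump \<delta>)"
  have c: "continuous_on {-\<delta>..\<delta>} (bump \<delta>)"
    using C_k_bump[of 0 \<delta>] by (auto intro: continuous_on_subset)
  have "M \<noteq> 0"
    unfolding M_def using integral_eq_0_iff[OF c] assms bump_nonneg bump_pos[of 0 \<delta>] by force
  moreover have "M \<ge> 0"
    unfolding M_def by (intro integral_nonneg integrable_continuous_real c bump_nonneg)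
  ultimately show "M > 0" by simp
  fix \<tau> b :: real assume \<tau>: "\<delta> \<le> \<tau>" "\<tau> \<le> b - \<delta>"
  have "(bump \<delta> has_integral M) {-\<delta>..\<delta>}" unfolding M_def by (intro integrable_integral integrable_continuous_real c)
  from has_integral_shift_real_ivl[OF this, of "-\<tau>"]
  have "((\<lambda>r. bump \<delta> (r - \<tau>)) has_integral M) {\<tau> - \<delta>..\<tau> + \<delta>}" by (simp add: add.commute)
  then show "((\<lambda>r. bump \<delta> (r - \<tau>)) has_integral M) {0..b}"
  proof (rule has_integral_on_superset)
    show "bump \<delta> (r - \<tau>) = 0" if "r \<notin> {\<tau> - \<delta>..\<tau> + \<delta>}" for r
      using that by (intro bump_zero) auto
  qed (use \<tau> in auto)
qed

text \<open>
  The hypothesis \<open>weak\<close> says \<open>U' = - R\<close> in the sense of distributions. Mollified in time, \<open>U\<close> becomes a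
  differentiable function with the same differential inequality. Comparing averages of \<open>U\<close> over small
  intervals around \<open>s\<close> and \<open>t\<close> avoids a passage to the limit.
\<close>

lemma distributional_gronwall:
  fixes U R :: "real \<Rightarrow> real"
  assumes U: "continuous_on {0..b} U" and R: "continuous_on {0..b} R"
    and RU: "\<And>t. t \<in> {0..b} \<Longrightarrow> \<bar>R t\<bar> \<le> K * U t"
    and weak: "\<And>\<theta>. smooth \<theta> \<Longrightarrow> (\<And>t. t \<le> 0 \<Longrightarrow> \<theta> t = 0) \<Longrightarrow> (\<And>t. t \<ge> b \<Longrightarrow> \<theta> t = 0) \<Longrightarrow> (\<And>t. t \<ge> b \<Longrightarrow> dderiv 1 \<theta> t = 0) \<Longrightarrow>
      integral {0..b} (\<lambda>t. dderiv 1 \<theta> t * U t - \<theta> t * R t) = 0"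
    and st: "s \<in> {0<..<b}" "t \<in> {0<..<b}"
  shows "U t \<le> exp (K * \<bar>t - s\<bar>) * U s"
proof (rule ccontr)
  assume neg: "\<not> U t \<le> exp (K * \<bar>t - s\<bar>) * U s"
  define q where "q = exp (K * \<bar>t - s\<bar>)"
  have q: "q > 0" by (simp add: q_def)
  define \<gamma> where "\<gamma> = (U t - q * U s) / (2 * (1 + q))"
  have \<gamma>: "\<gamma> > 0" using neg q by (simp add: \<gamma>_def q_def[symmetric])
  have "\<exists>d>0. \<forall>r\<in>{0..b}. dist r x < d \<longrightarrow> dist (U r) (U x) < \<gamma>" if "x \<in> {0<..<b}" for x
    using U \<gamma> that unfolding continuous_on_iff by force
  then obtain d1 d2 where d: "d1 > 0" "\<And>r. r \<in> {0..b} \<Longrightarrow> dist r s < d1 \<Longrightarrow> dist (U r) (U s) < \<gamma>"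
     "d2 > 0" "\<And>r. r \<in> {0..b} \<Longrightarrow> dist r t < d2 \<Longrightarrow> dist (U r) (U t) < \<gamma>"
    using st by meson
  define \<delta> where "\<delta> = min (min d1 d2) (min (min s t) (min (b - s) (b - t))) / 2"
  have \<delta>: "\<delta> > 0" "\<delta> < d1" "\<delta> < d2" "\<delta> < s" "\<delta> < t" "s < b - \<delta>" "t < b - \<delta>"
    using d st by (auto simp: \<delta>_def min_def field_simps)
  define \<beta> where "\<beta> = bump \<delta>"
  define \<beta>' where "\<beta>' = dderiv 1 \<beta>"
  have \<beta>C: "C_k k \<beta>" for k by (simp add: \<beta>_def C_k_bump)
  have \<beta>d: "(\<beta> has_real_derivative \<beta>' x) (at x)" for x
  proof -
    have "\<beta> differentiable (at x)" using \<beta>C[of 1] by simp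
    then obtain D where "(\<beta> has_real_derivative D) (at x)" by (auto simp: real_differentiable_def)
    then show ?thesis using dderiv_real unfolding \<beta>'_def by metis
  qed
  have c\<beta>: "continuous_on UNIV \<beta>" "continuous_on UNIV \<beta>'"
    using \<beta>C[of 0] \<beta>C[of 1] by (auto simp: \<beta>'_def)
  have cs: "continuous_on S (\<lambda>r. \<beta> (r - \<tau>))" "continuous_on S (\<lambda>r. \<beta>' (r - \<tau>))" for S \<tau>
    by (auto intro!: continuous_on_compose2[OF c\<beta>(1)] continuous_on_compose2[OF c\<beta>(2)] continuous_intros)
  define W where "W \<tau> = integral {0..b} (\<lambda>r. U r * \<beta> (r - \<tau>))" for \<tau>
  define W' where "W' \<tau> = integral {0..b} (\<lambda>r. - U r * \<beta>' (r - \<tau>))" for \<tau>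
  have Wd: "(W has_real_derivative W' \<tau>) (at \<tau>)" for \<tau>
  proof -
    have "((\<lambda>\<tau>. integral (cbox 0 b) (\<lambda>r. U r * \<beta> (r - \<tau>))) has_real_derivative integral (cbox 0 b) (\<lambda>r. - U r * \<beta>' (r - \<tau>))) (at \<tau> within UNIV)"
    proof (rule leibniz_rule_field_derivative[where fx = "\<lambda>\<tau> r. - U r * \<beta>' (r - \<tau>)"])
      show "((\<lambda>\<tau>. U r * \<beta> (r - \<tau>)) has_real_derivative - U r * \<beta>' (r - \<tau>)) (at \<tau> within UNIV)" for \<tau> r
        by (auto intro!: derivative_eq_intros DERIV_chain2[OF \<beta>d])
      show "(\<lambda>r. U r * \<beta> (r - \<tau>)) integrable_on cbox 0 b" for \<tau>
        using U by (intro integrable_continuous continuous_on_mult cs) auto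
      show "continuous_on (UNIV \<times> cbox 0 b) (\<lambda>(\<tau>, r). - U r * \<beta>' (r - \<tau>))"
        unfolding split_beta using U
        by (intro continuous_intros continuous_on_compose2[OF c\<beta>(2)] continuous_on_compose2[OF U]) auto
    qed auto
    then show ?thesis by (simp add: W_def[abs_def] W'_def)
  qed
  have W'b: "\<bar>W' \<tau>\<bar> \<le> K * W \<tau>" if \<tau>: "\<delta> \<le> \<tau>" "\<tau> \<le> b - \<delta>" for \<tau>
  proof -
    have sm: "smooth (\<lambda>r. \<beta> (r - \<tau>))"
      unfolding smooth_def using C_k_affine[OF bounded_linear_ident \<beta>C, of _ "- \<tau>"] by simp
    have "((\<lambda>r. \<beta> (r - \<tau>)) has_real_derivative \<beta>' (r - \<tau>) * 1) (at r)" for r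
      by (rule DERIV_chain2[OF \<beta>d]) (auto intro!: derivative_eq_intros)
    then have dd: "dderiv 1 (\<lambda>r. \<beta> (r - \<tau>)) = (\<lambda>r. \<beta>' (r - \<tau>))"
      by (intro ext dderiv_real) simp
    have out: "\<beta> (r - \<tau>) = 0" if "r \<le> 0 \<or> r \<ge> b" for r
      unfolding \<beta>_def using that \<tau> \<delta>(1) by (intro bump_zero) auto
    \<comment> \<open>Outside its support the bump has a minimum, so its derivative vanishes there.\<close>
    have out': "\<beta>' (r - \<tau>) = 0" if "r \<ge> b" for r
    proof -
      have "\<beta>' = (\<lambda>x. dderiv 1 \<beta> x)" by (simp add: \<beta>'_def)
      have "\<bar>r - \<tau>\<bar> \<ge> \<delta>" using that \<tau> by auto
      then have "\<beta> (r - \<tau>) = 0" unfolding \<beta>_def by (rule bump_zero)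
      then have "\<beta>' (r - \<tau>) = 0"
        using DERIV_local_min[OF \<beta>d, of 1 "r - \<tau>"] bump_nonneg by (simp add: \<beta>_def)
      then show ?thesis .
    qed
    have "integral {0..b} (\<lambda>r. \<beta>' (r - \<tau>) * U r - \<beta> (r - \<tau>) * R r) = 0"
      using weak[OF sm] out out' unfolding dd by blast
    moreover have "integral {0..b} (\<lambda>r. \<beta>' (r - \<tau>) * U r - \<beta> (r - \<tau>) * R r)
        = integral {0..b} (\<lambda>r. \<beta>' (r - \<tau>) * U r) - integral {0..b} (\<lambda>r. \<beta> (r - \<tau>) * R r)"
      by (intro integral_diff integrable_continuous_real continuous_on_mult cs U R)
    moreover have "W' \<tau> = - integral {0..b} (\<lambda>r. \<beta>' (r - \<tau>) * U r)"
      by (simp add: W'_def mult.commute)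
    ultimately have "W' \<tau> = - integral {0..b} (\<lambda>r. \<beta> (r - \<tau>) * R r)" by simp
    also have "\<bar>- integral {0..b} (\<lambda>r. \<beta> (r - \<tau>) * R r)\<bar> \<le> integral {0..b} (\<lambda>r. K * (U r * \<beta> (r - \<tau>)))"
    proof -
      have "norm (integral {0..b} (\<lambda>r. \<beta> (r - \<tau>) * R r)) \<le> integral {0..b} (\<lambda>r. K * (U r * \<beta> (r - \<tau>)))"
      proof (rule integral_norm_bound_integral)
        fix r assume "r \<in> {0..b}"
        then have "\<beta> (r - \<tau>) * \<bar>R r\<bar> \<le> \<beta> (r - \<tau>) * (K * U r)"
          by (intro mult_left_mono RU) (auto simp: \<beta>_def bump_nonneg)
        then show "norm (\<beta> (r - \<tau>) * R r) \<le> K * (U r * \<beta> (r - \<tau>))"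
          using bump_nonneg[of \<delta> "r - \<tau>"] by (simp add: abs_mult \<beta>_def mult_ac)
      qed (intro integrable_continuous_real continuous_on_mult continuous_on_const cs U R)+
      then show ?thesis by simp
    qed
    finally show ?thesis by (simp add: W_def)
  qed
  have grow: "W y \<le> exp (K * (y - x)) * W x \<and> W x \<le> exp (K * (y - x)) * W y" if xy: "\<delta> \<le> x" "x \<le> y" "y \<le> b - \<delta>" for x y
  proof
    have "exp (- K * y) * W y \<le> exp (- K * x) * W x"
    proof (rule DERIV_nonpos_imp_nonincreasing[OF xy(2), of "\<lambda>\<tau>. exp (- K * \<tau>) * W \<tau>"])
      fix \<tau> assume \<tau>: "x \<le> \<tau>" "\<tau> \<le> y"
      have "((\<lambda>\<tau>. exp (- K * \<tau>) * W \<tau>) has_real_derivative exp (- K * \<tau>) * (W' \<tau> - K * W \<tau>)) (at \<tau>)"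
        by (auto intro!: derivative_eq_intros Wd simp: algebra_simps)
      moreover have "exp (- K * \<tau>) * (W' \<tau> - K * W \<tau>) \<le> 0"
        using W'b[of \<tau>] \<tau> xy by (intro mult_nonneg_nonpos) auto
      ultimately show "\<exists>D. ((\<lambda>\<tau>. exp (- K * \<tau>) * W \<tau>) has_real_derivative D) (at \<tau>) \<and> D \<le> 0" by blast
    qed
    then have "exp (K * y) * (exp (- K * y) * W y) \<le> exp (K * y) * (exp (- K * x) * W x)"
      by (intro mult_left_mono) auto
    moreover have "exp (K * y) * (exp (- K * y) * W y) = W y" by (simp add: exp_minus field_simps)
    moreover have "exp (K * y) * (exp (- K * x) * W x) = exp (K * (y - x)) * W x"
      by (simp add: exp_minus exp_diff right_diff_distrib divide_inverse)
    ultimately show "W y \<le> exp (K * (y - x)) * W x" by linarith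
    have "exp (K * x) * W x \<le> exp (K * y) * W y"
    proof (rule DERIV_nonneg_imp_nondecreasing[OF xy(2), of "\<lambda>\<tau>. exp (K * \<tau>) * W \<tau>"])
      fix \<tau> assume \<tau>: "x \<le> \<tau>" "\<tau> \<le> y"
      have "((\<lambda>\<tau>. exp (K * \<tau>) * W \<tau>) has_real_derivative exp (K * \<tau>) * (W' \<tau> + K * W \<tau>)) (at \<tau>)"
        by (auto intro!: derivative_eq_intros Wd simp: algebra_simps)
      moreover have "exp (K * \<tau>) * (W' \<tau> + K * W \<tau>) \<ge> 0"
        using W'b[of \<tau>] \<tau> xy by (intro mult_nonneg_nonneg) auto
      ultimately show "\<exists>D. ((\<lambda>\<tau>. exp (K * \<tau>) * W \<tau>) has_real_derivative D) (at \<tau>) \<and> D \<ge> 0" by blast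
    qed
    then have "exp (- K * x) * (exp (K * x) * W x) \<le> exp (- K * x) * (exp (K * y) * W y)"
      by (intro mult_left_mono) auto
    moreover have "exp (- K * x) * (exp (K * x) * W x) = W x" by (simp add: exp_minus field_simps)
    moreover have "exp (- K * x) * (exp (K * y) * W y) = exp (K * (y - x)) * W y"
      by (simp add: exp_minus exp_diff right_diff_distrib divide_inverse)
    ultimately show "W x \<le> exp (K * (y - x)) * W y" by linarith
  qed
  have Wst: "W t \<le> q * W s"
    using grow[of s t] grow[of t s] \<delta> by (cases "s \<le> t") (auto simp: q_def abs_if)
  obtain M where M: "M > 0" "\<And>\<tau> b. \<delta> \<le> \<tau> \<Longrightarrow> \<tau> \<le> b - \<delta> \<Longrightarrow> ((\<lambda>r. bump \<delta> (r - \<tau>)) has_integral M) {0..b}"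
    using has_integral_bump[OF \<delta>(1)] by blast
  have Wi: "((\<lambda>r. U r * \<beta> (r - \<tau>)) has_integral W \<tau>) {0..b}" for \<tau>
    unfolding W_def by (intro integrable_integral integrable_continuous_real continuous_on_mult cs U)
  have "(U t - \<gamma>) * M \<le> W t"
  proof (rule has_integral_le[OF has_integral_mult_right[OF M(2)] Wi])
    fix r assume r: "r \<in> {0..b}"
    show "(U t - \<gamma>) * bump \<delta> (r - t) \<le> U r * \<beta> (r - t)"
    proof (cases "\<bar>r - t\<bar> < \<delta>")
      case True
      then have "U t - \<gamma> \<le> U r" using d(4)[OF r] \<delta> by (auto simp: dist_real_def)
      then show ?thesis unfolding \<beta>_def by (intro mult_right_mono bump_nonneg)
    qed (simp add: \<beta>_def bump_zero)
  qed (use \<delta> in auto)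
  moreover have "W s \<le> (U s + \<gamma>) * M"
  proof (rule has_integral_le[OF Wi has_integral_mult_right[OF M(2)]])
    fix r assume r: "r \<in> {0..b}"
    show "U r * \<beta> (r - s) \<le> (U s + \<gamma>) * bump \<delta> (r - s)"
    proof (cases "\<bar>r - s\<bar> < \<delta>")
      case True
      then have "U r \<le> U s + \<gamma>" using d(2)[OF r] \<delta> by (auto simp: dist_real_def)
      then show ?thesis unfolding \<beta>_def by (intro mult_right_mono bump_nonneg)
    qed (simp add: \<beta>_def bump_zero)
  qed (use \<delta> in auto)
  then have "q * W s \<le> q * ((U s + \<gamma>) * M)" using q by (intro mult_left_mono) auto
  ultimately have "(U t - \<gamma>) * M \<le> (q * (U s + \<gamma>)) * M" using Wst by (simp add: mult.assoc)
  then have "U t - \<gamma> \<le> q * (U s + \<gamma>)" using M(1) by (simp add: mult_le_cancel_right)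
  then have "U t - q * U s \<le> \<gamma> * (1 + q)" by (simp add: algebra_simps)
  moreover have "\<gamma> * (2 * (1 + q)) = U t - q * U s"
    by (rule iffD1[OF nonzero_eq_divide_eq \<gamma>_def]) (use q in simp)
  ultimately have "U t - q * U s \<le> 0" by (simp add: algebra_simps)
  then show False using neg by (simp add: q_def)
qed

section \<open>Waiting times for regular solutions\<close>

text \<open>
  The inequality holds for the integrals of \<open>u t\<close> against every nonnegative smooth periodic weight. With
  mollifiers centred at \<open>x\<close> as weights it becomes pointwise.
\<close>

lemma density_ratio:
  fixes u :: "real \<Rightarrow> real ^ 'n \<Rightarrow> real" and \<omega> :: "real \<Rightarrow> real ^ 'n \<Rightarrow> real"
  assumes m: "m > 1" and g: "green_kernel g" and \<omega>: "mollifiers \<omega>" and ws: "weak_solution m g u0 u"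
    and b: "b > 0" and c: "continuous_on ({0..b} \<times> UNIV) (\<lambda>(t, x). u t x)"
    and per: "\<And>t. t \<in> {0..b} \<Longrightarrow> periodic (u t)" and nonneg: "\<And>t x. t \<in> {0..b} \<Longrightarrow> 0 \<le> u t x"
    and lip: "\<And>t x y. t \<in> {0..b} \<Longrightarrow> \<bar>u t x powr m - u t y powr m\<bar> \<le> \<kappa> * max (u t x) (u t y) * dist x y" and \<kappa>: "\<kappa> \<ge> 0"
  obtains K where "\<And>s t x. s \<in> {0<..<b} \<Longrightarrow> t \<in> {0<..<b} \<Longrightarrow> u t x \<le> exp (K * \<bar>t - s\<bar>) * u s x"
proof -
  have "bounded ((\<lambda>(t, x). u t x) ` ({0..b} \<times> cbox 0 1))"
    by (intro compact_imp_bounded compact_continuous_image continuous_on_subset[OF c] compact_Times) auto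
  then obtain B where B: "B > 0" "\<And>t x. t \<in> {0..b} \<Longrightarrow> x \<in> cbox 0 1 \<Longrightarrow> \<bar>u t x\<bar> \<le> B"
    unfolding bounded_pos by force
  have uB: "\<bar>u t x\<bar> \<le> B" if "t \<in> {0..b}" for t x
  proof -
    obtain z where z: "\<And>i. z $ i \<in> \<int>" "x + z \<in> cbox 0 1" using periodic_reduce[of x] by blast
    then show ?thesis using B(2)[OF that z(2)] periodic_add_lattice[OF per[OF that] z(1), of x] by simp
  qed
  define P where "P = (real CARD('n) * (LINT y|torus. \<bar>g y\<bar>) + 1) * B"
  define K where "K = B * B powr (m - 1) + real CARD('n) * P * \<kappa>"
  have cu: "continuous_on UNIV (u t)" if "t \<in> {0..b}" for t by (rule continuous_on_slice[OF c that])
  have cum: "continuous_on UNIV (\<lambda>x. u t x powr m)" if "t \<in> {0..b}" for t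
    using m nonneg that by (intro continuous_on_powr' cu continuous_on_const) auto
  have mono: "u t x powr m \<le> B powr (m - 1) * u t x" if "t \<in> {0..b}" for t x
  proof -
    have "u t x powr m = u t x powr (m - 1) * u t x powr 1" unfolding powr_add[symmetric] by simp
    also have "\<dots> = u t x powr (m - 1) * u t x" using nonneg[OF that] by simp
    also have "\<dots> \<le> B powr (m - 1) * u t x"
      using nonneg[OF that, of x] uB[OF that, of x] m by (intro mult_right_mono powr_mono2) auto
    finally show ?thesis .
  qed
  have weighted: "(LINT x|torus. u t x * \<psi> x) \<le> exp (K * \<bar>t - s\<bar>) * (LINT x|torus. u s x * \<psi> x)"
    if \<psi>: "periodic \<psi>" "smooth \<psi>" "\<And>x. 0 \<le> \<psi> x" and st: "s \<in> {0<..<b}" "t \<in> {0<..<b}" for \<psi> s t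
  proof -
    have \<psi>1: "C_k 1 \<psi>" using \<psi>(2) by (simp add: smooth_def)
    have c\<psi>: "continuous_on UNIV \<psi>" "continuous_on UNIV (pd i \<psi>)" for i
      using C_k_continuous[OF \<psi>1] \<psi>1 by (auto simp: axis_in_Basis)
    define U where "U t = (LINT x|torus. u t x * \<psi> x)" for t
    define R where "R t = (LINT x|torus. u t x powr m * (\<Sum>i\<in>UNIV. pd i (conv g (u t)) x * pd i \<psi> x))" for t
    have cV: "continuous_on UNIV (pd i (conv g (u t)))" if "t \<in> {0..b}" for i t
      by (rule continuous_on_velocity[OF g \<omega> per[OF that] cu[OF that]])
    have sub: "{0..b} \<times> cbox 0 1 \<subseteq> {0..b} \<times> (UNIV :: (real ^ 'n) set)" by auto
    have cu': "continuous_on ({0..b} \<times> cbox 0 1) (\<lambda>z. u (fst z) (snd z))"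
      using continuous_on_subset[OF c sub] by (simp add: split_beta)
    have cV': "continuous_on ({0..b} \<times> cbox 0 1) (\<lambda>z. pd i (conv g (u (fst z))) (snd z))" for i
      using continuous_on_subset[OF continuous_on_velocity_spacetime[OF g \<omega> c per, of i] sub]
      by (simp add: split_beta)
    have c\<psi>': "continuous_on S (\<lambda>z. \<psi> (snd z))" "continuous_on S (\<lambda>z. pd i \<psi> (snd z))" for S :: "(real \<times> (real ^ 'n)) set" and i
      using c\<psi> by (auto intro!: continuous_on_compose2[of UNIV _ S snd] continuous_intros)
    have cum': "continuous_on ({0..b} \<times> cbox 0 1) (\<lambda>z. u (fst z) (snd z) powr m)"
      using m nonneg by (intro continuous_on_powr' cu' continuous_on_const) auto
    have "continuous_on {0..b} (\<lambda>t. integral (cbox 0 1) (\<lambda>x. u t x * \<psi> x))"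
      by (rule integral_continuous_on_param) (unfold split_beta, intro continuous_intros cu' c\<psi>')
    moreover have "integral (cbox 0 1) (\<lambda>x. u t x * \<psi> x) = U t" if "t \<in> {0..b}" for t
      unfolding U_def by (rule torus_integral_eq[symmetric]) (intro continuous_integrable_torus continuous_intros cu that c\<psi>)
    ultimately have cU: "continuous_on {0..b} U" by (rule continuous_on_eq)
    have "continuous_on {0..b} (\<lambda>t. integral (cbox 0 1) (\<lambda>x. u t x powr m * (\<Sum>i\<in>UNIV. pd i (conv g (u t)) x * pd i \<psi> x)))"
      by (rule integral_continuous_on_param) (unfold split_beta, intro continuous_on_mult continuous_on_sum cum' cV' c\<psi>')
    moreover have "integral (cbox 0 1) (\<lambda>x. u t x powr m * (\<Sum>i\<in>UNIV. pd i (conv g (u t)) x * pd i \<psi> x)) = R t"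
      if "t \<in> {0..b}" for t
      unfolding R_def by (rule torus_integral_eq[symmetric]) (intro continuous_integrable_torus continuous_on_mult continuous_on_sum cum cV that c\<psi>)
    ultimately have cR: "continuous_on {0..b} R" by (rule continuous_on_eq)
    have RU: "\<bar>R t\<bar> \<le> K * U t" if t: "t \<in> {0..b}" for t
      unfolding R_def U_def K_def
    proof (rule flux_bound[OF g \<omega> per[OF t] cu[OF t] nonneg[OF t]])
      show "u t x \<le> B" for x using uB[OF t, of x] by simp
      show "periodic (\<lambda>x. u t x powr m)" using per[OF t] by (simp add: periodic_def)
      show "u t x powr m \<le> B powr (m - 1) * u t x" for x by (rule mono[OF t])
      show "\<bar>pd i (conv g (u t)) x\<bar> \<le> P" for i x
        unfolding P_def by (rule velocity_bound[OF g \<omega> per[OF t] cu[OF t] uB[OF t]])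
    qed (use cum[OF t] lip[OF t] \<kappa> \<psi> \<psi>1 in auto)
    have "U t \<le> exp (K * \<bar>t - s\<bar>) * U s"
    proof (rule distributional_gronwall[OF cU cR RU _ st])
      show "integral {0..b} (\<lambda>t. dderiv 1 \<theta> t * U t - \<theta> t * R t) = 0"
        if "smooth \<theta>" "\<And>t. t \<le> 0 \<Longrightarrow> \<theta> t = 0" "\<And>t. t \<ge> b \<Longrightarrow> \<theta> t = 0" "\<And>t. t \<ge> b \<Longrightarrow> dderiv 1 \<theta> t = 0" for \<theta>
        unfolding U_def R_def using m
        by (intro weak_solution_product_test[OF _ g \<omega> ws b c per nonneg that \<psi>(1,2)]) auto
    qed
    then show ?thesis by (simp add: U_def)
  qed
  have "u t x \<le> exp (K * \<bar>t - s\<bar>) * u s x" if st: "s \<in> {0<..<b}" "t \<in> {0<..<b}" for s t x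
  proof (rule field_le_epsilon)
    fix e :: real assume e: "e > 0"
    define q where "q = exp (K * \<bar>t - s\<bar>)"
    have q: "q > 0" by (simp add: q_def)
    define d where "d = e / (1 + q)"
    have d: "d > 0" using e q by (simp add: d_def)
    have st': "s \<in> {0..b}" "t \<in> {0..b}" using st by auto
    have "\<forall>\<^sub>F \<epsilon> in at_right 0. \<epsilon> > 0 \<and> (\<forall>x. \<bar>conv (\<omega> \<epsilon>) (u s) x - u s x\<bar> \<le> d) \<and> (\<forall>x. \<bar>conv (\<omega> \<epsilon>) (u t) x - u t x\<bar> \<le> d)"
      by (intro eventually_conj mollify_uniform[OF \<omega>] per st' cu d) (auto simp: eventually_at_right_less)
    then obtain \<epsilon> where \<epsilon>: "\<epsilon> > 0" "\<bar>conv (\<omega> \<epsilon>) (u s) x - u s x\<bar> \<le> d" "\<bar>conv (\<omega> \<epsilon>) (u t) x - u t x\<bar> \<le> d"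
      using eventually_happens'[OF trivial_limit_at_right_real] by blast
    note w = mollifiersD[OF \<omega> \<epsilon>(1)]
    have "smooth (\<lambda>y. \<omega> \<epsilon> (x - y))" using w(2) C_k_reflect by (auto simp: smooth_def)
    then have "(LINT y|torus. u t y * \<omega> \<epsilon> (x - y)) \<le> q * (LINT y|torus. u s y * \<omega> \<epsilon> (x - y))"
      unfolding q_def by (intro weighted periodic_reflect w st)
    then have "conv (\<omega> \<epsilon>) (u t) x \<le> q * conv (\<omega> \<epsilon>) (u s) x" by (simp add: conv_def mult.commute)
    also have "\<dots> \<le> q * (u s x + d)" using \<epsilon>(2) q by (intro mult_left_mono) auto
    finally have "u t x \<le> q * u s x + d * (1 + q)" using \<epsilon>(3) by (simp add: algebra_simps)
    also have "d * (1 + q) = e" by (rule iffD1[OF nonzero_eq_divide_eq d_def]) (use q in simp)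
    finally show "u t x \<le> exp (K * \<bar>t - s\<bar>) * u s x + e" by (simp add: q_def)
  qed
  then show ?thesis using that by blast
qed

text \<open>
  With \<open>w = u powr (m - 1)\<close> and \<open>q = m / (m - 1)\<close>, \<open>u powr m = w powr q\<close> has at each point a local Lipschitz
  constant \<open>q * L * u\<close>. The ratio bound on the open time interval extends to time \<open>0\<close> by continuity.
\<close>

lemma stationary_positivity_set:
  fixes u :: "real \<Rightarrow> real ^ 'n \<Rightarrow> real" and \<omega> :: "real \<Rightarrow> real ^ 'n \<Rightarrow> real"
  assumes m: "m > 1" and g: "green_kernel g" and \<omega>: "mollifiers \<omega>" and ws: "weak_solution m g u0 u"
    and per: "\<And>t. t \<ge> 0 \<Longrightarrow> periodic (u t)" and nonneg: "\<And>t x. t \<ge> 0 \<Longrightarrow> 0 \<le> u t x"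
    and lip: "L-lipschitz_on ({0..<T} \<times> UNIV) (\<lambda>(t, x). u t x powr (m - 1))" and t: "t \<in> {0..<T}"
  shows "u t x > 0 \<longleftrightarrow> u 0 x > 0"
proof (cases "t = 0")
  case False
  then have t0: "0 < t" "t < T" using t by auto
  define b where "b = (t + T) / 2"
  have b: "b > 0" "t < b" "b < T" using t0 by (auto simp: b_def)
  define a where "a = 1 / (m - 1)"
  have a: "a > 0" using m by (simp add: a_def)
  have ua: "u s x = (u s x powr (m - 1)) powr a" if "s \<ge> 0" for s x
    using m nonneg[OF that, of x] by (cases "u s x = 0") (auto simp: a_def powr_powr)
  have "continuous_on ({0..<T} \<times> UNIV) (\<lambda>z. (\<lambda>(t, x). u t x powr (m - 1)) z powr a)"
    using a by (intro continuous_on_powr' lipschitz_on_continuous_on[OF lip] continuous_on_const) auto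
  then have "continuous_on ({0..b} \<times> UNIV) (\<lambda>z. (\<lambda>(t, x). u t x powr (m - 1)) z powr a)"
    by (rule continuous_on_subset) (use b in auto)
  moreover have "(\<lambda>(t, x). u t x powr (m - 1)) z powr a = (\<lambda>(t, x). u t x) z" if "z \<in> {0..b} \<times> UNIV" for z
    using that by (auto simp: ua[symmetric])
  ultimately have c: "continuous_on ({0..b} \<times> UNIV) (\<lambda>(t, x). u t x)" by (simp cong: continuous_on_cong)
  have L0: "L \<ge> 0" using lip by (rule lipschitz_on_nonneg)
  define q where "q = m * a"
  have q: "q > 1" "q - 1 = a" using m by (auto simp: q_def a_def field_simps)
  have lipm: "\<bar>u s x powr m - u s y powr m\<bar> \<le> (q * L) * max (u s x) (u s y) * dist x y" if s: "s \<in> {0..b}" for s x y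
  proof -
    define w where "w x = u s x powr (m - 1)" for x
    have w0: "w x \<ge> 0" for x by (simp add: w_def)
    have uw: "u s x = w x powr a" for x using ua[of s x] s by (simp add: w_def)
    have um: "u s x powr m = w x powr q" for x unfolding uw powr_powr by (simp add: q_def mult.commute)
    have "\<bar>w x powr q - w y powr q\<bar> \<le> q * (max (w x) (w y)) powr (q - 1) * \<bar>w x - w y\<bar>"
      by (intro powr_lipschitz w0 q)
    also have "(max (w x) (w y)) powr (q - 1) = max (u s x) (u s y)"
      unfolding q uw using powr_mono2[of a "w x" "w y"] powr_mono2[of a "w y" "w x"] a w0[of x] w0[of y] by (auto simp: max_def)
    also have "q * max (u s x) (u s y) * \<bar>w x - w y\<bar> \<le> q * max (u s x) (u s y) * (L * dist x y)"
    proof (rule mult_left_mono)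
      have "dist (w x) (w y) \<le> L * dist (s, x) (s, y)"
        using lipschitz_onD[OF lip, of "(s, x)" "(s, y)"] s b by (auto simp: w_def)
      then show "\<bar>w x - w y\<bar> \<le> L * dist x y" by (simp add: dist_real_def dist_Pair_Pair)
      show "0 \<le> q * max (u s x) (u s y)" using q nonneg[of s x] s by (intro mult_nonneg_nonneg) auto
    qed
    finally show ?thesis by (simp add: um mult_ac)
  qed
  obtain K where K: "\<And>s r x. s \<in> {0<..<b} \<Longrightarrow> r \<in> {0<..<b} \<Longrightarrow> u r x \<le> exp (K * \<bar>r - s\<bar>) * u s x"
  proof (rule density_ratio[OF m g \<omega> ws b(1) c _ _ lipm])
    show "0 \<le> q * L" using q L0 by simp
  qed (use per nonneg in auto)
  have cs: "continuous_on {0..b} (\<lambda>s. (\<lambda>(t, x). u t x) (s, x))"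
    by (rule continuous_on_compose2[OF c]) (auto intro!: continuous_intros)
  then have "((\<lambda>s. u s x) \<longlongrightarrow> u 0 x) (at 0 within {0..b})" using b by (simp add: continuous_on_def)
  then have lim: "((\<lambda>s. u s x) \<longlongrightarrow> u 0 x) (at_right 0)"
    by (simp add: at_within_Icc_at_right[OF b(1)])
  have ev: "\<forall>\<^sub>F s in at_right 0. s \<in> {0<..<b}" using b(1) by (rule eventually_at_right_real)
  have tb: "t \<in> {0<..<b}" using t0 b by auto
  have limE: "((\<lambda>s. exp (K * \<bar>t - s\<bar>)) \<longlongrightarrow> exp (K * \<bar>t - 0\<bar>)) (at_right 0)"
    by (intro tendsto_intros)
  have 1: "u t x \<le> exp (K * \<bar>t - 0\<bar>) * u 0 x"
    by (rule tendsto_lowerbound[OF tendsto_mult[OF limE lim]])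
       (use ev in \<open>eventually_elim, use K tb in auto\<close>)
  have 2: "u 0 x \<le> exp (K * \<bar>t - 0\<bar>) * u t x"
  proof (rule tendsto_le[OF _ tendsto_mult[OF limE tendsto_const] lim])
    show "\<forall>\<^sub>F s in at_right 0. u s x \<le> exp (K * \<bar>t - s\<bar>) * u t x"
      using ev by eventually_elim (use K[OF tb] in \<open>simp add: abs_minus_commute\<close>)
  qed simp
  show ?thesis
  proof
    assume "u t x > 0"
    with 1 have "0 < exp (K * \<bar>t - 0\<bar>) * u 0 x" by linarith
    then show "u 0 x > 0" by (simp add: zero_less_mult_iff)
  next
    assume "u 0 x > 0"
    with 2 have "0 < exp (K * \<bar>t - 0\<bar>) * u t x" by linarith
    then show "u t x > 0" by (simp add: zero_less_mult_iff)
  qed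
qed simp

text \<open>
  The function \<open>u powr 0\<close> takes the values \<open>0\<close> and \<open>1\<close> only, so it cannot change continuously.
\<close>

lemma stationary_positivity_set_indicator:
  fixes u :: "real \<Rightarrow> real ^ 'n \<Rightarrow> real"
  assumes nonneg: "\<And>t x. t \<ge> 0 \<Longrightarrow> 0 \<le> u t x"
    and lip: "L-lipschitz_on ({0..<T} \<times> UNIV) (\<lambda>(t, x). u t x powr 0)" and t: "t \<in> {0..<T}"
  shows "u t x > 0 \<longleftrightarrow> u 0 x > 0"
proof -
  define h where "h s = u s x powr 0" for s
  have "continuous_on {0..t} (\<lambda>s. (\<lambda>(t, x). u t x powr 0) (s, x))"
    by (rule continuous_on_compose2[OF lipschitz_on_continuous_on[OF lip]]) (use t in \<open>auto intro!: continuous_intros\<close>)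
  then have c: "continuous_on {0..t} h" by (simp add: h_def)
  have h: "h s = 0 \<or> h s = 1" for s by (simp add: h_def)
  have "h t = h 0"
  proof (rule ccontr)
    assume "h t \<noteq> h 0"
    then have "h 0 = 0 \<and> h t = 1 \<or> h 0 = 1 \<and> h t = 0" using h[of t] h[of 0] by auto
    then have "\<exists>s. h s = 1 / 2"
      using IVT'[of h 0 "1 / 2" t] IVT2'[of h t "1 / 2" 0] c t by auto
    then show False using h by (metis divide_eq_0_iff divide_eq_1_iff one_neq_zero numeral_eq_one_iff verit_eq_simplify(10) zero_neq_numeral)
  qed
  then show ?thesis using nonneg[of t x] nonneg[of 0 x] t by (auto simp: h_def split: if_splits)
qed

section \<open>The waiting time theorem\<close>

theorem theorem1p9:
  fixes m :: real
    and g u0 :: "real ^ 'n \<Rightarrow> real"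
    and u :: "real \<Rightarrow> real ^ 'n \<Rightarrow> real"
    and S :: "real \<Rightarrow> real"
  assumes "m \<ge> 1"
    and "green_kernel g"
    and "periodic u0" and "essentially_bounded torus u0" and "AE x in torus. 0 \<le> u0 x"
    and "constructed_solution m g u0 u"
    and S: "\<And>t. S t = support_size (u t)"
    and "S 0 < 1"
  shows "(no_waiting_condition m (S 0) u0 \<longrightarrow> (AE t in lebesgue. t > 0 \<longrightarrow> S t > S 0)) \<and>
         (\<forall>T>0. (\<exists>L. L-lipschitz_on ({0..<T} \<times> UNIV) (\<lambda>(t, x). u t x powr (m - 1))) \<longrightarrow>
            (\<forall>t\<in>{0..<T}. S t = S 0))"
proof -
  have u: "\<And>t. t \<ge> 0 \<Longrightarrow> periodic (u t)" "\<And>t x. t \<ge> 0 \<Longrightarrow> 0 \<le> u t x" "weak_solution m g u0 u"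
    and "vanishing_viscosity_limit m g u0 u"
    using assms(6) unfolding constructed_solution_def entropy_solution_def by blast+
  then obtain \<omega> :: "real \<Rightarrow> real ^ 'n \<Rightarrow> real" where \<omega>: "mollifiers \<omega>"
    unfolding vanishing_viscosity_limit_def by blast
  have "AE t in lebesgue. t > 0 \<longrightarrow> S t > S 0" if "no_waiting_condition m (S 0) u0"
    using no_waiting_time[OF assms(1-6)] assms(8) that unfolding S by blast
  moreover have "S t = S 0"
    if lip: "L-lipschitz_on ({0..<T} \<times> UNIV) (\<lambda>(t, x). u t x powr (m - 1))" and t: "t \<in> {0..<T}" for T L t
  proof -
    have "u t x > 0 \<longleftrightarrow> u 0 x > 0" for x
    proof (cases "m = 1")
      case True
      then show ?thesis using stationary_positivity_set_indicator[of u L T t x] u(2) lip t by simp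
    next
      case False
      then show ?thesis
        using assms(1) by (intro stationary_positivity_set[OF _ assms(2) \<omega> u(3,1,2) lip t]) auto
    qed
    then show ?thesis unfolding S support_size_def by simp
  qed
  ultimately show ?thesis by blast
qed

end
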